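(* Let $n\ge2$ and let $\mathrm P_*=(\Lambda,\chi,\Theta,\ell,\kappa,\vartheta)$ be the coordinates defined in the context, on the region of the phase space where they are well defined. Then: (1) The action-angle coordinates $\mathrm P_*=(\Lambda,\chi,\Theta,\ell,\kappa,\vartheta)$ are canonical, i.e. $$\sum_{i=1}^n d\Lambda_i\wedge d\ell_i+\sum_{j=0}^{n-1}d\chi_j\wedge d\kappa_j+\sum_{j=0}^{n-1}d\Theta_j\wedge d\vartheta_j=\sum_{i=1}^n\sum_{j=1}^3dy^{(i)}_j\wedge dx^{(i)}_j .$$ (2) Letting $H_{\chi_0}$ denote the Hamiltonian $H_{\rm hel}$ expressed in these variables, $\Theta_0,\vartheta_0,\chi_0$ are integrals of motion for $H_{\chi_0}$, which so takes the form $$H_{\chi_0}=h_{\rm K}(\Lambda)+\mu f_{\chi_0}(\Lambda,\bar\chi,\bar\Theta,\ell,\bar\kappa,\bar\vartheta),\qquad h_{\rm K}(\Lambda)=-\sum_{i=1}^n\frac{\mathfrak m_i^3\mathfrak M_i^2}{2\Lambda_i^2},$$ where $f_{\chi_0}$ depends parametrically on $\chi_0$ and does not depend on $\Theta_0,\vartheta_0,\kappa_0$. (3) In these variables, the reflection transformation $$(y_1^{(i)},y_2^{(i)},y_3^{(i)},x_1^{(i)},x_2^{(i)},x_3^{(i)})\to(y_1^{(i)},-y_2^{(i)},y_3^{(i)},x_1^{(i)},-x_2^{(i)},x_3^{(i)}),\qquad 1\le i\le n,$$ is $$(\Lambda,\chi,\Theta,\ell,\kappa,\vartheta)\to(\Lambda,\chi,-\Theta,\ell,\kappa,-\vartheta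 \bmod 2\pi\mathbb Z^n).$$ (4) Therefore, any of the points $$(\Theta,\vartheta)=(0,\pi k),\qquad k\in\{0,1\}^n,\qquad \vartheta \bmod 2\pi\mathbb Z^n,$$ which represents a planar configuration, is an equilibrium point for the function $(\bar\Theta,\bar\vartheta)\to f_{\chi_0}(\Lambda,\bar\chi,\bar\Theta,\ell,\bar\kappa,\bar\vartheta)$, i.e. the gradient of this function with respect to $(\bar\Theta,\bar\vartheta)$ vanishes at $\bar\Theta=0$, $\bar\vartheta=\pi\bar k$, $\bar k\in\{0,1\}^{n-1}$, for all values of the remaining variables.
   Context: Hamiltonian. For masses $m_0,m_1,\dots,m_n>0$ and $\mu>0$, put $\mathfrak m_i=\frac{m_0m_i}{m_0+\mu m_i}$, $\mathfrak M_i=m_0+\mu m_i$. On $(y,x)=(y^{(1)},\dots,y^{(n)},x^{(1)},\dots,x^{(n)})\in(\mathbb R^3)^n\times(\mathbb R^3)^n$ (no collisions), $$H_{\rm hel}(y,x)=\sum_{i=1}^n\Big(\frac{|y^{(i)}|^2}{2\mathfrak m_i}-\frac{\mathfrak m_i\mathfrak M_i}{|x^{(i)}|}\Big)+\mu\sum_{1\le i<j\le n}\Big(\frac{y^{(i)}\cdot y^{(j)}}{m_0}-\frac{m_im_j}{|x^{(i)}-x^{(j)}|}\Big).$$ Orbital elements. On the region where each two-body term $\frac{|y^{(i)}|^2}{2\mathfrak m_i}-\frac{\mathfrak m_i\mathfrak M_i}{|x^{(i)}|}$ is negative and $C^{(i)}:=x^{(i)}\times y^{(i)}\ne0$, let $\mathfrak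 E_i$ be the instantaneous Kepler ellipse through $(x^{(i)},y^{(i)})$ (the orbit of the $i$-th two-body term, with one focus at the origin), $a^{(i)}$ its semi-major axis, $e^{(i)}$ its eccentricity, assumed in $(0,1)$, $P^{(i)}$ (with $|P^{(i)}|=1$) the direction from the origin to its perihelion, $\mathcal A^{(i)}$ the area spanned by $x^{(i)}$ on $\mathfrak E_i$ starting from $P^{(i)}$ (in the direction of motion), and $\mathcal A^{(i)}_{\rm tot}=\pi (a^{(i)})^2\sqrt{1-(e^{(i)})^2}$ the total area. Nodes. Let $(k^{(1)},k^{(2)},k^{(3)})$ be the standard orthonormal frame of $\mathbb R^3$, and $$S^{(j)}:=\sum_{k=j}^nC^{(k)},\quad 1\le j\le n,$$ so $S^{(1)}=C$ is the total angular momentum and $S^{(n)}=C^{(n)}$. Define $$\tilde\nu_1:=k^{(3)}\times C,\qquad \tilde{\rm n}_j:=S^{(j)}\times P^{(j)},\quad \tilde\nu_{j+1}:=P^{(j)}\times S^{(j+1)}\quad(1\le j\le n-1),\qquad \tilde{\rm n}_n:=P^{(n)}.$$ For a nonzero vector $w$ and nonzero vectors $u,v$ orthogonal to $w$, $\alpha_w(u,v)\in\mathbb T=\mathbb R/2\pi\mathbb Z$ denotes the oriented angle from $u$ to $v$ in the plane orthogonal to $w$, positively oriented (counterclockwise) with respect to $w$. Coordinates $\mathrm P_*$. $\Lambda=(\Lambda_1,\dots,\Lambda_n)$, $\ell=(\ell_1,\dots,\ell_n)\in\mathbb T^n$, $\chi=(\chi_0,\bar\chi)$ with $\bar\chi=(\chi_1,\dots,\chi_{n-1})$,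 $\kappa=(\kappa_0,\bar\kappa)\in\mathbb T\times\mathbb T^{n-1}$ with $\bar\kappa=(\kappa_1,\dots,\kappa_{n-1})$, $\Theta=(\Theta_0,\bar\Theta)$ with $\bar\Theta=(\Theta_1,\dots,\Theta_{n-1})$, $\vartheta=(\vartheta_0,\bar\vartheta)\in\mathbb T\times\mathbb T^{n-1}$ with $\bar\vartheta=(\vartheta_1,\dots,\vartheta_{n-1})$, are defined by - $\Theta_0:=C\cdot k^{(3)}$, $\vartheta_0:=\alpha_{k^{(3)}}(k^{(1)},\tilde\nu_1)$; - $\Theta_{j-1}:=S^{(j)}\cdot P^{(j-1)}$, $\vartheta_{j-1}:=\alpha_{P^{(j-1)}}(\tilde{\rm n}_{j-1},\tilde\nu_j)$ for $2\le j\le n$; - $\chi_{j-1}:=|S^{(j)}|$, $\kappa_{j-1}:=\alpha_{S^{(j)}}(\tilde\nu_j,\tilde{\rm n}_j)$ for $1\le j\le n$; - $\Lambda_i:=\mathfrak m_i\sqrt{\mathfrak M_ia^{(i)}}$, $\ell_i:=2\pi\mathcal A^{(i)}/\mathcal A^{(i)}_{\rm tot}$ (mean anomaly of $x^{(i)}$ on $\mathfrak E_i$), for $1\le i\le n$. They are considered on the region where the ellipses $\mathfrak E_i$, the perihelion directions $P^{(i)}$ and the angles $\vartheta_{j-1},\kappa_{j-1},\ell_i$ ($1\le i,j\le n$) are well defined, i.e. where, for all $1\le i,j\le n$, the two-body term $\frac{|y^{(i)}|^2}{2\mathfrak m_i}-\frac{\mathfrak m_i\mathfrak M_i}{|x^{(i)}|}$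 is negative, $C^{(i)}\ne0$, $e^{(i)}\in(0,1)$, and all the vectors $S^{(j)},\tilde\nu_j,\tilde{\rm n}_j$ are nonzero. A planar configuration is one in which all the $C^{(i)}$ are parallel (with the same or opposite verse). *)

theory Defs
  imports "HOL-Analysis.Analysis" "HOL-Library.Real_Mod"
begin

text \<open>
  The bodies \<open>1, \<dots>, n\<close> are indexed by a finite linearly ordered type \<open>'n\<close> with \<open>n = CARD('n)\<close>.
  A point of the phase space is \<open>z = (y, x)\<close>, momenta first. Every coordinate family with \<open>n\<close>
  members is a vector in \<open>real^'n\<close>; the families which are numbered \<open>0, \<dots>, n-1\<close> on paper
  (\<open>\<chi>, \<kappa>, \<Theta>, \<vartheta>\<close>) are indexed here by the body \<open>j\<close>, i.e. component \<open>j\<close> stands for the coordinate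
  with number \<open>j-1\<close>, so the coordinate number \<open>0\<close> is the component \<open>first\<close>.

  The circle \<open>\<real>/2\<pi>\<int>\<close>: angles are given by their representatives in \<open>[0, 2\<pi>)\<close>,
  equality of arbitrary real representatives is congruence modulo \<open>2\<pi>\<close>.
\<close>

type_synonym 'n coord = "real^'n"
type_synonym 'n phase = "(real^3^'n) \<times> (real^3^'n)"

subsection \<open>Angles\<close>

definition oangle :: "real^3 \<Rightarrow> real^3 \<Rightarrow> real^3 \<Rightarrow> real" where
  \<comment> \<open>for \<open>u, v\<close> orthogonal to \<open>w\<close> the complex number is
     \<open>norm u * norm v * (cos \<alpha> + \<i> * sin \<alpha>)\<close>, \<open>\<alpha>\<close> being the angle from \<open>u\<close> to \<open>v\<close>
     counterclockwise with respect to \<open>w\<close>\<close>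
  "oangle w u v = Arg2pi (Complex (u \<bullet> v) (w \<bullet> cross3 u v / norm w))"

definition angle_cong :: "real^'n \<Rightarrow> real^'n \<Rightarrow> bool" where
  "angle_cong \<alpha> \<beta> \<longleftrightarrow> (\<forall>i. [\<alpha> $ i = \<beta> $ i] (rmod (2 * pi)))"

text \<open>Derivative of a map into the torus: the derivative of a local real lift of it.\<close>

definition angle_has_derivative ::
    "('a::real_normed_vector \<Rightarrow> real^'n) \<Rightarrow> ('a \<Rightarrow> real^'n) \<Rightarrow> 'a \<Rightarrow> bool" where
  "angle_has_derivative \<alpha> D z \<longleftrightarrow>
     (\<exists>\<phi>. (\<forall>\<^sub>F w in nhds z. angle_cong (\<phi> w) (\<alpha> w)) \<and> (\<phi> has_derivative D) (at z))"

subsection \<open>Hamiltonian systems\<close>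

definition wedge :: "('a \<Rightarrow> 'b::real_inner) \<Rightarrow> ('a \<Rightarrow> 'b) \<Rightarrow> 'a \<Rightarrow> 'a \<Rightarrow> real" where
  \<comment> \<open>for \<open>'b = real^'n\<close> this is the 2-form \<open>\<Sum>i. \<alpha>\<^sub>i \<and> \<beta>\<^sub>i\<close>\<close>
  "wedge \<alpha> \<beta> u v = \<alpha> u \<bullet> \<beta> v - \<alpha> v \<bullet> \<beta> u"

text \<open>
  Hamilton's equations \<open>y' = - \<partial>H/\<partial>x\<close>, \<open>x' = \<partial>H/\<partial>y\<close> on the time set \<open>J\<close>, i.e.
  \<open>dH = x' \<bullet> dy - y' \<bullet> dx\<close>. They include the differentiability of \<open>H\<close> along the motion; so there
  are no collisions in the motions of \<open>two_body\<close> below.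
\<close>

definition hamiltonian_motion ::
    "('a::real_inner \<times> 'a \<Rightarrow> real) \<Rightarrow> real set \<Rightarrow> (real \<Rightarrow> 'a \<times> 'a) \<Rightarrow> bool" where
  "hamiltonian_motion H J z \<longleftrightarrow>
     (\<forall>t\<in>J. \<exists>y' x'. (z has_vector_derivative (y', x')) (at t within J) \<and>
        (H has_derivative (\<lambda>(\<eta>, \<xi>). x' \<bullet> \<eta> - y' \<bullet> \<xi>)) (at (z t)))"

subsection \<open>Kepler ellipses\<close>

definition two_body :: "real \<Rightarrow> real \<Rightarrow> (real^3) \<times> (real^3) \<Rightarrow> real" where
  "two_body \<mm> \<MM> = (\<lambda>(y, x). (norm y)\<^sup>2 / (2 * \<mm>) - \<mm> * \<MM> / norm x)"

definition two_body_orbit :: "real \<Rightarrow> real \<Rightarrow> (real^3) \<times> (real^3) \<Rightarrow> (real^3) set" where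
  "two_body_orbit \<mm> \<MM> p =
     {snd (z t) | z t. hamiltonian_motion (two_body \<mm> \<MM>) UNIV z \<and> z 0 = p}"

text \<open>
  The ellipse in the plane through the origin orthogonal to \<open>w\<close> with semi-major axis \<open>a\<close>,
  eccentricity \<open>e\<close>, one focus at the origin and perihelion in the direction \<open>P\<close>;
  the other focus is \<open>- 2 a e P\<close>.
\<close>

definition ellipse :: "real^3 \<Rightarrow> real \<Rightarrow> real \<Rightarrow> real^3 \<Rightarrow> (real^3) set" where
  "ellipse w a e P = {q. w \<bullet> q = 0 \<and> norm q + norm (q + (2 * a * e) *\<^sub>R P) = 2 * a}"

definition ellipse_elements ::
    "real \<Rightarrow> real \<Rightarrow> (real^3) \<times> (real^3) \<Rightarrow> real \<Rightarrow> real \<Rightarrow> real^3 \<Rightarrow> bool" where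
  "ellipse_elements \<mm> \<MM> p a e P \<longleftrightarrow>
     0 < a \<and> 0 \<le> e \<and> e < 1 \<and> norm P = 1 \<and> cross3 (snd p) (fst p) \<bullet> P = 0 \<and>
     two_body_orbit \<mm> \<MM> p = ellipse (cross3 (snd p) (fst p)) a e P"

definition semi_major_axis :: "real \<Rightarrow> real \<Rightarrow> (real^3) \<times> (real^3) \<Rightarrow> real" where
  "semi_major_axis \<mm> \<MM> p = (THE a. \<exists>e P. ellipse_elements \<mm> \<MM> p a e P)"

definition eccentricity :: "real \<Rightarrow> real \<Rightarrow> (real^3) \<times> (real^3) \<Rightarrow> real" where
  "eccentricity \<mm> \<MM> p = (THE e. \<exists>a P. ellipse_elements \<mm> \<MM> p a e P)"

definition perihelion :: "real \<Rightarrow> real \<Rightarrow> (real^3) \<times> (real^3) \<Rightarrow> real^3" where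
  \<comment> \<open>meaningful only for nonzero eccentricity\<close>
  "perihelion \<mm> \<MM> p = (THE P. \<exists>a e. ellipse_elements \<mm> \<MM> p a e P)"

text \<open>
  The area of the sector of \<open>ellipse w a e P\<close> swept counterclockwise (with respect to \<open>w\<close>) by the
  segment from the focus at the origin to the ellipse, from the direction \<open>P\<close> to the direction \<open>x\<close>.
  The plane of the ellipse is identified with \<open>real^2\<close> through its orthonormal basis
  \<open>P\<close>, \<open>(w / norm w) \<times> P\<close>.
\<close>

definition sector_area :: "real^3 \<Rightarrow> real \<Rightarrow> real \<Rightarrow> real^3 \<Rightarrow> real^3 \<Rightarrow> real" where
  "sector_area w a e P x = measure lebesgue
     {c :: real^2. let q = (c $ 1) *\<^sub>R P + (c $ 2) *\<^sub>R cross3 (w /\<^sub>R norm w) P in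
        norm q + norm (q + (2 * a * e) *\<^sub>R P) \<le> 2 * a \<and> oangle w P q \<le> oangle w P x}"

definition mean_anomaly :: "real \<Rightarrow> real \<Rightarrow> (real^3) \<times> (real^3) \<Rightarrow> real" where
  \<comment> \<open>\<open>x\<close> moves counterclockwise with respect to \<open>x \<times> y\<close>\<close>
  "mean_anomaly \<mm> \<MM> p =
     (let a = semi_major_axis \<mm> \<MM> p; e = eccentricity \<mm> \<MM> p; P = perihelion \<mm> \<MM> p in
      2 * pi * sector_area (cross3 (snd p) (fst p)) a e P (snd p) / (pi * a\<^sup>2 * sqrt (1 - e\<^sup>2)))"

subsection \<open>The planetary system\<close>

definition first :: "'n::{finite,linorder}" where "first = Min UNIV"

definition final :: "'n::{finite,linorder}" where "final = Max UNIV"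

definition prv :: "'n::{finite,linorder} \<Rightarrow> 'n" where "prv j = Max {k. k < j}"

definition body :: "'n::finite phase \<Rightarrow> 'n \<Rightarrow> (real^3) \<times> (real^3)" where
  "body z i = (fst z $ i, snd z $ i)"

definition angmom :: "'n::finite phase \<Rightarrow> 'n \<Rightarrow> real^3" where
  "angmom z i = cross3 (snd z $ i) (fst z $ i)"

definition S :: "'n::{finite,linorder} phase \<Rightarrow> 'n \<Rightarrow> real^3" where
  "S z j = (\<Sum>k\<in>{j..}. angmom z k)"

definition no_collision :: "'n::finite phase \<Rightarrow> bool" where
  "no_collision z \<longleftrightarrow> (\<forall>i. snd z $ i \<noteq> 0) \<and> (\<forall>i j. i \<noteq> j \<longrightarrow> snd z $ i \<noteq> snd z $ j)"

definition planar :: "'n::finite phase \<Rightarrow> bool" where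
  "planar z \<longleftrightarrow> (\<forall>i j. cross3 (angmom z i) (angmom z j) = 0)"

definition reflect3 :: "real^3 \<Rightarrow> real^3" where
  "reflect3 v = vector [v $ 1, - v $ 2, v $ 3]"

definition reflect :: "'n::finite phase \<Rightarrow> 'n phase" where
  "reflect z = ((\<chi> i. reflect3 (fst z $ i)), (\<chi> i. reflect3 (snd z $ i)))"

text \<open>The vector \<open>v\<close> without its component of number \<open>0\<close>, which is replaced by \<open>0\<close>.\<close>

definition bar :: "'n::{finite,linorder} coord \<Rightarrow> 'n coord" where
  "bar v = (\<chi> j. if j = first then 0 else v $ j)"

context
  fixes m0 \<mu> :: real and m :: "'n::{finite,linorder} coord"
begin

definition red_mass :: "'n \<Rightarrow> real" where
  "red_mass i = m0 * m $ i / (m0 + \<mu> * m $ i)"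

definition tot_mass :: "'n \<Rightarrow> real" where
  "tot_mass i = m0 + \<mu> * m $ i"

definition H_hel :: "'n phase \<Rightarrow> real" where
  "H_hel = (\<lambda>(y, x).
     (\<Sum>i\<in>UNIV. (norm (y $ i))\<^sup>2 / (2 * red_mass i) - red_mass i * tot_mass i / norm (x $ i)) +
     \<mu> * (\<Sum>(i, j)\<in>{(i, j). i < j}. y $ i \<bullet> y $ j / m0 - m $ i * m $ j / norm (x $ i - x $ j)))"

definition h_K :: "'n coord \<Rightarrow> real" where
  "h_K \<Lambda> = - (\<Sum>i\<in>UNIV. red_mass i ^ 3 * (tot_mass i)\<^sup>2 / (2 * (\<Lambda> $ i)\<^sup>2))"

definition Peri :: "'n phase \<Rightarrow> 'n \<Rightarrow> real^3" where
  "Peri z i = perihelion (red_mass i) (tot_mass i) (body z i)"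

text \<open>The nodes \<open>\<nu>\<^sub>j\<close> and \<open>n\<^sub>j\<close>.\<close>

definition node_nu :: "'n phase \<Rightarrow> 'n \<Rightarrow> real^3" where
  "node_nu z j = (if j = first then cross3 (axis 3 1) (S z j) else cross3 (Peri z (prv j)) (S z j))"

definition node_n :: "'n phase \<Rightarrow> 'n \<Rightarrow> real^3" where
  "node_n z j = (if j = final then Peri z j else cross3 (S z j) (Peri z j))"

definition region :: "'n phase set" where
  "region = {z. no_collision z \<and>
     (\<forall>i. two_body (red_mass i) (tot_mass i) (body z i) < 0 \<and> angmom z i \<noteq> 0 \<and>
          eccentricity (red_mass i) (tot_mass i) (body z i) \<in> {0<..<1} \<and>
          S z i \<noteq> 0 \<and> node_nu z i \<noteq> 0 \<and> node_n z i \<noteq> 0)}"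

definition c_Lambda :: "'n phase \<Rightarrow> 'n coord" where
  "c_Lambda z = (\<chi> i. red_mass i *
     sqrt (tot_mass i * semi_major_axis (red_mass i) (tot_mass i) (body z i)))"

definition c_ell :: "'n phase \<Rightarrow> 'n coord" where
  "c_ell z = (\<chi> i. mean_anomaly (red_mass i) (tot_mass i) (body z i))"

definition c_chi :: "'n phase \<Rightarrow> 'n coord" where
  "c_chi z = (\<chi> j. norm (S z j))"

definition c_kappa :: "'n phase \<Rightarrow> 'n coord" where
  "c_kappa z = (\<chi> j. oangle (S z j) (node_nu z j) (node_n z j))"

definition c_Theta :: "'n phase \<Rightarrow> 'n coord" where
  "c_Theta z = (\<chi> j. if j = first then S z j \<bullet> axis 3 1 else S z j \<bullet> Peri z (prv j))"

definition c_theta :: "'n phase \<Rightarrow> 'n coord" where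
  "c_theta z = (\<chi> j. if j = first then oangle (axis 3 1) (axis 1 1) (node_nu z j)
                     else oangle (Peri z (prv j)) (node_n z (prv j)) (node_nu z j))"

text \<open>
  \<open>f \<chi>\<^sub>0 \<Lambda> \<chi> \<Theta> \<ell> \<kappa> \<vartheta>\<close>, the last arguments being barred except for \<open>\<Lambda>\<close> and \<open>\<ell>\<close>, is the perturbing
  function \<open>f\<^bsub>\<chi>\<^sub>0\<^esub>\<close> of \<open>H_hel\<close> in the coordinates. The angles are arbitrary real representatives, hence
  \<open>f\<close> is \<open>2\<pi>\<close>-periodic in them. Nothing is required of \<open>f\<close> at arguments which are not the coordinates
  of a point of \<open>region\<close>.
\<close>

definition perturbing_function ::
    "(real \<Rightarrow> 'n coord \<Rightarrow> 'n coord \<Rightarrow> 'n coord \<Rightarrow>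
       'n coord \<Rightarrow> 'n coord \<Rightarrow> 'n coord \<Rightarrow> real) \<Rightarrow> bool" where
  "perturbing_function f \<longleftrightarrow>
     (\<forall>z\<in>region. \<forall>l k t.
        angle_cong l (c_ell z) \<and> angle_cong k (c_kappa z) \<and> angle_cong t (c_theta z) \<longrightarrow>
        H_hel z = h_K (c_Lambda z) +
          \<mu> * f (c_chi z $ first) (c_Lambda z) (bar (c_chi z)) (bar (c_Theta z)) l (bar k) (bar t))"

end

end

(*
  The two-body orbit is the ellipse determined by the angular momentum C and the Laplace vector e P, and
  the mean anomaly is E - e sin E. In the frame (P, C x P, C) the form dy ^ dx of one body is
  dLambda ^ dl plus the exterior derivative of the 1-form C . omega, where omega is the angular velocity
  of that frame. Since C(i) = S(i) - S(i+1), these 1-forms telescope along the chain of rotations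
    (k3, nu1) -> (S1, nu1) -> (S1, n1) -> (P1, n1) -> (P1, nu2) -> (S2, nu2) -> ...
  whose angles are theta and kappa: a rotation about the axis p by the angle a contributes
  d(S . p) ^ da, so that only d chi ^ d kappa and d Theta ^ d theta survive. Following the same chain, the
  coordinates other than Theta0, theta0, kappa0 determine the configuration up to a rotation; hence
  injectivity and the existence of f. Nondegeneracy of the symplectic form makes the coordinates a
  local diffeomorphism, so that f is differentiable; the reflection makes it even in
  (Theta, theta - pi k), so its gradient vanishes there.
*)
theory Submission
  imports Defs
begin

text \<open>The data are given indirectly: the orbit as a set swept by motions, the elements as
  definite descriptions, the mean anomaly as a Lebesgue measure. Each must first be replaced on
  \<open>region\<close> by a closed formula in position and momentum (\<open>kep_a\<close>,
  \<open>laplace\<close>, \<open>kep_ecc\<close>). This takes an explicit solution of Kepler's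
  problem, since the orbit has to be known to fill its ellipse. In the chain of frames every other
  axis is a node. A node is orthogonal to the angular momentum S carried at that stage, so a turn
  about it contributes d(S . node) = 0. At P(j) the carried momentum changes from S(j) to S(j+1);
  their difference C(j) is orthogonal to P(j), so that both have the same height over P(j). The
  angles jump at 2 pi, hence all derivatives are those of local real lifts. A perturbing function is
  prescribed only at coordinates of configurations, so its differentiability has to be extracted
  from that of H through an inverse chart. Since it does not see \<Theta>0 and \<theta>0, its
  equilibria are tested at configurations in any plane, not only in the one that the reflection
  fixes.\<close>

unbundle cross3_syntax

section \<open>Angles and moving frames\<close>

lemma rcong_2pi_iff: "[a = b] (rmod (2 * pi)) \<longleftrightarrow> (\<exists>n::int. a = b + 2 * pi * n)"
proof
  assume "[a = b] (rmod (2 * pi))"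
  then have "a - 2 * pi * of_int \<lfloor>a / (2 * pi)\<rfloor> = b - 2 * pi * of_int \<lfloor>b / (2 * pi)\<rfloor>"
    by (simp add: rcong_def rmod_def)
  then have "a = b + 2 * pi * of_int (\<lfloor>a / (2 * pi)\<rfloor> - \<lfloor>b / (2 * pi)\<rfloor>)"
    by (simp add: algebra_simps)
  then show "\<exists>n::int. a = b + 2 * pi * n" by blast
next
  assume "\<exists>n::int. a = b + 2 * pi * n"
  then obtain n :: int where "a = b + 2 * pi * n" by blast
  then have "[a = b + n * (2 * pi)] (rmod (2 * pi))" by (simp add: mult.commute)
  moreover have "[b + n * (2 * pi) = b + 0] (rmod (2 * pi))"
    unfolding rcong_add_left_cancel rcong_0_iff by (rule rmod_self_multiple_int)
  ultimately show "[a = b] (rmod (2 * pi))" using rcong_trans by fastforce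
qed

lemma rcong_2pi_iff_cis: "[a = b] (rmod (2 * pi)) \<longleftrightarrow> cis a = cis b"
proof -
  have "cis a = cis b \<longleftrightarrow> (\<exists>n::int. a = b + 2 * pi * n)"
    using sin_cos_eq_iff[of a b] by (auto simp: complex_eq_iff)
  then show ?thesis by (simp add: rcong_2pi_iff)
qed

lemma rcong_2pi_imp_eq:
  assumes "[a = b] (rmod (2 * pi))" "0 \<le> a" "a < 2 * pi" "0 \<le> b" "b < 2 * pi"
  shows "a = b"
  using assms rmod_idem[of a "2 * pi"] rmod_idem[of b "2 * pi"] by (simp add: rcong_def)

lemma cis_Arg2pi: "z \<noteq> 0 \<Longrightarrow> cis (Arg2pi z) = sgn z"
  using cos_Arg2pi[of z] sin_Arg2pi[of z]
  by (simp add: complex_eq_iff sgn_eq field_simps)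

lemma Arg2pi_cis: "0 \<le> t \<Longrightarrow> t < 2 * pi \<Longrightarrow> Arg2pi (cis t) = t"
  by (rule Arg2pi_unique[of 1]) (auto simp: cis_conv_exp)

lemma angle_congD: "angle_cong a b \<Longrightarrow> [a $ i = b $ i] (rmod (2 * pi))"
  by (simp add: angle_cong_def)

lemma angle_cong_sym: "angle_cong a b \<Longrightarrow> angle_cong b a"
  and angle_cong_trans: "angle_cong a b \<Longrightarrow> angle_cong b c \<Longrightarrow> angle_cong a c"
  by (auto simp: angle_cong_def rcong_def)

lemma angle_cong_imp_eq:
  assumes "angle_cong a b" "\<And>i. 0 \<le> a $ i" "\<And>i. a $ i < 2 * pi" "\<And>i. 0 \<le> b $ i" "\<And>i. b $ i < 2 * pi"
  shows "a = b"
  using assms by (auto simp: vec_eq_iff intro!: rcong_2pi_imp_eq dest: angle_congD)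

lemma cross_cross_left: "(a \<times> b) \<times> c = (a \<bullet> c) *\<^sub>R b - (b \<bullet> c) *\<^sub>R a"
  by (simp add: Lagrange cross_skew[of "a \<times> b"] inner_commute)

lemma inner_cross_swap: "a \<bullet> (b \<times> c) = (a \<times> b) \<bullet> c"
  by (metis cross_triple inner_commute)

lemma norm_cross_orthonormal: "p \<bullet> q = 0 \<Longrightarrow> norm p = 1 \<Longrightarrow> norm q = 1 \<Longrightarrow> norm (p \<times> q) = 1"
  using norm_cross[of p q] by (simp add: power2_eq_1_iff) (smt (verit) norm_ge_zero)

lemma orthonormal_expansion:
  assumes "norm p = 1" "norm q = 1" "p \<bullet> q = 0"
  shows "w = (w \<bullet> p) *\<^sub>R p + (w \<bullet> q) *\<^sub>R q + (w \<bullet> (p \<times> q)) *\<^sub>R (p \<times> q)"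
proof -
  let ?n = "p \<times> q"
  have pp: "p \<bullet> p = 1" "q \<bullet> q = 1" using assms by (auto simp: dot_square_norm)
  \<comment> \<open>This double product is minus the projection of \<open>w\<close> to the plane of
    \<open>p\<close> and \<open>q\<close>. Computing the inner product first expresses the same
    vector through \<open>p\<close> and \<open>q\<close>.\<close>
  have "(w \<times> ?n) \<times> ?n = (w \<bullet> ?n) *\<^sub>R ?n - (?n \<bullet> ?n) *\<^sub>R w"
    by (simp add: cross_cross_left)
  moreover have "?n \<bullet> ?n = 1"
    using norm_cross_orthonormal[of p q] assms by (simp add: dot_square_norm)
  moreover have "w \<times> ?n = (w \<bullet> q) *\<^sub>R p - (w \<bullet> p) *\<^sub>R q"
    by (simp add: Lagrange)
  moreover have "p \<times> ?n = - q" "q \<times> ?n = p"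
    using pp assms by (simp_all add: Lagrange inner_commute)
  ultimately show ?thesis
    by (simp add: Cross3.left_diff_distrib cross_mult_left algebra_simps)
qed

lemma cross_eq_0_imp_parallel:
  assumes "norm p = 1" "p \<times> w = 0"
  shows "w = (w \<bullet> p) *\<^sub>R p"
proof -
  have "(p \<times> w) \<times> p = (p \<bullet> p) *\<^sub>R w - (w \<bullet> p) *\<^sub>R p" by (simp add: cross_cross_left)
  then show ?thesis using assms by (simp add: dot_square_norm)
qed

text \<open>Such a \<open>w\<close> would be parallel to two perpendicular directions. Consequently
  an angular velocity is determined by its action on two axes.\<close>

lemma eq_0_if_cross_orthonormal:
  assumes "norm p = 1" "norm q = 1" "p \<bullet> q = 0" "w \<times> p = 0" "w \<times> q = 0"
  shows "w = 0"
proof -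
  have "w = (w \<bullet> p) *\<^sub>R p" 
    using assms cross_eq_0_imp_parallel[of p w] by (simp add: cross_skew[of p])
  moreover have "w = (w \<bullet> q) *\<^sub>R q" 
    using assms cross_eq_0_imp_parallel[of q w] by (simp add: cross_skew[of q])
  ultimately have "w \<bullet> q = 0" using assms(3) by (metis inner_scaleR_left mult_zero_right)
  with \<open>w = (w \<bullet> q) *\<^sub>R q\<close> show ?thesis by simp
qed

subsection \<open>Oriented angles\<close>

lemma oangle_scale:
  assumes "0 < a" "0 < b" "0 < c"
  shows "oangle (a *\<^sub>R w) (b *\<^sub>R u) (c *\<^sub>R v) = oangle w u v"
proof -
  have "Complex ((b *\<^sub>R u) \<bullet> (c *\<^sub>R v)) ((a *\<^sub>R w) \<bullet> cross3 (b *\<^sub>R u) (c *\<^sub>R v) / norm (a *\<^sub>R w)) =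
     of_real (b * c) * Complex (u \<bullet> v) (w \<bullet> cross3 u v / norm w)"
    using assms by (simp add: complex_eq_iff cross_mult_left cross_mult_right)
  moreover have "0 < b * c" using assms by simp
  ultimately show ?thesis unfolding oangle_def by (metis Arg2pi_times_of_real)
qed

text \<open>The coordinates are defined with nodes of arbitrary length, whereas all moving frames
  below consist of unit vectors; this passes from one to the other.\<close>

lemma oangle_sgn:
  assumes "w \<noteq> 0" "u \<noteq> 0" "v \<noteq> 0"
  shows "oangle (sgn w) (sgn u) (sgn v) = oangle w u v"
  using assms oangle_scale[of "inverse (norm w)" "inverse (norm u)" "inverse (norm v)" w u v]
  by (simp add: sgn_div_norm)

lemma oangle_bounds: "0 \<le> oangle w u v" "oangle w u v < 2 * pi"
  by (simp_all add: oangle_def Arg2pi_ge_0 Arg2pi_lt_2pi)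

lemma rotated_expansion:
  assumes "norm p = 1" "norm u = 1" "u \<bullet> p = 0" "v \<bullet> p = 0"
  shows "v = (u \<bullet> v) *\<^sub>R u + (p \<bullet> (u \<times> v)) *\<^sub>R (p \<times> u)"
proof -
  have "v \<bullet> (p \<times> u) = p \<bullet> (u \<times> v)"
    by (metis cross_triple inner_commute)
  then show ?thesis
    using orthonormal_expansion[of p u v] assms by (simp add: inner_commute)
qed

lemma norm_orthonormal_comb:
  assumes "norm p = 1" "norm q = 1" "p \<bullet> q = 0"
  shows "(norm (a *\<^sub>R p + b *\<^sub>R q))\<^sup>2 = a\<^sup>2 + b\<^sup>2"
proof -
  have "p \<bullet> p = 1" "q \<bullet> q = 1" "q \<bullet> p = 0" using assms by (auto simp: dot_square_norm inner_commute)
  then show ?thesis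
    using assms unfolding power2_norm_eq_inner by (simp add: inner_simps power2_eq_square)
qed

text \<open>By Pythagoras the complex number under \<open>Arg2pi\<close> has modulus one. The first
  form serves the differentiation of the angle, the second the reconstruction of \<open>v\<close>
  from it.\<close>

lemma oangle_unit:
  assumes "norm p = 1" "norm u = 1" "norm v = 1" "u \<bullet> p = 0" "v \<bullet> p = 0"
  shows "cis (oangle p u v) = Complex (u \<bullet> v) (p \<bullet> (u \<times> v))"
    and "v = cos (oangle p u v) *\<^sub>R u + sin (oangle p u v) *\<^sub>R (p \<times> u)"
proof -
  let ?z = "Complex (u \<bullet> v) (p \<bullet> (u \<times> v))"
  have "(norm v)\<^sup>2 = (u \<bullet> v)\<^sup>2 + (p \<bullet> (u \<times> v))\<^sup>2"
    using rotated_expansion[of p u v] assms norm_orthonormal_comb[of u "p \<times> u"] norm_cross_orthonormal[of p u]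
    by (metis dot_cross_self(2) inner_commute)
  then have "cmod ?z = 1" using assms by (simp add: complex_norm)
  then have "?z \<noteq> 0" "sgn ?z = ?z" by (auto simp: sgn_eq)
  then show c: "cis (oangle p u v) = ?z"
    using cis_Arg2pi[of ?z] assms by (simp add: oangle_def)
  then have "cos (oangle p u v) = u \<bullet> v" "sin (oangle p u v) = p \<bullet> (u \<times> v)"
    by (auto simp: complex_eq_iff)
  then show "v = cos (oangle p u v) *\<^sub>R u + sin (oangle p u v) *\<^sub>R (p \<times> u)"
    using rotated_expansion[of p u v] assms by simp
qed

subsection \<open>Angular velocity of moving frames\<close>

text \<open>
  If the orthonormal pair \<open>(p, q)\<close> moves with velocity \<open>(p', q')\<close>, \<open>spin p p' q q'\<close> is its angular
  velocity.
\<close>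

definition spin :: "real^3 \<Rightarrow> real^3 \<Rightarrow> real^3 \<Rightarrow> real^3 \<Rightarrow> real^3" where
  "spin p p' q q' = p \<times> p' + (q' \<bullet> (p \<times> q)) *\<^sub>R p"

lemma spin_cross_first:
  assumes "norm p = 1" "p \<bullet> p' = 0"
  shows "spin p p' q q' \<times> p = p'"
  using assms by (simp add: spin_def cross_add_left cross_mult_left cross_cross_left inner_commute dot_square_norm)

lemma spin_cross_second:
  assumes "norm p = 1" "norm q = 1" "p \<bullet> q = 0" "q \<bullet> q' = 0" "p' \<bullet> q + p \<bullet> q' = 0"
  shows "spin p p' q q' \<times> q = q'"
proof -
  have "p \<bullet> q' = - (p' \<bullet> q)" using assms(5) by linarith
  then have "spin p p' q q' \<times> q = (q' \<bullet> p) *\<^sub>R p + (q' \<bullet> (p \<times> q)) *\<^sub>R (p \<times> q)"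
    using assms(3) by (simp add: spin_def cross_add_left cross_mult_left cross_cross_left inner_commute)
  also have "\<dots> = q'"
    using orthonormal_expansion[OF assms(1-3), of q'] assms(4) by (simp add: inner_commute)
  finally show ?thesis .
qed

text \<open>Both sides are the angular velocity of the same rigid frame. This makes it possible to
  take either leg of a frame as the axis of the next rotation.\<close>

lemma spin_commute:
  assumes "norm p = 1" "norm q = 1" "p \<bullet> q = 0" "p \<bullet> p' = 0" "q \<bullet> q' = 0" "p' \<bullet> q + p \<bullet> q' = 0"
  shows "spin p p' q q' = spin q q' p p'"
proof -
  have "q' \<bullet> p + q \<bullet> p' = 0" using assms(6) by (simp add: inner_commute)
  then have "(spin p p' q q' - spin q q' p p') \<times> p = 0" "(spin p p' q q' - spin q q' p p') \<times> q = 0"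
    using assms by (simp_all add: Cross3.left_diff_distrib spin_cross_first spin_cross_second inner_commute)
  then have "spin p p' q q' - spin q q' p p' = 0"
    by (rule eq_0_if_cross_orthonormal[OF assms(1-3)])
  then show ?thesis by simp
qed

text \<open>
  The value at two tangent vectors \<open>u, v\<close> of the exterior derivative of the 1-form \<open>S \<bullet> \<omega>\<close>,
  where \<open>\<omega>\<close> is the angular velocity of a moving frame; by the Maurer-Cartan equation
  no second derivatives occur in it.
\<close>

definition frame_form :: "real^3 \<Rightarrow> ('a \<Rightarrow> real^3) \<Rightarrow> ('a \<Rightarrow> real^3) \<Rightarrow> 'a \<Rightarrow> 'a \<Rightarrow> real" where
  "frame_form s s' \<omega> u v = s' u \<bullet> \<omega> v - s' v \<bullet> \<omega> u + s \<bullet> (\<omega> u \<times> \<omega> v)"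

text \<open>Additivity in the angular momentum is what permits the splitting of S(j) into C(j) and
  S(j+1) inside one frame.\<close>

lemma frame_form_add:
  "frame_form (a + b) (\<lambda>h. a' h + b' h) \<omega> u v = frame_form a a' \<omega> u v + frame_form b b' \<omega> u v"
  by (simp add: frame_form_def inner_simps)

lemma frame_form_zero [simp]: "frame_form 0 (\<lambda>h. 0) \<omega> u v = 0" "frame_form s s' (\<lambda>h. 0) u v = 0"
  by (simp_all add: frame_form_def)

text \<open>A further rotation of the frame about its axis \<open>p\<close> by the angle \<open>\<theta>\<close> adds \<open>d (S \<bullet> p) \<and> d\<theta>\<close>.\<close>

lemma frame_form_rotate:
  assumes "\<And>h. \<omega>2 h = \<omega>1 h + \<theta>' h *\<^sub>R p" "\<And>h. \<omega>1 h \<times> p = p' h" "\<And>h. t' h = s' h \<bullet> p + s \<bullet> p' h"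
  shows "frame_form s s' \<omega>2 u v = frame_form s s' \<omega>1 u v + (t' u * \<theta>' v - t' v * \<theta>' u)"
  unfolding frame_form_def assms(1) assms(3) assms(2)[symmetric]
  by (simp add: inner_simps cross_add_left cross_add_right cross_mult_left cross_mult_right cross_skew[of p "\<omega>1 v"] algebra_simps)

text \<open>\<open>p\<close> and \<open>q\<close> are the velocities of position \<open>x\<close> and momentum \<open>y\<close> relative to the rotating frame.\<close>

lemma wedge_rotating:
  fixes x y :: "real^3"
  assumes "\<And>h. x' h = p h + \<omega> h \<times> x" "\<And>h. y' h = q h + \<omega> h \<times> y"
    and "\<And>h. c' h = x' h \<times> y + x \<times> y' h"
  shows "y' u \<bullet> x' v - y' v \<bullet> x' u = (q u \<bullet> p v - q v \<bullet> p u) + frame_form (x \<times> y) c' \<omega> u v"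
proof -
  have 1: "c' h \<bullet> w = q h \<bullet> (w \<times> x) - p h \<bullet> (w \<times> y) + w \<bullet> (\<omega> h \<times> (x \<times> y))" for h w
    unfolding assms by (simp add: cross3_simps)
  have 2: "w \<bullet> (w' \<times> (x \<times> y)) = (w' \<bullet> y) * (w \<bullet> x) - (w' \<bullet> x) * (w \<bullet> y)" for w w'
    by (simp add: Lagrange inner_simps inner_commute)
  have 3: "(x \<times> y) \<bullet> (\<omega> u \<times> \<omega> v) = (\<omega> u \<bullet> x) * (\<omega> v \<bullet> y) - (\<omega> v \<bullet> x) * (\<omega> u \<bullet> y)"
    by (simp add: dot_cross inner_commute)
  \<comment> \<open>The terms quadratic in \<omega> balance: the two products of \<open>c'\<close>
    with \<omega> give -2 times the triple product of \<open>x \<times> y\<close> with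
    \<open>\<omega> u\<close>, \<open>\<omega> v\<close>, the last summand of
    \<open>frame_form\<close> adds one, and the left side contains it with factor -1.\<close>
  show ?thesis
    unfolding frame_form_def 1 2 3 assms(1,2)
    by (simp add: inner_simps dot_cross inner_commute algebra_simps)
qed

subsection \<open>Local lifts of angles\<close>

lemma bounded_bilinear_cross3: "bounded_bilinear cross3"
  using bilinear_cross bilinear_conv_bounded_bilinear by blast

lemmas has_derivative_cross3 = bounded_bilinear.FDERIV[OF bounded_bilinear_cross3]
lemmas continuous_on_cross3 [continuous_intros] = continuous_on_cross

lemma times_one_eq_id: "(*) (1::'a::monoid_mult) = (\<lambda>h. h)"
  by (rule ext) simp

text \<open>Near \<open>z\<close> the quotient \<open>F w / F z\<close> stays in the right half
  plane, where the principal logarithm is smooth. Its imaginary part, shifted by the constant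
  \<open>Arg2pi (F z)\<close>, is an argument of \<open>F\<close> without the jump of
  \<open>Arg2pi\<close>.\<close>

lemma arg_lift:
  fixes F :: "'a::real_normed_vector \<Rightarrow> complex"
  assumes U: "open U" "z \<in> U" and cont: "continuous_on U F" and nz: "\<And>w. w \<in> U \<Longrightarrow> F w \<noteq> 0"
    and F': "(F has_derivative F') (at z)"
  obtains V \<phi> where "open V" "z \<in> V" "V \<subseteq> U" "continuous_on V \<phi>"
    "\<And>w. w \<in> V \<Longrightarrow> cis (\<phi> w) = sgn (F w)"
    "(\<phi> has_derivative (\<lambda>h. Im (F' h / F z))) (at z)"
proof
  define \<phi> where "\<phi> w = Arg2pi (F z) + Im (Ln (F w / F z))" for w
  define V where "V = {w \<in> U. F w / F z \<in> {t. Re t > 0}}"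
  have [simp]: "F z \<noteq> 0" using nz U by auto
  have c: "continuous_on U (\<lambda>w. F w / F z)"
    by (intro continuous_intros cont) auto
  have V_eq: "V = U \<inter> (\<lambda>w. F w / F z) -` {t. Re t > 0}" by (auto simp: V_def)
  show "open V" unfolding V_eq
    using c U open_halfspace_Re_gt[of 0] by (intro continuous_open_preimage)
  show "z \<in> V" using U by (simp add: V_def)
  show "V \<subseteq> U" by (auto simp: V_def)
  have nr: "F w / F z \<notin> \<real>\<^sub>\<le>\<^sub>0" if "w \<in> V" for w
    using that by (auto simp: V_def complex_nonpos_Reals_iff)
  show "continuous_on V \<phi>"
    unfolding \<phi>_def using nr by (intro continuous_intros continuous_on_subset[OF c \<open>V \<subseteq> U\<close>]) auto
  show "cis (\<phi> w) = sgn (F w)" if "w \<in> V" for w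
  proof -
    have "F w \<noteq> 0" using that nz \<open>V \<subseteq> U\<close> by auto
    then have "exp (Ln (F w / F z)) = F w / F z" by simp
    then have "cmod (F w / F z) *\<^sub>R cis (Im (Ln (F w / F z))) = F w / F z"
      using \<open>F w \<noteq> 0\<close> \<open>F z \<noteq> 0\<close> by (metis exp_eq_polar norm_exp_eq_Re scaleR_conv_of_real)
    then have "cis (Im (Ln (F w / F z))) = sgn (F w / F z)"
      using \<open>F w \<noteq> 0\<close> by (auto simp: sgn_eq norm_divide scaleR_conv_of_real field_simps)
    then show ?thesis
      by (simp add: \<phi>_def cis_mult[symmetric] cis_Arg2pi sgn_eq norm_divide)
  qed
  have "((\<lambda>w. F w / F z) has_derivative (\<lambda>h. F' h / F z)) (at z)"
    using bounded_linear.has_derivative[OF bounded_linear_divide F'] .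
  moreover have "(Ln has_derivative (\<lambda>h. h)) (at (F z / F z))"
    using has_field_derivative_Ln[of 1] by (auto simp: has_field_derivative_def times_one_eq_id)
  ultimately have "((\<lambda>w. Ln (F w / F z)) has_derivative (\<lambda>h. F' h / F z)) (at z)"
    using has_derivative_compose[of "\<lambda>w. F w / F z" _ z UNIV Ln "\<lambda>h. h"] by simp
  then have "((\<lambda>w. Im (Ln (F w / F z))) has_derivative (\<lambda>h. Im (F' h / F z))) (at z)"
    by (rule bounded_linear.has_derivative[OF bounded_linear_Im])
  then show "(\<phi> has_derivative (\<lambda>h. Im (F' h / F z))) (at z)"
    unfolding \<phi>_def using has_derivative_add[OF has_derivative_const[of "Arg2pi (F z)"]] by fastforce
qed

lemma inner_derivative_zero_if_norm_1:
  fixes p :: "'a::real_normed_vector \<Rightarrow> 'b::real_inner"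
  assumes "open U" "z \<in> U" "(p has_derivative p') (at z)" "\<And>w. w \<in> U \<Longrightarrow> norm (p w) = 1"
  shows "p z \<bullet> p' h = 0"
proof -
  have "((\<lambda>w. p w \<bullet> p w) has_derivative (\<lambda>h. p z \<bullet> p' h + p' h \<bullet> p z)) (at z)"
    by (intro has_derivative_inner assms)
  moreover have "((\<lambda>w. p w \<bullet> p w) has_derivative (\<lambda>h. 0)) (at z)"
    using assms by (intro has_derivative_transform_within_open[OF has_derivative_const[of 1]])
       (auto simp: dot_square_norm)
  ultimately have "(\<lambda>h. p z \<bullet> p' h + p' h \<bullet> p z) = (\<lambda>h. 0)"
    by (rule has_derivative_unique)
  then have "p z \<bullet> p' h + p' h \<bullet> p z = 0" by metis
  then show ?thesis by (simp add: inner_commute)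
qed

lemma inner_derivative_if_orthogonal:
  fixes p q :: "'a::real_normed_vector \<Rightarrow> 'b::real_inner"
  assumes "open U" "z \<in> U" "(p has_derivative p') (at z)" "(q has_derivative q') (at z)"
    "\<And>w. w \<in> U \<Longrightarrow> p w \<bullet> q w = 0"
  shows "p' h \<bullet> q z + p z \<bullet> q' h = 0"
proof -
  have "((\<lambda>w. p w \<bullet> q w) has_derivative (\<lambda>h. p z \<bullet> q' h + p' h \<bullet> q z)) (at z)"
    by (intro has_derivative_inner assms)
  moreover have "((\<lambda>w. p w \<bullet> q w) has_derivative (\<lambda>h. 0)) (at z)"
    using assms by (intro has_derivative_transform_within_open[OF has_derivative_const[of 0]]) auto
  ultimately have "(\<lambda>h. p z \<bullet> q' h + p' h \<bullet> q z) = (\<lambda>h. 0)"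
    by (rule has_derivative_unique)
  then have "p z \<bullet> q' h + p' h \<bullet> q z = 0" by metis
  then show ?thesis by simp
qed

text \<open>The derivative is the rate at which \<open>v\<close> turns about \<open>p\<close> minus
  that of \<open>u\<close>. The motion of the axis drops out because \<open>u \<times> v\<close> is
  parallel to \<open>p\<close> while \<open>p'\<close> is orthogonal to \<open>p\<close>.\<close>

lemma oangle_lift:
  fixes p u v :: "'a::real_normed_vector \<Rightarrow> real^3"
  assumes U: "open U" "z \<in> U"
    and cont: "continuous_on U p" "continuous_on U u" "continuous_on U v"
    and p': "(p has_derivative p') (at z)" and u': "(u has_derivative u') (at z)"
    and v': "(v has_derivative v') (at z)"
    and unit: "\<And>w. w \<in> U \<Longrightarrow> norm (p w) = 1 \<and> norm (u w) = 1 \<and> norm (v w) = 1"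
    and orth: "\<And>w. w \<in> U \<Longrightarrow> u w \<bullet> p w = 0 \<and> v w \<bullet> p w = 0"
  obtains V \<phi> where "open V" "z \<in> V" "V \<subseteq> U" "continuous_on V \<phi>"
    "\<And>w. w \<in> V \<Longrightarrow> [\<phi> w = oangle (p w) (u w) (v w)] (rmod (2 * pi))"
    "(\<phi> has_derivative (\<lambda>h. v' h \<bullet> (p z \<times> v z) - u' h \<bullet> (p z \<times> u z))) (at z)"
proof -
  define F where "F w = Complex (u w \<bullet> v w) (p w \<bullet> (u w \<times> v w))" for w
  define F' where "F' h = Complex (u z \<bullet> v' h + u' h \<bullet> v z) (p z \<bullet> (u z \<times> v' h + u' h \<times> v z) + p' h \<bullet> (u z \<times> v z))" for h
  have F: "cis (oangle (p w) (u w) (v w)) = F w" if "w \<in> U" for w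
    unfolding F_def using oangle_unit(1) unit[OF that] orth[OF that] by blast
  then have F1: "cmod (F w) = 1" if "w \<in> U" for w using that norm_cis by metis
  have "continuous_on U F"
    unfolding F_def Complex_eq by (intro continuous_intros cont)
  moreover have "(F has_derivative F') (at z)"
  proof -
    have "((\<lambda>w. u w \<bullet> v w) has_derivative (\<lambda>h. u z \<bullet> v' h + u' h \<bullet> v z)) (at z)"
      "((\<lambda>w. p w \<bullet> (u w \<times> v w)) has_derivative
         (\<lambda>h. p z \<bullet> (u z \<times> v' h + u' h \<times> v z) + p' h \<bullet> (u z \<times> v z))) (at z)"
      by (intro has_derivative_inner has_derivative_cross3 p' u' v')+
    then show ?thesis
      unfolding F_def F'_def Complex_eq
      by (intro has_derivative_add has_derivative_mult_right has_derivative_of_real)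
  qed
  ultimately obtain V \<phi> where V: "open V" "z \<in> V" "V \<subseteq> U" "continuous_on V \<phi>"
    "\<And>w. w \<in> V \<Longrightarrow> cis (\<phi> w) = sgn (F w)" "(\<phi> has_derivative (\<lambda>h. Im (F' h / F z))) (at z)"
    using arg_lift[OF U, of F F'] F1 by force
  have "[\<phi> w = oangle (p w) (u w) (v w)] (rmod (2 * pi))" if "w \<in> V" for w
    using V that F1[of w] F[of w] by (auto simp: rcong_2pi_iff_cis sgn_div_norm subset_iff)
  moreover have "Im (F' h / F z) = v' h \<bullet> (p z \<times> v z) - u' h \<bullet> (p z \<times> u z)" for h
  proof -
    define c s where "c = u z \<bullet> v z" and "s = p z \<bullet> (u z \<times> v z)"
    have F_eq: "F z = Complex c s" by (simp add: F_def c_def s_def)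
    have nz: "norm (p z) = 1" "norm (u z) = 1" "u z \<bullet> p z = 0" "v z \<bullet> p z = 0" "p z \<bullet> p z = 1" "u z \<bullet> u z = 1"
      using unit[OF U(2)] orth[OF U(2)] by (auto simp: dot_square_norm)
    have v_eq: "v z = c *\<^sub>R u z + s *\<^sub>R (p z \<times> u z)"
      unfolding c_def s_def using nz by (intro rotated_expansion) auto
    have cs: "c\<^sup>2 + s\<^sup>2 = 1" using F1[OF U(2)] by (simp add: F_eq complex_norm)
    have pp: "p z \<bullet> p' h = 0" "u z \<bullet> u' h = 0"
      using inner_derivative_zero_if_norm_1[OF U p'] inner_derivative_zero_if_norm_1[OF U u'] unit by auto
    have "u z \<times> v z = s *\<^sub>R p z"
      using nz by (simp add: v_eq cross_add_right cross_mult_right Lagrange inner_commute)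
    then have 1: "p' h \<bullet> (u z \<times> v z) = 0" using pp by (simp add: inner_commute)
    have "v z \<times> p z = - c *\<^sub>R (p z \<times> u z) + s *\<^sub>R u z"
      using nz by (simp add: v_eq cross_add_left cross_mult_left cross_cross_left inner_commute cross_skew[of "u z"])
    moreover have "p z \<bullet> (u' h \<times> v z) = (v z \<times> p z) \<bullet> u' h"
      by (subst inner_commute) (rule cross_triple)
    ultimately have 2: "p z \<bullet> (u' h \<times> v z) = - c * (u' h \<bullet> (p z \<times> u z))"
      using pp by (simp add: inner_simps inner_commute)
    have 3: "u' h \<bullet> v z = s * (u' h \<bullet> (p z \<times> u z))"
      using pp by (simp add: v_eq inner_simps inner_commute)
    have 4: "p z \<bullet> (u z \<times> v' h) = v' h \<bullet> (p z \<times> u z)"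
      by (metis cross_triple inner_commute)
    have 5: "v' h \<bullet> (p z \<times> v z) = c * (v' h \<bullet> (p z \<times> u z)) - s * (v' h \<bullet> u z)"
      using nz by (simp add: v_eq cross_add_right cross_mult_right Lagrange inner_simps inner_commute)
    have "F' h = Complex (u z \<bullet> v' h + s * (u' h \<bullet> (p z \<times> u z))) (v' h \<bullet> (p z \<times> u z) - c * (u' h \<bullet> (p z \<times> u z)))"
      by (simp add: F'_def 1 2 3 4 inner_simps)
    then have "Im (F' h / F z) = (v' h \<bullet> (p z \<times> u z) - c * (u' h \<bullet> (p z \<times> u z))) * c
        - (u z \<bullet> v' h + s * (u' h \<bullet> (p z \<times> u z))) * s"
      using cs by (simp add: F_eq Im_divide)
    also have "\<dots> = c * (v' h \<bullet> (p z \<times> u z)) - s * (v' h \<bullet> u z) - (c\<^sup>2 + s\<^sup>2) * (u' h \<bullet> (p z \<times> u z))"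
      by (simp add: algebra_simps inner_commute power2_eq_square)
    finally show ?thesis using cs 5 by simp
  qed
  ultimately show thesis using V that[of V \<phi>] by presburger
qed

section \<open>The Kepler problem\<close>

text \<open>
  Only the combination \<open>k = \<mm>\<^sup>2 \<MM>\<close> matters for the shape of the orbits:
  the semi-major axis is \<open>kep_a k\<close>, the eccentricity is the norm of the Laplace vector.
\<close>

definition kep_a :: "real \<Rightarrow> (real^3) \<times> (real^3) \<Rightarrow> real" where
  "kep_a k p = 1 / (2 / norm (snd p) - (norm (fst p))\<^sup>2 / k)"

definition laplace :: "real \<Rightarrow> (real^3) \<times> (real^3) \<Rightarrow> real^3" where
  "laplace k p = (1 / k) *\<^sub>R (fst p \<times> (snd p \<times> fst p)) - (1 / norm (snd p)) *\<^sub>R snd p"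

text \<open>Negative two-body energy, written through \<open>k\<close> alone. The second condition
  also excludes \<open>x = 0\<close>.\<close>

definition bound :: "real \<Rightarrow> (real^3) \<times> (real^3) \<Rightarrow> bool" where
  "bound k p \<longleftrightarrow> (norm (fst p))\<^sup>2 / k < 2 / norm (snd p) \<and> snd p \<times> fst p \<noteq> 0"

lemma two_body_neg_iff:
  assumes "0 < m" "0 < M"
  shows "two_body m M p < 0 \<longleftrightarrow> (norm (fst p))\<^sup>2 / (m\<^sup>2 * M) < 2 / norm (snd p)"
proof -
  have "two_body m M p = (m * M / 2) * ((norm (fst p))\<^sup>2 / (m\<^sup>2 * M) - 2 / norm (snd p))"
    using assms by (cases p) (auto simp: two_body_def field_simps power2_eq_square)
  moreover have "0 < m * M / 2" using assms by simp
  moreover have "c * t < 0 \<longleftrightarrow> t < 0" if "0 < c" for c t :: real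
    using that by (auto simp: mult_less_0_iff)
  ultimately show ?thesis by (simp only: less_iff_diff_less_0[symmetric])
qed

lemma laplace_inner_angular_momentum: "laplace k p \<bullet> (snd p \<times> fst p) = 0"
  by (simp add: laplace_def inner_simps dot_cross_self)

lemma laplace_inner_position:
  assumes "snd p \<noteq> 0"
  shows "laplace k p \<bullet> snd p = (norm (snd p \<times> fst p))\<^sup>2 / k - norm (snd p)"
proof -
  have "(fst p \<times> (snd p \<times> fst p)) \<bullet> snd p = (norm (snd p \<times> fst p))\<^sup>2"
    unfolding power2_norm_eq_inner by (simp add: cross_triple[of "snd p" "fst p"] inner_commute)
  moreover have "snd p \<bullet> snd p = norm (snd p) * norm (snd p)"
    by (simp add: dot_square_norm power2_eq_square)
  ultimately show ?thesis using assms by (simp add: laplace_def inner_simps)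
qed

context
  fixes k :: real and x y :: "real^3"
  assumes k: "0 < k" and bnd: "bound k (y, x)"
begin

lemma bound_position_nz: "x \<noteq> 0" "x \<times> y \<noteq> 0"
  using bnd by (auto simp: bound_def)

lemma kep_a_pos: "0 < kep_a k (y, x)"
  using bnd by (simp add: kep_a_def bound_def)

text \<open>The first identity ties the eccentricity to the length of the angular momentum. The
  second is \<open>(e cos E)\<^sup>2 + (e sin E)\<^sup>2 = e\<^sup>2\<close> before any anomaly is
  available. Both reduce to the same polynomial in |x|, |y|, x . y.\<close>

lemma norm_laplace:
  "(norm (laplace k (y, x)))\<^sup>2 = 1 - (norm (x \<times> y))\<^sup>2 / (k * kep_a k (y, x))"
  "(1 - norm x / kep_a k (y, x))\<^sup>2 + (x \<bullet> y / sqrt (k * kep_a k (y, x)))\<^sup>2 = (norm (laplace k (y, x)))\<^sup>2"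
proof -
  define r where "r = norm x"
  define d where "d = x \<bullet> y"
  define v where "v = (norm y)\<^sup>2"
  \<comment> \<open>With names for the reciprocals of \<open>k\<close> and \<open>r\<close> both
    claims are polynomial identities modulo \<open>r * \<rho> = 1\<close>.\<close>
  define \<kappa> where "\<kappa> = 1 / k"
  define \<rho> where "\<rho> = 1 / r"
  have r: "0 < r" using bound_position_nz by (simp add: r_def)
  have eq: "x \<bullet> x = r\<^sup>2" "y \<bullet> y = v" "x \<bullet> y = d" "y \<bullet> x = d"
    by (simp_all add: r_def v_def d_def dot_square_norm inner_commute)
  have C: "(norm (x \<times> y))\<^sup>2 = r\<^sup>2 * v - d\<^sup>2" by (simp add: norm_cross r_def v_def d_def)
  have \<rho>: "r * \<rho> = 1" using r by (simp add: \<rho>_def)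
  have ia: "1 / kep_a k (y, x) = 2 * \<rho> - v * \<kappa>" by (simp add: kep_a_def r_def v_def \<rho>_def \<kappa>_def)
  have "laplace k (y, x) = (v * \<kappa> - \<rho>) *\<^sub>R x - (d * \<kappa>) *\<^sub>R y"
    by (simp add: laplace_def Lagrange eq r_def[symmetric] \<kappa>_def \<rho>_def algebra_simps)
  then have "(norm (laplace k (y, x)))\<^sup>2 = (v * \<kappa> - \<rho>)\<^sup>2 * r\<^sup>2 - 2 * (v * \<kappa> - \<rho>) * (d * \<kappa>) * d + (d * \<kappa>)\<^sup>2 * v"
    unfolding power2_norm_eq_inner by (simp add: inner_simps eq) (simp add: power2_eq_square algebra_simps)
  also have "\<dots> = 1 - (r\<^sup>2 * v - d\<^sup>2) * \<kappa> * (2 * \<rho> - v * \<kappa>)"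
    using \<rho> by algebra
  finally have 1: "(norm (laplace k (y, x)))\<^sup>2 = 1 - (r\<^sup>2 * v - d\<^sup>2) * \<kappa> * (2 * \<rho> - v * \<kappa>)" .
  then show "(norm (laplace k (y, x)))\<^sup>2 = 1 - (norm (x \<times> y))\<^sup>2 / (k * kep_a k (y, x))"
    unfolding C ia[symmetric] by (simp add: \<kappa>_def)
  have "(1 - norm x / kep_a k (y, x))\<^sup>2 + (x \<bullet> y / sqrt (k * kep_a k (y, x)))\<^sup>2
      = (1 - r * (1 / kep_a k (y, x)))\<^sup>2 + d\<^sup>2 * \<kappa> * (1 / kep_a k (y, x))"
    using k kep_a_pos by (simp add: power_divide r_def d_def \<kappa>_def)
  also have "\<dots> = 1 - (r\<^sup>2 * v - d\<^sup>2) * \<kappa> * (2 * \<rho> - v * \<kappa>)"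
    unfolding ia using \<rho> by algebra
  finally show "(1 - norm x / kep_a k (y, x))\<^sup>2 + (x \<bullet> y / sqrt (k * kep_a k (y, x)))\<^sup>2 = (norm (laplace k (y, x)))\<^sup>2"
    using 1 by simp
qed

lemma norm_laplace_less_1: "norm (laplace k (y, x)) < 1"
proof -
  have "0 < (norm (x \<times> y))\<^sup>2 / (k * kep_a k (y, x))"
    using k kep_a_pos bound_position_nz by simp
  then have "(norm (laplace k (y, x)))\<^sup>2 < 1\<^sup>2" using norm_laplace(1) by simp
  then show ?thesis by (rule power_less_imp_less_base) simp
qed

lemma norm_angular_momentum:
  "norm (x \<times> y) = sqrt (k * kep_a k (y, x) * (1 - (norm (laplace k (y, x)))\<^sup>2))"
proof -
  have "k * kep_a k (y, x) * (1 - (norm (laplace k (y, x)))\<^sup>2) = (norm (x \<times> y))\<^sup>2"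
    using norm_laplace(1) k kep_a_pos by (simp add: field_simps)
  then show ?thesis by simp
qed

end

lemma sqrt_div_mult:
  fixes a k :: real assumes "0 < a" "0 < k"
  shows "sqrt (k / a) * a = sqrt (k * a)" "sqrt (k / a) * sqrt (k * a) = k"
proof -
  have "sqrt (k / a) * a = sqrt (k / a) * sqrt (a\<^sup>2)" using assms by simp
  also have "\<dots> = sqrt (k * a)"
    unfolding real_sqrt_mult[symmetric] using assms by (simp add: power2_eq_square)
  finally show "sqrt (k / a) * a = sqrt (k * a)" .
  show "sqrt (k / a) * sqrt (k * a) = k"
    unfolding real_sqrt_mult[symmetric] using assms by (simp add: power2_eq_square[symmetric])
qed

text \<open>Position and momentum as functions of the eccentric anomaly \<open>E\<close>.\<close>

definition kpos :: "real \<Rightarrow> real \<Rightarrow> real \<Rightarrow> real^3 \<Rightarrow> real^3 \<Rightarrow> real^3" where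
  "kpos a e E P Q = (a * (cos E - e)) *\<^sub>R P + (a * sqrt (1 - e\<^sup>2) * sin E) *\<^sub>R Q"

definition kmom :: "real \<Rightarrow> real \<Rightarrow> real \<Rightarrow> real \<Rightarrow> real^3 \<Rightarrow> real^3 \<Rightarrow> real^3" where
  "kmom k a e E P Q = (- sqrt (k / a) * sin E / (1 - e * cos E)) *\<^sub>R P
     + (sqrt (k / a) * sqrt (1 - e\<^sup>2) * cos E / (1 - e * cos E)) *\<^sub>R Q"

lemma one_minus_e_cos_pos:
  fixes e :: real assumes "0 \<le> e" "e < 1" shows "0 < 1 - e * cos E"
proof -
  have "e * cos E \<le> e * 1" using assms by (intro mult_left_mono) auto
  then show ?thesis using assms by simp
qed

lemma one_minus_e2_pos: "0 \<le> e \<Longrightarrow> e < 1 \<Longrightarrow> 0 < 1 - (e::real)\<^sup>2"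
  by (simp add: power_less_one_iff abs_square_less_1)

context
  fixes P Q :: "real^3"
  assumes on: "norm P = 1" "norm Q = 1" "P \<bullet> Q = 0"
begin

lemma norm_kpos:
  assumes "0 < a" "0 \<le> e" "e < 1"
  shows "norm (kpos a e E P Q) = a * (1 - e * cos E)"
proof -
  have "(norm (kpos a e E P Q))\<^sup>2 = a\<^sup>2 * ((cos E - e)\<^sup>2 + (1 - e\<^sup>2) * (sin E)\<^sup>2)"
    using one_minus_e2_pos[of e] assms unfolding kpos_def norm_orthonormal_comb[OF on]
    by (simp only: power_mult_distrib distrib_left) simp
  also have "\<dots> = (a * (1 - e * cos E))\<^sup>2"
    by (simp add: sin_squared_eq) (simp add: power2_eq_square algebra_simps)
  finally show ?thesis
    using assms one_minus_e_cos_pos[of e E] by (simp add: power2_eq_iff_nonneg)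
qed

lemma inner_kpos: "P \<bullet> kpos a e E P Q = a * (cos E - e)" "Q \<bullet> kpos a e E P Q = a * sqrt (1 - e\<^sup>2) * sin E"
  using on by (simp_all add: kpos_def inner_simps dot_square_norm inner_commute)

lemma inner_kmom: "P \<bullet> kmom k a e E P Q = - sqrt (k / a) * sin E / (1 - e * cos E)"
  "Q \<bullet> kmom k a e E P Q = sqrt (k / a) * sqrt (1 - e\<^sup>2) * cos E / (1 - e * cos E)"
  using on by (simp_all add: kmom_def inner_simps dot_square_norm inner_commute)

end

text \<open>
  With \<open>N\<close> the direction of \<open>x \<times> y\<close>, the ellipse equation \<open>|x| + e P \<bullet> x = a (1 - e\<^sup>2)\<close> says that
  \<open>(P \<bullet> x / a + e, (N \<times> P) \<bullet> x / b)\<close> lies on the unit circle, and the Laplace vector determines \<open>y\<close>.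
\<close>

lemma ellipse_param:
  assumes on: "norm P = 1" "norm Q = 1" "P \<bullet> Q = 0"
    and a: "0 < a" and e: "0 \<le> e" "e < 1"
    and x: "x = \<alpha> *\<^sub>R P + \<beta> *\<^sub>R Q" "norm x + e * (P \<bullet> x) = a * (1 - e\<^sup>2)"
  obtains E where "0 \<le> E" "E < 2 * pi" "x = kpos a e E P Q"
proof -
  have e2: "0 < 1 - e\<^sup>2" using one_minus_e2_pos e by blast
  define b where "b = a * sqrt (1 - e\<^sup>2)"
  have b: "0 < b" "b\<^sup>2 = a\<^sup>2 * (1 - e\<^sup>2)" using a e2 by (auto simp: b_def power_mult_distrib)
  have "P \<bullet> x = \<alpha>" using on x(1) by (simp add: inner_simps dot_square_norm)
  then have r: "norm x = a * (1 - e\<^sup>2) - e * \<alpha>" using x(2) by simp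
  have "(norm x)\<^sup>2 = \<alpha>\<^sup>2 + \<beta>\<^sup>2" using norm_orthonormal_comb[OF on] x(1) by simp
  then have *: "(a * (1 - e\<^sup>2) - e * \<alpha>)\<^sup>2 = \<alpha>\<^sup>2 + \<beta>\<^sup>2" by (simp add: r)
  \<comment> \<open>The focal equation squared, completed to a square about the centre of the
    ellipse, which lies at \<open>- a * e\<close> on the axis \<open>P\<close>.\<close>
  have "(1 - e\<^sup>2) * (\<alpha> + a * e)\<^sup>2 + \<beta>\<^sup>2 = a\<^sup>2 * (1 - e\<^sup>2)"
    using * by (simp add: power2_eq_square) algebra
  moreover have "X / A + B / (A * f) = (f * X + B) / (A * f)" if "0 < A" "0 < f" for A B X f :: real
    using that by (simp add: field_simps)
  ultimately have "(\<alpha> + a * e)\<^sup>2 / a\<^sup>2 + \<beta>\<^sup>2 / b\<^sup>2 = 1"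
    using a e2 unfolding b(2) by simp
  then have "((\<alpha> + a * e) / a)\<^sup>2 + (\<beta> / b)\<^sup>2 = 1" by (simp add: power_divide)
  then obtain E where E: "0 \<le> E" "E < 2 * pi" "(\<alpha> + a * e) / a = cos E" "\<beta> / b = sin E"
    using sincos_total_2pi by metis
  then have "\<alpha> = a * (cos E - e)" "\<beta> = b * sin E" using a b by (simp_all add: field_simps)
  then show thesis using that[of E] E x(1) by (simp add: kpos_def b_def)
qed

lemma kepler_param:
  assumes k: "0 < k" and bnd: "bound k (y, x)"
    and P: "norm P = 1" "P \<bullet> (x \<times> y) = 0" "laplace k (y, x) = e *\<^sub>R P" "0 \<le> e"
    and Q: "Q = sgn (x \<times> y) \<times> P" and a: "a = kep_a k (y, x)"
  obtains E where "0 \<le> E" "E < 2 * pi" "x = kpos a e E P Q" "y = kmom k a e E P Q" "e < 1"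
proof -
  define N where "N = sgn (x \<times> y)"
  have nz: "x \<noteq> 0" "x \<times> y \<noteq> 0" using bnd by (auto simp: bound_def)
  then have N: "norm N = 1" "N \<bullet> P = 0" "x \<bullet> N = 0"
    using P by (auto simp: N_def norm_sgn sgn_div_norm inner_commute dot_cross_self)
  have on: "norm P = 1" "norm Q = 1" "P \<bullet> Q = 0" 
    using P N norm_cross_orthonormal[of N P] by (auto simp: Q N_def[symmetric] dot_cross_self)
  have PQ: "P \<times> Q = N" "N \<times> Q = - P" using N P unfolding Q N_def[symmetric]
    by (auto simp: Lagrange dot_square_norm inner_commute)
  have en: "norm (laplace k (y, x)) = e" using P by simp
  then have e1: "e < 1" using norm_laplace_less_1[OF k bnd] by simp
  have apos: "0 < a" using kep_a_pos[OF k bnd] a by simp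
  have C: "norm (x \<times> y) = sqrt (k * a * (1 - e\<^sup>2))"
    using norm_angular_momentum[OF k bnd] a en by simp
  have e2: "0 < 1 - e\<^sup>2" using one_minus_e2_pos P e1 by blast
  have "x = (x \<bullet> P) *\<^sub>R P + (x \<bullet> Q) *\<^sub>R Q"
    using orthonormal_expansion[OF on, of x] N PQ by (simp add: inner_commute)
  moreover have "norm x + e * (P \<bullet> x) = a * (1 - e\<^sup>2)"
  proof -
    have "(norm (x \<times> y))\<^sup>2 / k = a * (1 - e\<^sup>2)"
      using k apos e2 unfolding C by simp
    then show ?thesis
      using laplace_inner_position[of "(y, x)" k] nz P(3) by (simp add: inner_commute)
  qed
  ultimately obtain E where E: "0 \<le> E" "E < 2 * pi" "x = kpos a e E P Q"
    using ellipse_param[OF on apos P(4) e1] by metis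
  define c where "c = norm (x \<times> y)"
  define s where "s = sqrt (1 - e\<^sup>2)"
  define D where "D = 1 - e * cos E"
  have D: "0 < D" using one_minus_e_cos_pos[OF P(4) e1] by (simp add: D_def)
  have s: "0 < s" "s\<^sup>2 = 1 - e\<^sup>2" using e2 by (auto simp: s_def)
  have "0 < c" using nz by (simp add: c_def)
  moreover have "c = sqrt (k * a) * s" unfolding c_def C s_def by (rule real_sqrt_mult)
  ultimately have c: "0 < c" "c = sqrt (k * a) * s" by auto
  have CN: "x \<times> y = c *\<^sub>R N" using nz by (simp add: c_def N_def sgn_div_norm)
  have r: "norm x = a * D" using norm_kpos[OF on apos P(4) e1] E by (simp add: D_def)
  \<comment> \<open>The definition of the Laplace vector is solved for \<open>y \<times> N\<close>;
    as \<open>y\<close> is orthogonal to \<open>N\<close>, another product with \<open>N\<close>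
    returns \<open>y\<close> itself.\<close>
  have "(1 / k) *\<^sub>R (y \<times> (x \<times> y)) = e *\<^sub>R P + (1 / norm x) *\<^sub>R x"
    using P(3) by (simp add: laplace_def algebra_simps)
  then have "(1 / k) *\<^sub>R (c *\<^sub>R (y \<times> N)) = e *\<^sub>R P + (1 / norm x) *\<^sub>R x"
    by (simp add: CN cross_mult_right)
  moreover have "y \<times> N = (k / c) *\<^sub>R ((1 / k) *\<^sub>R (c *\<^sub>R (y \<times> N)))" using k c(1) by simp
  ultimately have "y \<times> N = (k / c) *\<^sub>R (e *\<^sub>R P + (1 / norm x) *\<^sub>R x)" by simp
  then have 1: "N \<times> (y \<times> N) = (k / c) *\<^sub>R (e *\<^sub>R Q + (1 / norm x) *\<^sub>R (N \<times> x))"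
    by (simp add: cross_mult_right cross_add_right Q N_def)
  have "y \<bullet> N = 0" by (simp add: N_def sgn_div_norm dot_cross_self)
  then have "N \<times> (y \<times> N) = y" using N by (simp add: Lagrange inner_commute dot_square_norm)
  moreover have "N \<times> x = (a * (cos E - e)) *\<^sub>R Q - (a * s * sin E) *\<^sub>R P"
    unfolding E(3) kpos_def using PQ by (simp add: cross_add_right cross_mult_right s_def Q N_def)
  then have "(1 / norm x) *\<^sub>R (N \<times> x) = ((cos E - e) / D) *\<^sub>R Q - (s * sin E / D) *\<^sub>R P"
    unfolding r using apos D by (simp add: scaleR_diff_right)
  moreover have "t *\<^sub>R (e *\<^sub>R Q + (\<alpha> *\<^sub>R Q - \<beta> *\<^sub>R P)) = (t * - \<beta>) *\<^sub>R P + (t * (e + \<alpha>)) *\<^sub>R Q" for t \<alpha> \<beta>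
    by (simp add: algebra_simps)
  ultimately have y: "y = (k / c * - (s * sin E / D)) *\<^sub>R P + (k / c * (e + (cos E - e) / D)) *\<^sub>R Q"
    using 1 by simp
  have kc: "k / c = sqrt (k / a) / s"
    using sqrt_div_mult(2)[OF apos k] c k apos s by (simp add: divide_eq_eq)
  have "e + (cos E - e) / D = (e * D + cos E - e) / D" using D by (simp add: field_simps)
  also have "e * D + cos E - e = s\<^sup>2 * cos E"
    unfolding s(2) by (simp add: D_def power2_eq_square algebra_simps)
  finally have ecc: "e + (cos E - e) / D = s\<^sup>2 * cos E / D" .
  have "k / c * - (s * sin E / D) = - sqrt (k / a) * sin E / D" "k / c * (s\<^sup>2 * cos E / D) = sqrt (k / a) * s * cos E / D"
    unfolding kc using s(1) by (simp_all add: power2_eq_square)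
  then have "y = kmom k a e E P Q"
    unfolding y kmom_def ecc by (simp add: D_def s_def)
  then show thesis using that E e1 by blast
qed

lemma kepler_elements:
  assumes on: "norm P = 1" "norm Q = 1" "P \<bullet> Q = 0"
    and k: "0 < k" and a: "0 < a" and e: "0 \<le> e" "e < 1"
    and xy: "x = kpos a e E P Q" "y = kmom k a e E P Q"
  shows "x \<bullet> y / sqrt (k * a) = e * sin E" "1 - norm x / a = e * cos E"
proof -
  have D: "0 < 1 - e * cos E" using one_minus_e_cos_pos[OF e] .
  have "x = (a * (cos E - e)) *\<^sub>R P + (a * sqrt (1 - e\<^sup>2) * sin E) *\<^sub>R Q" by (simp add: xy kpos_def)
  then have "x \<bullet> y = (a * (cos E - e)) * (P \<bullet> y) + (a * sqrt (1 - e\<^sup>2) * sin E) * (Q \<bullet> y)"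
    by (simp add: inner_simps)
  also have "\<dots> = sqrt (k / a) * a * sin E * ((sqrt (1 - e\<^sup>2))\<^sup>2 * cos E - (cos E - e)) / (1 - e * cos E)"
    unfolding xy(2) inner_kmom[OF on] 
    by (simp add: diff_divide_distrib add_divide_distrib power2_eq_square algebra_simps)
  also have "(sqrt (1 - e\<^sup>2))\<^sup>2 * cos E - (cos E - e) = e * (1 - e * cos E)"
    using one_minus_e2_pos[OF e] by (simp add: power2_eq_square algebra_simps)
  also have "sqrt (k / a) * a * sin E * (e * (1 - e * cos E)) / (1 - e * cos E) = sqrt (k / a) * a * (e * sin E)"
    using D by simp
  finally show "x \<bullet> y / sqrt (k * a) = e * sin E"
    using k a by (simp add: sqrt_div_mult(1))
  show "1 - norm x / a = e * cos E"
    using a by (simp add: xy norm_kpos[OF on a e] field_simps)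
qed

subsection \<open>Kepler's equation\<close>

definition ecc_anom :: "real \<Rightarrow> real \<Rightarrow> real" where
  "ecc_anom e l = (THE E. E - e * sin E = l)"

context
  fixes e :: real
  assumes e: "0 \<le> e" "e < 1"
begin

lemma kepler_eq_deriv: "((\<lambda>E. E - e * sin E) has_real_derivative (1 - e * cos E)) (at E)"
  by (auto intro!: derivative_eq_intros)

lemma kepler_eq_strict_mono: "x < y \<Longrightarrow> x - e * sin x < y - e * sin y"
  by (rule DERIV_pos_imp_increasing[where f = "\<lambda>E. E - e * sin E"])
     (use kepler_eq_deriv one_minus_e_cos_pos[OF e] in blast)+

lemma kepler_eq_inj: "x - e * sin x = y - e * sin y \<longleftrightarrow> x = y"
  using kepler_eq_strict_mono[of x y] kepler_eq_strict_mono[of y x] by (cases x y rule: linorder_cases) auto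

lemma kepler_eq_less_iff: "x - e * sin x < y - e * sin y \<longleftrightarrow> x < y"
  using kepler_eq_strict_mono[of x y] kepler_eq_strict_mono[of y x] by (cases x y rule: linorder_cases) auto

lemma ecc_anom_kepler [simp]: "ecc_anom e (E - e * sin E) = E"
  unfolding ecc_anom_def by (rule the_equality) (auto simp: kepler_eq_inj)

lemma kepler_ecc_anom: "ecc_anom e l - e * sin (ecc_anom e l) = l"
proof -
  have b: "\<bar>e * sin t\<bar> \<le> 1" for t
    using e mult_mono[of e 1 "\<bar>sin t\<bar>" 1] by (simp add: abs_mult)
  \<comment> \<open>Since \<open>e * sin E\<close> is at most 1 in modulus, the root is bracketed
    within distance 1 of \<open>l\<close>.\<close>
  have "\<exists>E\<ge>l - 1. E \<le> l + 1 \<and> E - e * sin E = l"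
    using b[of "l - 1"] b[of "l + 1"] by (intro IVT') (auto intro!: continuous_intros)
  then show ?thesis by auto
qed

lemma ecc_anom_deriv: "(ecc_anom e has_real_derivative 1 / (1 - e * cos (ecc_anom e l))) (at l)"
proof -
  define d where "d = 1 - e * cos (ecc_anom e l)"
  have d: "0 < d" using one_minus_e_cos_pos[OF e] by (simp add: d_def)
  have "(ecc_anom e has_derivative (*) (1 / d)) (at ((\<lambda>E. E - e * sin E) (ecc_anom e l)))"
  proof (rule has_derivative_inverse_strong[where S = UNIV and f = "\<lambda>E. E - e * sin E" and f' = "(*) d" and x = "ecc_anom e l"])
    show "((\<lambda>E. E - e * sin E) has_derivative (*) d) (at (ecc_anom e l))"
      using kepler_eq_deriv[of "ecc_anom e l"] by (simp add: has_field_derivative_def d_def)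
    show "(*) d \<circ> (*) (1 / d) = id" using d by (simp add: fun_eq_iff)
  qed (auto intro!: continuous_intros)
  then show ?thesis by (simp add: kepler_ecc_anom has_field_derivative_def d_def)
qed

end

subsection \<open>Orbits are ellipses\<close>

text \<open>Squaring once removes the distance to the second focus. It is reversible when
  \<open>r \<le> 2 * a\<close>, which follows from the focal inequality by Cauchy-Schwarz. The
  inequality describes the sector whose area is measured, the equality the orbit.\<close>

lemma ellipse_norm_iff:
  fixes P q :: "'a::real_inner"
  assumes a: "0 < a" and e: "0 \<le> e" "e < 1" and P: "norm P = 1"
  shows "norm q + norm (q + (2 * a * e) *\<^sub>R P) \<le> 2 * a \<longleftrightarrow> norm q + e * (P \<bullet> q) \<le> a * (1 - e\<^sup>2)" (is ?le)
    and "norm q + norm (q + (2 * a * e) *\<^sub>R P) = 2 * a \<longleftrightarrow> norm q + e * (P \<bullet> q) = a * (1 - e\<^sup>2)" (is ?eq)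
proof -
  define r t n where "r = norm q" and "t = P \<bullet> q" and "n = norm (q + (2 * a * e) *\<^sub>R P)"
  have n: "0 \<le> n" "n\<^sup>2 = r\<^sup>2 + 4 * a * e * t + 4 * a\<^sup>2 * e\<^sup>2"
  proof -
    have "P \<bullet> P = 1" using P by (simp add: dot_square_norm)
    then show "n\<^sup>2 = r\<^sup>2 + 4 * a * e * t + 4 * a\<^sup>2 * e\<^sup>2"
      unfolding n_def r_def t_def power2_norm_eq_inner
      by (simp add: inner_simps power2_eq_square inner_commute)
  qed (simp add: n_def)
  have "\<bar>t\<bar> \<le> r" using Cauchy_Schwarz_ineq2[of P q] P by (simp add: r_def t_def)
  have diff: "(2 * a - r)\<^sup>2 - n\<^sup>2 = 4 * a * (a * (1 - e\<^sup>2) - (r + e * t))"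
    unfolding n(2) by (simp add: power2_eq_square algebra_simps)
  have r2a: "r \<le> 2 * a" if "r + e * t \<le> a * (1 - e\<^sup>2)"
  proof -
    have "e * (- t) \<le> e * r" using \<open>\<bar>t\<bar> \<le> r\<close> e by (intro mult_left_mono) auto
    then have "(1 - e) * r \<le> (1 - e) * (a * (1 + e))"
      using that by (simp add: algebra_simps power2_eq_square)
    then have "r \<le> a * (1 + e)" using e by simp
    also have "\<dots> \<le> a * 2" using a e by (intro mult_left_mono) auto
    finally show ?thesis by simp
  qed
  have "n \<le> 2 * a - r \<longleftrightarrow> r \<le> 2 * a \<and> n\<^sup>2 \<le> (2 * a - r)\<^sup>2"
    using n(1) abs_le_square_iff[of n "2 * a - r"] by auto
  also have "\<dots> \<longleftrightarrow> r \<le> 2 * a \<and> r + e * t \<le> a * (1 - e\<^sup>2)"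
    using diff a by (auto simp: zero_le_mult_iff intro: ccontr) (smt (verit) mult_pos_pos zero_le_mult_iff)+
  finally have le: "r + n \<le> 2 * a \<longleftrightarrow> r + e * t \<le> a * (1 - e\<^sup>2)" using r2a by auto
  then show ?le by (simp add: r_def t_def n_def)
  have "n = 2 * a - r \<longleftrightarrow> r \<le> 2 * a \<and> n\<^sup>2 = (2 * a - r)\<^sup>2"
    using n(1) by (auto simp: power2_eq_iff_nonneg)
  also have "\<dots> \<longleftrightarrow> r \<le> 2 * a \<and> r + e * t = a * (1 - e\<^sup>2)"
    using diff a by auto
  finally have "r + n = 2 * a \<longleftrightarrow> r + e * t = a * (1 - e\<^sup>2)" using r2a by auto
  then show ?eq by (simp add: r_def t_def n_def)
qed

lemma two_body_deriv:
  assumes "x \<noteq> 0" "m \<noteq> 0"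
  shows "(two_body m M has_derivative (\<lambda>(\<eta>, \<xi>). ((1 / m) *\<^sub>R y) \<bullet> \<eta> + ((m * M / norm x ^ 3) *\<^sub>R x) \<bullet> \<xi>)) (at (y, x))"
proof -
  have "((\<lambda>p. (fst p \<bullet> fst p) / (2 * m) - m * M / norm (snd p)) has_derivative
      (\<lambda>(\<eta>, \<xi>). ((1 / m) *\<^sub>R y) \<bullet> \<eta> + ((m * M / norm x ^ 3) *\<^sub>R x) \<bullet> \<xi>)) (at (y, x))"
    using assms
    by (auto intro!: derivative_eq_intros has_derivative_norm[THEN has_derivative_compose[rotated]]
        simp: fun_eq_iff field_simps inner_commute sgn_div_norm power3_eq_cube power2_eq_square)
  then show ?thesis by (simp add: two_body_def case_prod_unfold dot_square_norm)
qed

text \<open>Division by zero yields 0, so \<open>two_body\<close> has a finite value at a collision;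
  the blow-up of the potential nearby contradicts continuity there.\<close>

lemma two_body_not_differentiable_at_collision:
  assumes "0 < m" "0 < M" "(two_body m M has_derivative D) (at (y, x))"
  shows "x \<noteq> 0"
proof
  assume [simp]: "x = 0"
  have "isCont (two_body m M) (y, 0)" using assms has_derivative_continuous by force
  then obtain d where d: "d > 0" "\<And>p. dist p (y, 0) < d \<Longrightarrow> dist (two_body m M p) (two_body m M (y, 0)) < 1"
    unfolding continuous_at_eps_delta by (meson zero_less_one)
  \<comment> \<open>At distance \<open>s \<le> m * M\<close> from the collision the potential
    already differs by \<open>m * M / s \<ge> 1\<close>.\<close>
  define s where "s = min (d / 2) (m * M)"
  have s: "0 < s" "s < d" "s \<le> m * M" using assms d by (auto simp: s_def)
  define p where "p = (y, s *\<^sub>R axis 1 1 :: real^3)"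
  have "dist p (y, 0) < d" using s by (simp add: p_def dist_Pair_Pair dist_norm)
  then have "dist (two_body m M p) (two_body m M (y, 0)) < 1" by (rule d)
  then have "m * M / s < 1" using s assms by (simp add: two_body_def p_def dist_norm)
  then show False using s by simp
qed

lemma two_body_motion_iff:
  assumes "0 < m" "0 < M"
  shows "hamiltonian_motion (two_body m M) UNIV z \<longleftrightarrow>
    (\<forall>t. snd (z t) \<noteq> 0 \<and> (z has_vector_derivative
       (- (m * M / norm (snd (z t)) ^ 3) *\<^sub>R snd (z t), (1 / m) *\<^sub>R fst (z t))) (at t))"
    (is "_ \<longleftrightarrow> (\<forall>t. ?C t)")
proof
  assume h: "hamiltonian_motion (two_body m M) UNIV z"
  show "\<forall>t. ?C t"
  proof
    fix t
    obtain y x where z: "z t = (y, x)" by fastforce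
    from h obtain y' x' where 1: "(z has_vector_derivative (y', x')) (at t)"
      and 2: "(two_body m M has_derivative (\<lambda>(\<eta>, \<xi>). x' \<bullet> \<eta> - y' \<bullet> \<xi>)) (at (z t))"
      unfolding hamiltonian_motion_def by blast
    have x: "x \<noteq> 0" using two_body_not_differentiable_at_collision[OF assms] 2 z by auto
    have "(\<lambda>(\<eta>, \<xi>). x' \<bullet> \<eta> - y' \<bullet> \<xi>) =
       (\<lambda>(\<eta>, \<xi>). ((1 / m) *\<^sub>R y) \<bullet> \<eta> + ((m * M / norm x ^ 3) *\<^sub>R x) \<bullet> \<xi>)"
      using has_derivative_unique[OF 2] two_body_deriv[OF x, of m M y] z assms by auto
    then have D: "x' \<bullet> \<eta> - y' \<bullet> \<xi> = ((1 / m) *\<^sub>R y) \<bullet> \<eta> + ((m * M / norm x ^ 3) *\<^sub>R x) \<bullet> \<xi>" for \<eta> \<xi>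
      by (simp add: fun_eq_iff)
    have "x' = (1 / m) *\<^sub>R y"
    proof -
      have "\<eta> \<bullet> x' = \<eta> \<bullet> ((1 / m) *\<^sub>R y)" for \<eta>
        using D[of \<eta> 0] by (simp add: inner_commute)
      then show ?thesis by (metis vector_eq_ldot)
    qed
    moreover have "y' = - (m * M / norm x ^ 3) *\<^sub>R x"
    proof -
      have "\<xi> \<bullet> y' = \<xi> \<bullet> (- (m * M / norm x ^ 3) *\<^sub>R x)" for \<xi>
        using D[of 0 \<xi>] by (simp add: inner_commute)
      then show ?thesis by (metis vector_eq_ldot)
    qed
    ultimately show "?C t" using 1 x z by simp
  qed
next
  assume h: "\<forall>t. ?C t"
  show "hamiltonian_motion (two_body m M) UNIV z"
    unfolding hamiltonian_motion_def
  proof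
    fix t
    show "\<exists>y' x'. (z has_vector_derivative (y', x')) (at t) \<and>
        (two_body m M has_derivative (\<lambda>(\<eta>, \<xi>). x' \<bullet> \<eta> - y' \<bullet> \<xi>)) (at (z t))"
      using assms h[rule_format, of t] two_body_deriv[of "snd (z t)" m M "fst (z t)"]
      by (intro exI[of _ "- (m * M / norm (snd (z t)) ^ 3) *\<^sub>R snd (z t)"] exI[of _ "(1 / m) *\<^sub>R fst (z t)"]) simp
  qed
qed

context
  fixes m M k :: real
  assumes mM: "0 < m" "0 < M" and k_def: "k = m\<^sup>2 * M"
begin

lemma k_pos: "0 < k" using mM by (simp add: k_def)

text \<open>A central force preserves \<open>x \<times> y\<close>. For the inverse square law the
  derivatives of \<open>y \<times> C / k\<close> and of \<open>x / |x|\<close> are proportional, and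
  \<open>k = m\<^sup>2 * M\<close> is the constant that makes them equal.\<close>

lemma motion_invariants:
  assumes "hamiltonian_motion (two_body m M) UNIV z"
  shows "snd (z t) \<times> fst (z t) = snd (z 0) \<times> fst (z 0)" "laplace k (z t) = laplace k (z 0)"
    "snd (z t) \<noteq> 0"
proof -
  define y x where "y = (\<lambda>t. fst (z t))" and "x = (\<lambda>t. snd (z t))"
  from assms have nz: "x t \<noteq> 0" and D: "(z has_vector_derivative
       (- (m * M / norm (x t) ^ 3) *\<^sub>R x t, (1 / m) *\<^sub>R y t)) (at t)" for t
    by (auto simp: two_body_motion_iff[OF mM] y_def x_def)
  show "snd (z t) \<noteq> 0" using nz by (simp add: x_def)
  have y': "(y has_vector_derivative - (m * M / norm (x t) ^ 3) *\<^sub>R x t) (at t)" for t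
    using bounded_linear.has_vector_derivative[OF bounded_linear_fst D] by (simp add: y_def)
  have x': "(x has_vector_derivative (1 / m) *\<^sub>R y t) (at t)" for t
    using bounded_linear.has_vector_derivative[OF bounded_linear_snd D] by (simp add: x_def)
  have "((\<lambda>t. x t \<times> y t) has_vector_derivative 0) (at t)" for t
    using bounded_bilinear.has_vector_derivative[OF bounded_bilinear_cross3 x' y']
    by (simp add: cross_mult_left cross_mult_right)
  then obtain C where C: "x t \<times> y t = C" for t
    using has_vector_derivative_zero_constant[of UNIV "\<lambda>t. x t \<times> y t"] by auto
  then show "snd (z t) \<times> fst (z t) = snd (z 0) \<times> fst (z 0)" by (simp add: x_def y_def)
  have "((\<lambda>t. (1 / k) *\<^sub>R (y t \<times> C) - (1 / norm (x t)) *\<^sub>R x t) has_vector_derivative 0) (at t)" for t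
  proof -
    define r where "r = norm (x t)"
    have r: "0 < r" using nz by (simp add: r_def)
    have "((\<lambda>t. y t \<times> C) has_vector_derivative (- (m * M / r ^ 3) *\<^sub>R x t) \<times> C) (at t)"
      using bounded_bilinear.has_vector_derivative[OF bounded_bilinear_cross3 y' has_vector_derivative_const[of C]]
      by (simp add: r_def)
    then have 1: "((\<lambda>t. (1 / k) *\<^sub>R (y t \<times> C)) has_vector_derivative (1 / k) *\<^sub>R ((- (m * M / r ^ 3) *\<^sub>R x t) \<times> C)) (at t)"
      by (rule bounded_linear.has_vector_derivative[OF bounded_linear_scaleR_right])
    have "((\<lambda>t. norm (x t)) has_derivative (\<lambda>h. (h *\<^sub>R (1 / m) *\<^sub>R y t) \<bullet> sgn (x t))) (at t)"
      using has_derivative_compose[OF x'[unfolded has_vector_derivative_def] has_derivative_norm[OF nz]] .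
    then have "((\<lambda>t. norm (x t)) has_real_derivative (x t \<bullet> y t) / (m * r)) (at t)"
      unfolding has_field_derivative_def
      by (rule has_derivative_eq_rhs) (auto simp: fun_eq_iff sgn_div_norm r_def inner_commute field_simps)
    then have "((\<lambda>t. 1 / norm (x t)) has_real_derivative - (x t \<bullet> y t) / (m * r ^ 3)) (at t)"
      using nz r by (auto intro!: derivative_eq_intros simp: r_def[symmetric] power3_eq_cube power2_eq_square)
    then have 2: "((\<lambda>t. (1 / norm (x t)) *\<^sub>R x t) has_vector_derivative
        (1 / r) *\<^sub>R (1 / m) *\<^sub>R y t + (- (x t \<bullet> y t) / (m * r ^ 3)) *\<^sub>R x t) (at t)"
      using has_vector_derivative_scaleR[OF _ x'] by (fastforce simp: r_def)
    have "x t \<times> C = (x t \<bullet> y t) *\<^sub>R x t - r\<^sup>2 *\<^sub>R y t"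
      by (simp add: C[of t, symmetric] Lagrange r_def dot_square_norm)
    then have f1: "(1 / k) *\<^sub>R ((- (m * M / r ^ 3) *\<^sub>R x t) \<times> C) =
        (- (m * M / (k * r ^ 3)) * (x t \<bullet> y t)) *\<^sub>R x t + (m * M / (k * r ^ 3) * r\<^sup>2) *\<^sub>R y t"
      unfolding cross_mult_left by (simp add: scaleR_diff_right)
    have f2: "(\<alpha> *\<^sub>R a + \<beta> *\<^sub>R b) - ((1 / r) *\<^sub>R (1 / m) *\<^sub>R b + \<gamma> *\<^sub>R a) = (\<alpha> - \<gamma>) *\<^sub>R a + (\<beta> - 1 / (r * m)) *\<^sub>R b"
      for \<alpha> \<beta> \<gamma> and a b :: "real^3" by (simp add: algebra_simps)
    have "(1 / k) *\<^sub>R ((- (m * M / r ^ 3) *\<^sub>R x t) \<times> C) -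
        ((1 / r) *\<^sub>R (1 / m) *\<^sub>R y t + (- (x t \<bullet> y t) / (m * r ^ 3)) *\<^sub>R x t) = 
       (- (m * M / (k * r ^ 3)) * (x t \<bullet> y t) - - (x t \<bullet> y t) / (m * r ^ 3)) *\<^sub>R x t +
       (m * M / (k * r ^ 3) * r\<^sup>2 - 1 / (r * m)) *\<^sub>R y t" unfolding f1 by (rule f2)
    also have "\<dots> = 0" using r mM by (simp add: k_def field_simps power2_eq_square power3_eq_cube)
    finally show ?thesis using has_vector_derivative_diff[OF 1 2] by metis
  qed
  then obtain A where "(1 / k) *\<^sub>R (y t \<times> C) - (1 / norm (x t)) *\<^sub>R x t = A" for t
    using has_vector_derivative_zero_constant[of UNIV "\<lambda>t. (1 / k) *\<^sub>R (y t \<times> C) - (1 / norm (x t)) *\<^sub>R x t"] by auto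
  then have "laplace k (z t) = A" for t
    using C[of t] by (simp add: laplace_def y_def x_def)
  then show "laplace k (z t) = laplace k (z 0)" by simp
qed

text \<open>The mean anomaly has to run uniformly, with the mean motion
  \<open>sqrt (k / a ^ 3) / m\<close> of Kepler's third law and the value \<open>l\<close> at time
  0. The force is then matched through \<open>norm x = a * D\<close> and
  \<open>w\<^sup>2 = k / a\<close>.\<close>

lemma kepler_motion:
  assumes on: "norm P = 1" "norm Q = 1" "P \<bullet> Q = 0" and a: "0 < a" and e: "0 \<le> e" "e < 1"
    and E_def: "\<And>t. E t = ecc_anom e (sqrt (k / a ^ 3) / m * t + l)"
  shows "hamiltonian_motion (two_body m M) UNIV (\<lambda>t. (kmom k a e (E t) P Q, kpos a e (E t) P Q))"
  unfolding two_body_motion_iff[OF mM] fst_conv snd_conv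
proof
  fix t
  define w where "w = sqrt (k / a)"
  define s where "s = sqrt (1 - e\<^sup>2)"
  define D where "D = 1 - e * cos (E t)"
  have D: "0 < D" using one_minus_e_cos_pos[OF e] by (simp add: D_def)
  have w: "sqrt (k / a ^ 3) = w / a" "w\<^sup>2 = k / a"
  proof -
    have *: "k / a ^ 3 = (k / a) / a\<^sup>2" by (simp add: power3_eq_cube power2_eq_square)
    have "sqrt ((k / a) / a\<^sup>2) = sqrt (k / a) / sqrt (a\<^sup>2)" by (rule real_sqrt_divide)
    then show "sqrt (k / a ^ 3) = w / a" using a unfolding * w_def by simp
  qed (use a k_pos in \<open>simp add: w_def\<close>)
  have "(E has_real_derivative 1 / D * (w / a / m)) (at t)"
    unfolding E_def[abs_def] D_def w by (rule DERIV_chain2[OF ecc_anom_deriv[OF e]]) (use a mM in \<open>auto intro!: derivative_eq_intros\<close>)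
  then have E': "(E has_real_derivative w / (a * m * D)) (at t)" by (simp add: mult_ac)
  have comb: "((\<lambda>t. f t *\<^sub>R P + g t *\<^sub>R Q) has_vector_derivative f' *\<^sub>R P + g' *\<^sub>R Q) (at t)"
    if "(f has_real_derivative f') (at t)" "(g has_real_derivative g') (at t)" for f g f' g'
    using that by (auto intro!: derivative_eq_intros)
  have nx: "norm (kpos a e (E t) P Q) = a * D" by (simp add: norm_kpos[OF on a e] D_def)
  have "((\<lambda>t. kpos a e (E t) P Q) has_vector_derivative
     (- a * sin (E t) * (w / (a * m * D))) *\<^sub>R P + (a * s * cos (E t) * (w / (a * m * D))) *\<^sub>R Q) (at t)"
    unfolding kpos_def s_def[symmetric] by (rule comb) (auto intro!: derivative_eq_intros E')
  also have "(- a * sin (E t) * (w / (a * m * D))) *\<^sub>R P + (a * s * cos (E t) * (w / (a * m * D))) *\<^sub>R Q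
      = (1 / m) *\<^sub>R kmom k a e (E t) P Q"
    using a by (simp add: kmom_def w_def[symmetric] s_def[symmetric] D_def[symmetric] algebra_simps)
  finally have x': "((\<lambda>t. kpos a e (E t) P Q) has_vector_derivative (1 / m) *\<^sub>R kmom k a e (E t) P Q) (at t)" .
  have cs: "(sin (E t))\<^sup>2 = 1 - (cos (E t))\<^sup>2" by (rule sin_squared_eq)
  have g: "((\<lambda>t. 1 - e * cos (E t)) has_real_derivative e * sin (E t) * (w / (a * m * D))) (at t)"
    by (auto intro!: derivative_eq_intros E')
  have quot: "((\<lambda>t. f t / (1 - e * cos (E t))) has_real_derivative
      (f' * D - f t * (e * sin (E t))) / D\<^sup>2 * (w / (a * m * D))) (at t)"
    if "(f has_real_derivative f' * (w / (a * m * D))) (at t)" for f f'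
  proof -
    define W where "W = w / (a * m * D)"
    have "f' * W * D - f t * (e * sin (E t) * W) = (f' * D - f t * (e * sin (E t))) * W"
      by (simp add: algebra_simps)
    then have "(f' * W * D - f t * (e * sin (E t) * W)) / (D * D) = (f' * D - f t * (e * sin (E t))) / D\<^sup>2 * W"
      by (simp only: power2_eq_square times_divide_eq_left)
    moreover have "((\<lambda>t. f t / (1 - e * cos (E t))) has_real_derivative
        (f' * W * D - f t * (e * sin (E t) * W)) / (D * D)) (at t)"
      using DERIV_divide[OF that[folded W_def] g[folded W_def]] D unfolding D_def by simp
    ultimately show ?thesis by (simp only: W_def)
  qed
  have "((\<lambda>t. - w * sin (E t) / (1 - e * cos (E t))) has_real_derivative
      (- w * cos (E t) * D - - w * sin (E t) * (e * sin (E t))) / D\<^sup>2 * (w / (a * m * D))) (at t)"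
    by (rule quot) (auto intro!: derivative_eq_intros E')
  also have "- w * cos (E t) * D - - w * sin (E t) * (e * sin (E t)) = - w * (cos (E t) - e)"
    using cs unfolding D_def by algebra
  finally have f': "((\<lambda>t. - w * sin (E t) / (1 - e * cos (E t))) has_real_derivative
      - w * (cos (E t) - e) / D\<^sup>2 * (w / (a * m * D))) (at t)" .
  have "((\<lambda>t. w * s * cos (E t) / (1 - e * cos (E t))) has_real_derivative
      (- (w * s) * sin (E t) * D - w * s * cos (E t) * (e * sin (E t))) / D\<^sup>2 * (w / (a * m * D))) (at t)"
    by (rule quot) (auto intro!: derivative_eq_intros E')
  also have "- (w * s) * sin (E t) * D - w * s * cos (E t) * (e * sin (E t)) = - w * s * sin (E t)"
    unfolding D_def by algebra
  finally have g': "((\<lambda>t. w * s * cos (E t) / (1 - e * cos (E t))) has_real_derivative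
      - w * s * sin (E t) / D\<^sup>2 * (w / (a * m * D))) (at t)" .
  have h0: "((\<lambda>t. kmom k a e (E t) P Q) has_vector_derivative
     (- w * (cos (E t) - e) / D\<^sup>2 * (w / (a * m * D))) *\<^sub>R P + (- w * s * sin (E t) / D\<^sup>2 * (w / (a * m * D))) *\<^sub>R Q) (at t)"
    unfolding kmom_def s_def[symmetric] w_def[symmetric] by (rule comb[OF f' g'])
  have eqs: "(- w * (cos (E t) - e) / D\<^sup>2 * (w / (a * m * D))) = - (m * M / (a * D) ^ 3) * (a * (cos (E t) - e))"
    "(- w * s * sin (E t) / D\<^sup>2 * (w / (a * m * D))) = - (m * M / (a * D) ^ 3) * (a * s * sin (E t))"
  proof -
    have "- w * T / D\<^sup>2 * (w / (a * m * D)) = - (m * M / (a * D) ^ 3) * (a * T)" for T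
    proof -
      have "- w * T / D\<^sup>2 * (w / (a * m * D)) = - w\<^sup>2 * (T / (D\<^sup>2 * (a * m * D)))"
        by (simp add: power2_eq_square)
      also have "\<dots> = - (m * M / (a * D) ^ 3) * (a * T)"
        unfolding w(2) k_def using a D mM by (simp add: field_simps power2_eq_square power3_eq_cube)
      finally show ?thesis .
    qed
    from this[of "cos (E t) - e"] this[of "s * sin (E t)"]
    show "(- w * (cos (E t) - e) / D\<^sup>2 * (w / (a * m * D))) = - (m * M / (a * D) ^ 3) * (a * (cos (E t) - e))"
      "(- w * s * sin (E t) / D\<^sup>2 * (w / (a * m * D))) = - (m * M / (a * D) ^ 3) * (a * s * sin (E t))"
      by (simp_all only: mult.assoc mult_minus_left)
  qed
  have y': "((\<lambda>t. kmom k a e (E t) P Q) has_vector_derivative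
      - (m * M / norm (kpos a e (E t) P Q) ^ 3) *\<^sub>R kpos a e (E t) P Q) (at t)"
    using h0 unfolding eqs nx by (simp add: kpos_def s_def scaleR_add_right)
  show "kpos a e (E t) P Q \<noteq> 0 \<and> ((\<lambda>t. (kmom k a e (E t) P Q, kpos a e (E t) P Q)) has_vector_derivative
      (- (m * M / norm (kpos a e (E t) P Q) ^ 3) *\<^sub>R kpos a e (E t) P Q, (1 / m) *\<^sub>R kmom k a e (E t) P Q)) (at t)"
    using has_vector_derivative_Pair[OF y' x'] nx a D by auto
qed

end

text \<open>The extreme distances from the focus, \<open>a * (1 - e)\<close> and
  \<open>a * (1 + e)\<close>, can be read off the point set. The perihelion of one ellipse, lying on
  the other, then forces the directions to agree unless \<open>e = 0\<close>; the conclusion for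
  \<open>e *\<^sub>R P\<close> covers circles as well.\<close>

lemma ellipse_elements_unique:
  assumes w: "w \<noteq> 0"
    and 1: "0 < a" "0 \<le> e" "e < 1" "norm P = 1" "w \<bullet> P = 0"
    and 2: "0 < a'" "0 \<le> e'" "e' < 1" "norm P' = 1" "w \<bullet> P' = 0"
    and eq: "ellipse w a e P = ellipse w a' e' P'"
  shows "a = a'" "e = e'" "e *\<^sub>R P = e' *\<^sub>R P'"
proof -
  have mem: "q \<in> ellipse w a e P \<longleftrightarrow> w \<bullet> q = 0 \<and> norm q + e * (P \<bullet> q) = a * (1 - e\<^sup>2)"
    if "0 < a" "0 \<le> e" "e < 1" "norm P = 1" for q a e P
    using ellipse_norm_iff(2)[OF that] by (simp add: ellipse_def)
  have bounds: "a * (1 - e) \<le> norm q" "norm q \<le> a * (1 + e)"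
    if "0 < a" "0 \<le> e" "e < 1" "norm P = 1" "q \<in> ellipse w a e P" for q a e P
  proof -
    have h: "norm q + e * (P \<bullet> q) = a * (1 - e\<^sup>2)" using mem that by blast
    have "\<bar>P \<bullet> q\<bar> \<le> norm q" using Cauchy_Schwarz_ineq2[of P q] that by simp
    then have "\<bar>e * (P \<bullet> q)\<bar> \<le> e * norm q"
      using that by (simp add: abs_mult mult_left_mono)
    then have "(1 + e) * (a * (1 - e)) \<le> (1 + e) * norm q" "(1 - e) * norm q \<le> (1 - e) * (a * (1 + e))"
      using h by (simp_all add: algebra_simps power2_eq_square)
    then show "a * (1 - e) \<le> norm q" "norm q \<le> a * (1 + e)" using that by auto
  qed
  have n: "norm ((a * (1 - e)) *\<^sub>R P) = a * (1 - e)" "norm ((- a * (1 + e)) *\<^sub>R P) = a * (1 + e)"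
    if "0 < a" "0 \<le> e" "e < 1" "norm P = 1" for a e and P :: "real^3"
  proof -
    have "0 < a * (1 - e)" "0 < a * (1 + e)" using that by (auto intro: mult_pos_pos)
    then show "norm ((a * (1 - e)) *\<^sub>R P) = a * (1 - e)" "norm ((- a * (1 + e)) *\<^sub>R P) = a * (1 + e)"
      by (simp_all only: norm_scaleR that mult_1_right abs_of_pos abs_minus_cancel mult_minus_left)
  qed
  have apses: "(a * (1 - e)) *\<^sub>R P \<in> ellipse w a e P" "(- a * (1 + e)) *\<^sub>R P \<in> ellipse w a e P"
    if "0 < a" "0 \<le> e" "e < 1" "norm P = 1" "w \<bullet> P = 0" for a e P
  proof -
    have PP: "P \<bullet> P = 1" using that by (simp add: dot_square_norm)
    have "a * (1 - e) + e * (a * (1 - e) * 1) = a * (1 - e\<^sup>2)" "a * (1 + e) + e * (- a * (1 + e) * 1) = a * (1 - e\<^sup>2)"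
      by algebra+
    then show "(a * (1 - e)) *\<^sub>R P \<in> ellipse w a e P" "(- a * (1 + e)) *\<^sub>R P \<in> ellipse w a e P"
      unfolding mem[OF that(1-4)] n[OF that(1-4)] inner_scaleR_right PP that(5) by simp_all
  qed
  have "a' * (1 - e') \<le> norm ((a * (1 - e)) *\<^sub>R P)" "norm ((- a * (1 + e)) *\<^sub>R P) \<le> a' * (1 + e')"
    by (rule bounds[OF 2(1-4)], use apses[OF 1] eq in simp)+
  then have "a' * (1 - e') \<le> a * (1 - e)" "a * (1 + e) \<le> a' * (1 + e')"
    unfolding n[OF 1(1-4)] .
  moreover have "a * (1 - e) \<le> norm ((a' * (1 - e')) *\<^sub>R P')" "norm ((- a' * (1 + e')) *\<^sub>R P') \<le> a * (1 + e)"
    by (rule bounds[OF 1(1-4)], use apses[OF 2] eq in simp)+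
  then have "a * (1 - e) \<le> a' * (1 - e')" "a' * (1 + e') \<le> a * (1 + e)"
    unfolding n[OF 2(1-4)] .
  ultimately have "a * (1 - e) = a' * (1 - e')" "a * (1 + e) = a' * (1 + e')" by auto
  then show a: "a = a'" by (simp add: algebra_simps)
  with \<open>a * (1 - e) = a' * (1 - e')\<close> show e: "e = e'" using 1 by simp
  have "(a * (1 - e)) *\<^sub>R P \<in> ellipse w a e P'"
    using apses(1)[OF 1] eq a e by simp
  then have "a * (1 - e) + e * (a * (1 - e) * (P' \<bullet> P)) = a * (1 - e\<^sup>2)"
    using mem[OF 1(1-3), of P'] n(1)[OF 1(1-4)] 2 by simp
  then have "(a * (1 - e)) * (e * (P' \<bullet> P)) = (a * (1 - e)) * e"
    by (simp add: algebra_simps power2_eq_square)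
  then have "e * (P' \<bullet> P) = e" using 1 by simp
  then have "e = 0 \<or> P' \<bullet> P = 1" by auto
  moreover have "P' = P" if "P' \<bullet> P = 1"
  proof -
    have "(P' - P) \<bullet> (P' - P) = P' \<bullet> P' - 2 * (P' \<bullet> P) + P \<bullet> P"
      by (simp only: inner_diff_left inner_diff_right inner_commute[of P P'])
    also have "\<dots> = 0" using that 1 2 by (simp add: dot_square_norm)
    finally have "(P' - P) \<bullet> (P' - P) = 0" .
    then show ?thesis by simp
  qed
  ultimately show "e *\<^sub>R P = e' *\<^sub>R P'" using e by auto
qed

context
  fixes m M k :: real and x y :: "real^3"
  assumes mM: "0 < m" "0 < M" and k_def: "k = m\<^sup>2 * M" and bnd: "bound k (y, x)"
begin

text \<open>The conserved angular momentum and Laplace vector confine the orbit to the ellipse. That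
  it is not a proper subset needs a motion through each point, which Kepler's equation
  provides.\<close>

lemma two_body_orbit_eq_ellipse:
  assumes P: "norm P = 1" "P \<bullet> (x \<times> y) = 0" "laplace k (y, x) = e *\<^sub>R P" "0 \<le> e"
  shows "two_body_orbit m M (y, x) = ellipse (x \<times> y) (kep_a k (y, x)) e P"
proof -
  note k = k_pos[OF mM k_def]
  define a where "a = kep_a k (y, x)"
  define N where "N = sgn (x \<times> y)"
  define Q where "Q = N \<times> P"
  obtain E0 where E0: "x = kpos a e E0 P Q" "y = kmom k a e E0 P Q" "e < 1"
    using kepler_param[OF k bnd P Q_def[unfolded N_def] a_def] by metis
  have apos: "0 < a" using kep_a_pos[OF k bnd] by (simp add: a_def)
  have nz: "x \<times> y \<noteq> 0" using bnd by (simp add: bound_def)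
  have N: "norm N = 1" "N \<bullet> P = 0" using nz P by (auto simp: N_def norm_sgn sgn_div_norm inner_commute)
  have on: "norm P = 1" "norm Q = 1" "P \<bullet> Q = 0"
    using P N norm_cross_orthonormal[of N P] by (auto simp: Q_def dot_cross_self)
  have PQ: "P \<times> Q = N" using N P by (simp add: Q_def Lagrange inner_commute dot_square_norm)
  have C2: "(norm (x \<times> y))\<^sup>2 / k = a * (1 - e\<^sup>2)"
    using norm_laplace(1)[OF k bnd] P k apos by (simp add: a_def[symmetric] field_simps)
  have mem: "q \<in> ellipse (x \<times> y) a e P \<longleftrightarrow> (x \<times> y) \<bullet> q = 0 \<and> norm q + e * (P \<bullet> q) = a * (1 - e\<^sup>2)" for q
    using ellipse_norm_iff(2)[OF apos P(4) E0(3) P(1)] by (simp add: ellipse_def)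
  have "two_body_orbit m M (y, x) = ellipse (x \<times> y) a e P"
  proof (intro equalityI subsetI)
    fix q assume "q \<in> two_body_orbit m M (y, x)"
    then obtain z t where z: "q = snd (z t)" "hamiltonian_motion (two_body m M) UNIV z" "z 0 = (y, x)"
      by (auto simp: two_body_orbit_def)
    note inv = motion_invariants[OF mM k_def z(2), of t, unfolded z(3) fst_conv snd_conv]
    have "(x \<times> y) \<bullet> q = 0" using inv(1) z(1) by (metis dot_cross_self(1) inner_commute)
    moreover have "e * (P \<bullet> q) = a * (1 - e\<^sup>2) - norm q"
      using laplace_inner_position[OF inv(3), of k] inv P z(1) C2 by simp
    ultimately show "q \<in> ellipse (x \<times> y) a e P" by (simp add: mem)
  next
    fix q assume "q \<in> ellipse (x \<times> y) a e P"
    then have q: "(x \<times> y) \<bullet> q = 0" "norm q + e * (P \<bullet> q) = a * (1 - e\<^sup>2)" by (auto simp: mem)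
    have "q \<bullet> N = 0" using q(1) by (simp add: N_def sgn_div_norm inner_commute)
    then have "q = (q \<bullet> P) *\<^sub>R P + (q \<bullet> Q) *\<^sub>R Q"
      using orthonormal_expansion[OF on, of q] PQ by simp
    then obtain E1 where E1: "q = kpos a e E1 P Q"
      using ellipse_param[OF on apos P(4) E0(3)] q(2) by metis
    define n where "n = sqrt (k / a ^ 3) / m"
    have "n \<noteq> 0" using k apos mM by (simp add: n_def)
    define l where "l = E0 - e * sin E0"
    define E where "E t = ecc_anom e (n * t + l)" for t
    \<comment> \<open>The time at which the mean anomaly \<open>n * t + l\<close> attains the value
      belonging to \<open>E1\<close>.\<close>
    define t where "t = (E1 - e * sin E1 - l) / n"
    have "hamiltonian_motion (two_body m M) UNIV (\<lambda>t. (kmom k a e (E t) P Q, kpos a e (E t) P Q))"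
      by (rule kepler_motion[OF mM k_def on apos P(4) E0(3)]) (simp add: E_def n_def)
    moreover have "E 0 = E0" using ecc_anom_kepler[OF P(4) E0(3)] by (simp add: E_def l_def)
    moreover have "E t = E1" using ecc_anom_kepler[OF P(4) E0(3)] \<open>n \<noteq> 0\<close> by (simp add: E_def t_def)
    ultimately show "q \<in> two_body_orbit m M (y, x)"
      unfolding two_body_orbit_def mem_Collect_eq
      by (intro exI[of _ "\<lambda>t. (kmom k a e (E t) P Q, kpos a e (E t) P Q)"] exI[of _ t]) (simp add: E0 E1)
  qed
  then show ?thesis by (simp add: a_def)
qed

lemma perihelion_direction_exists:
  obtains P where "norm P = 1" "P \<bullet> (x \<times> y) = 0" "laplace k (y, x) = norm (laplace k (y, x)) *\<^sub>R P"
proof (cases "laplace k (y, x) = 0")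
  case True
  have "x \<noteq> 0" using bnd by (auto simp: bound_def)
  \<comment> \<open>For a circle every direction in the plane of motion qualifies; that of the
    position is at hand.\<close>
  then show thesis using that[of "sgn x"] True by (simp add: norm_sgn sgn_div_norm dot_cross_self)
next
  case False
  then show thesis using that[of "sgn (laplace k (y, x))"] laplace_inner_angular_momentum[of k "(y, x)"]
    by (simp add: norm_sgn sgn_div_norm)
qed

lemma ellipse_elements_iff:
  "ellipse_elements m M (y, x) a e P \<longleftrightarrow> a = kep_a k (y, x) \<and> e = norm (laplace k (y, x)) \<and>
     norm P = 1 \<and> (x \<times> y) \<bullet> P = 0 \<and> laplace k (y, x) = e *\<^sub>R P"
proof -
  note k = k_pos[OF mM k_def]
  have nz: "x \<times> y \<noteq> 0" using bnd by (simp add: bound_def)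
  obtain P0 where P0: "norm P0 = 1" "P0 \<bullet> (x \<times> y) = 0" "laplace k (y, x) = norm (laplace k (y, x)) *\<^sub>R P0"
    by (rule perihelion_direction_exists)
  note el = kep_a_pos[OF k bnd] norm_ge_zero norm_laplace_less_1[OF k bnd]
  have o: "two_body_orbit m M (y, x) = ellipse (x \<times> y) (kep_a k (y, x)) (norm (laplace k (y, x))) P0"
    using two_body_orbit_eq_ellipse[OF P0] by simp
  show ?thesis
  proof
    assume "ellipse_elements m M (y, x) a e P"
    then have h: "0 < a" "0 \<le> e" "e < 1" "norm P = 1" "(x \<times> y) \<bullet> P = 0"
      "ellipse (x \<times> y) (kep_a k (y, x)) (norm (laplace k (y, x))) P0 = ellipse (x \<times> y) a e P"
      by (auto simp: ellipse_elements_def o)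
    have "(x \<times> y) \<bullet> P0 = 0" using P0(2) by (simp add: inner_commute)
    from ellipse_elements_unique[OF nz el P0(1) this h]
    show "a = kep_a k (y, x) \<and> e = norm (laplace k (y, x)) \<and>
     norm P = 1 \<and> (x \<times> y) \<bullet> P = 0 \<and> laplace k (y, x) = e *\<^sub>R P" using h P0(3) by simp
  next
    assume h: "a = kep_a k (y, x) \<and> e = norm (laplace k (y, x)) \<and>
     norm P = 1 \<and> (x \<times> y) \<bullet> P = 0 \<and> laplace k (y, x) = e *\<^sub>R P"
    then have h1: "a = kep_a k (y, x)" and h2: "e = norm (laplace k (y, x))"
      and h3: "norm P = 1" and h4: "(x \<times> y) \<bullet> P = 0" and h5: "laplace k (y, x) = e *\<^sub>R P" by blast+
    have "P \<bullet> (x \<times> y) = 0" "0 \<le> e" using h4 by (simp add: inner_commute, simp add: h2)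
    then have "two_body_orbit m M (y, x) = ellipse (x \<times> y) a e P"
      unfolding h1 by (intro two_body_orbit_eq_ellipse h3 h5)
    moreover have "0 < a" "e < 1" unfolding h1 h2 by (rule el)+
    ultimately show "ellipse_elements m M (y, x) a e P"
      unfolding ellipse_elements_def fst_conv snd_conv using h3 h4 \<open>0 \<le> e\<close> by blast
  qed
qed

lemma semi_major_axis_eq: "semi_major_axis m M (y, x) = kep_a k (y, x)"
  and eccentricity_eq: "eccentricity m M (y, x) = norm (laplace k (y, x))"
proof -
  obtain P0 where P0: "norm P0 = 1" "P0 \<bullet> (x \<times> y) = 0" "laplace k (y, x) = norm (laplace k (y, x)) *\<^sub>R P0"
    by (rule perihelion_direction_exists)
  then show "semi_major_axis m M (y, x) = kep_a k (y, x)" "eccentricity m M (y, x) = norm (laplace k (y, x))"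
    unfolding semi_major_axis_def eccentricity_def ellipse_elements_iff
    by (auto intro!: the_equality simp: inner_commute)
qed

lemma perihelion_eq:
  assumes "laplace k (y, x) \<noteq> 0"
  shows "perihelion m M (y, x) = sgn (laplace k (y, x))"
  unfolding perihelion_def ellipse_elements_iff
proof (rule the_equality)
  show "\<exists>a e. a = kep_a k (y, x) \<and> e = norm (laplace k (y, x)) \<and> norm (sgn (laplace k (y, x))) = 1 \<and>
      (x \<times> y) \<bullet> sgn (laplace k (y, x)) = 0 \<and> laplace k (y, x) = e *\<^sub>R sgn (laplace k (y, x))"
    using assms laplace_inner_angular_momentum[of k "(y, x)"]
    by (simp add: norm_sgn sgn_div_norm inner_commute)
next
  fix P assume "\<exists>a e. a = kep_a k (y, x) \<and> e = norm (laplace k (y, x)) \<and> norm P = 1 \<and>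
      (x \<times> y) \<bullet> P = 0 \<and> laplace k (y, x) = e *\<^sub>R P"
  then have "laplace k (y, x) = norm (laplace k (y, x)) *\<^sub>R P" by auto
  then have "sgn (laplace k (y, x)) = inverse (norm (laplace k (y, x))) *\<^sub>R norm (laplace k (y, x)) *\<^sub>R P"
    by (metis sgn_div_norm)
  then show "P = sgn (laplace k (y, x))" using assms by simp
qed

end

subsection \<open>The mean anomaly\<close>

text \<open>The true anomaly grows with the eccentric one, so the angular bound of a sector becomes
  a bound on \<open>E\<close>. Its cosine \<open>(cos E - e) / (1 - e * cos E)\<close> increases
  with \<open>cos E\<close>, and the sign of \<open>sin E\<close> tells the half plane; hence the
  three cases.\<close>

lemma Arg2pi_position_strict_mono:
  fixes a b e :: real
  assumes ab: "0 < a" "b = a * sqrt (1 - e\<^sup>2)" and e: "0 \<le> e" "e < 1" and E: "0 \<le> E" "E < E'" "E' < 2 * pi"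
  shows "Arg2pi (Complex (a * (cos E - e)) (b * sin E)) < Arg2pi (Complex (a * (cos E' - e)) (b * sin E'))"
    (is "Arg2pi (?z E) < Arg2pi (?z E')")
proof -
  have b: "0 < b" "b\<^sup>2 = a\<^sup>2 * (1 - e\<^sup>2)" using ab one_minus_e2_pos[OF e] by (auto simp: power_mult_distrib)
  define A where "A E = Arg2pi (?z E)" for E
  have A: "0 \<le> A E" "A E < 2 * pi" for E by (auto simp: A_def Arg2pi_ge_0 Arg2pi_lt_2pi)
  have D: "0 < 1 - e * cos E" for E using one_minus_e_cos_pos[OF e] .
  have n: "cmod (?z E) = a * (1 - e * cos E)" for E
  proof -
    have "(a * (cos E - e))\<^sup>2 + (b * sin E)\<^sup>2 = (a * (1 - e * cos E))\<^sup>2"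
      unfolding power_mult_distrib b(2) sin_squared_eq by algebra
    then show ?thesis using ab D[of E] by (simp add: complex_norm)
  qed
  have cosA: "cos (A E) = (cos E - e) / (1 - e * cos E)" for E
  proof -
    have "a * ((1 - e * cos E) * cos (A E)) = a * (cos E - e)"
      using cos_Arg2pi[of "?z E"] unfolding n A_def by simp
    then have "(1 - e * cos E) * cos (A E) = cos E - e" using ab by simp
    then show ?thesis using D[of E] by (simp add: eq_divide_eq mult.commute)
  qed
  have mono: "cos (A E') < cos (A E)" if "cos E' < cos E" for E E'
  proof -
    have "(1 - e\<^sup>2) * cos E' < (1 - e\<^sup>2) * cos E" using that one_minus_e2_pos[OF e] by simp
    then have "(cos E' - e) * (1 - e * cos E) < (cos E - e) * (1 - e * cos E')"
      by (simp add: algebra_simps power2_eq_square)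
    then have "cos E' - e < (cos E - e) * (1 - e * cos E') / (1 - e * cos E)"
      using pos_less_divide_eq[OF D] by blast
    then show ?thesis unfolding cosA pos_divide_less_eq[OF D] by simp
  qed
  have le_pi: "A E \<le> pi \<longleftrightarrow> 0 \<le> sin E" for E
    using b by (simp add: A_def Arg2pi_le_pi zero_le_mult_iff)
  consider "E' \<le> pi" | "E \<le> pi" "pi < E'" | "pi < E" by linarith
  then have "A E < A E'"
  proof cases
    case 1
    then have "cos E' < cos E" using E by (intro cos_monotone_0_pi) auto
    then have "cos (A E') < cos (A E)" by (rule mono)
    moreover have "A E \<le> pi" "A E' \<le> pi" using 1 E by (auto simp: le_pi intro: sin_ge_zero)
    ultimately show ?thesis using A by (metis cos_mono_less_eq)
  next
    case 2
    then have "A E \<le> pi" "\<not> A E' \<le> pi" using E sin_lt_zero[of E'] by (auto simp: le_pi intro: sin_ge_zero)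
    then show ?thesis by simp
  next
    case 3
    have r: "cos (2 * pi - t) = cos t" for t :: real by simp
    have "cos (2 * pi - E) < cos (2 * pi - E')" using E 3 by (intro cos_monotone_0_pi) auto
    then have "cos E < cos E'" unfolding r .
    then have "cos (2 * pi - A E) < cos (2 * pi - A E')" unfolding r by (rule mono)
    moreover have "\<not> A E \<le> pi" "\<not> A E' \<le> pi" using 3 E sin_lt_zero[of E] sin_lt_zero[of E'] by (auto simp: le_pi)
    ultimately have "2 * pi - A E' < 2 * pi - A E" using A[of E] A[of E'] cos_mono_less_eq[of "2 * pi - A E" "2 * pi - A E'"] by simp
    then show ?thesis by simp
  qed
  then show ?thesis by (simp add: A_def)
qed

lemma Arg2pi_Complex_scale: "0 < s \<Longrightarrow> Arg2pi (Complex (s * a) (s * b)) = Arg2pi (Complex a b)"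
  using Arg2pi_times_of_real[of s "Complex a b"] by (simp add: complex_eq_iff Complex_eq algebra_simps)

lemma oangle_plane:
  assumes "w \<noteq> 0" "norm P = 1" "w \<bullet> P = 0"
  shows "oangle w P (\<alpha> *\<^sub>R P + \<beta> *\<^sub>R (sgn w \<times> P)) = Arg2pi (Complex \<alpha> \<beta>)"
proof -
  have "P \<bullet> P = 1" using assms by (simp add: dot_square_norm)
  then have "P \<times> (sgn w \<times> P) = sgn w" using assms by (simp add: Lagrange sgn_div_norm inner_commute)
  moreover have "P \<bullet> (\<alpha> *\<^sub>R P + \<beta> *\<^sub>R (sgn w \<times> P)) = \<alpha>"
    using \<open>P \<bullet> P = 1\<close> by (simp add: inner_simps dot_cross_self)
  moreover have "w \<bullet> sgn w = norm w"
    using assms by (simp add: sgn_div_norm dot_square_norm power2_eq_square)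
  ultimately show ?thesis
    unfolding oangle_def using assms(1) by (simp add: cross_add_right cross_mult_right)
qed

lemma has_derivative_vec2:
  fixes f g :: "'a::real_normed_vector \<Rightarrow> real"
  assumes "(f has_derivative f') (at x within A)" "(g has_derivative g') (at x within A)"
  shows "((\<lambda>x. vector [f x, g x] :: real^2) has_derivative (\<lambda>h. vector [f' h, g' h])) (at x within A)"
proof -
  have eq: "vector [s, t] = s *\<^sub>R axis 1 1 + t *\<^sub>R (axis 2 1 :: real^2)" for s t :: real
    by (simp add: vec_eq_iff forall_2 axis_def)
  show ?thesis unfolding eq by (intro has_derivative_add has_derivative_scaleR_left assms)
qed

text \<open>
  In the parameters \<open>(u, M)\<close>, where a point is \<open>\<surd>u\<close> times the point of the ellipse with mean anomaly \<open>M\<close>,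
  the Jacobian is constant: this is Kepler's second law.
\<close>

lemma sector_area_eq:
  assumes w: "w \<noteq> 0" and P: "norm P = 1" "w \<bullet> P = 0" and a: "0 < a" and e: "0 \<le> e" "e < 1"
    and E0: "0 \<le> E0" "E0 < 2 * pi"
  defines "Q \<equiv> sgn w \<times> P"
  shows "sector_area w a e P (kpos a e E0 P Q) = a\<^sup>2 * sqrt (1 - e\<^sup>2) / 2 * (E0 - e * sin E0)"
proof -
  define b where "b = a * sqrt (1 - e\<^sup>2)"
  have b: "0 < b" using a one_minus_e2_pos[OF e] by (simp add: b_def)
  have N: "norm (sgn w) = 1" "sgn w \<bullet> P = 0" using w P by (auto simp: norm_sgn sgn_div_norm)
  then have on: "norm P = 1" "norm Q = 1" "P \<bullet> Q = 0"
    using P norm_cross_orthonormal[of "sgn w" P] by (auto simp: Q_def dot_cross_self)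
  define M0 where "M0 = E0 - e * sin E0"
  have M0: "0 \<le> M0" "M0 < 2 * pi"
    using kepler_eq_less_iff[OF e, of E0 0] kepler_eq_less_iff[OF e, of E0 "2 * pi"] E0 by (auto simp: M0_def)
  define \<theta> where "\<theta> E = Arg2pi (Complex (a * (cos E - e)) (b * sin E))" for E
  have \<theta>_less: "\<theta> E < \<theta> E'" if "0 \<le> E" "E < E'" "E' < 2 * pi" for E E'
    unfolding \<theta>_def using Arg2pi_position_strict_mono[OF a b_def e that] .
  have \<theta>_le: "\<theta> E \<le> \<theta> E' \<longleftrightarrow> E \<le> E'" if "0 \<le> E" "E < 2 * pi" "0 \<le> E'" "E' < 2 * pi" for E E'
    using \<theta>_less[of E E'] \<theta>_less[of E' E] that by (cases E E' rule: linorder_cases) auto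
  define q where "q c = (c $ 1) *\<^sub>R P + (c $ 2) *\<^sub>R Q" for c :: "real^2"
  have P_q: "P \<bullet> q c = c $ 1" "Q \<bullet> q c = c $ 2" for c
    using on by (auto simp: q_def inner_simps dot_square_norm inner_commute)
  define T where "T = {c. norm (q c) + e * (c $ 1) \<le> a * (1 - e\<^sup>2) \<and> Arg2pi (Complex (c $ 1) (c $ 2)) \<le> \<theta> E0}"
  have area: "sector_area w a e P (kpos a e E0 P Q) = measure lebesgue T"
  proof -
    have "w /\<^sub>R norm w = sgn w" by (simp add: sgn_div_norm)
    moreover have "oangle w P (q c) = Arg2pi (Complex (c $ 1) (c $ 2))" for c
      unfolding q_def Q_def by (rule oangle_plane[OF w P])
    moreover have "oangle w P (kpos a e E0 P Q) = \<theta> E0"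
      unfolding \<theta>_def kpos_def b_def Q_def by (rule oangle_plane[OF w P])
    ultimately show ?thesis
      unfolding sector_area_def T_def Let_def
      by (simp only: Q_def[symmetric] q_def[symmetric] ellipse_norm_iff(1)[OF a e P(1)] P_q)
  qed
  \<comment> \<open>The edge u = 0, which \<open>f\<close> collapses to the focus and where
    \<open>sqrt\<close> is not differentiable, and the edge M = 0 are left out. This loses only
    points of the line through the apsides, a null set.\<close>
  define D where "D = {v :: real^2. 0 < v $ 1 \<and> v $ 1 \<le> 1 \<and> 0 < v $ 2 \<and> v $ 2 \<le> M0}"
  define \<E> where "\<E> = ecc_anom e"
  have \<E>: "\<E> l - e * sin (\<E> l) = l" for l unfolding \<E>_def by (rule kepler_ecc_anom[OF e])
  have \<E>_range: "0 < \<E> l" "\<E> l < 2 * pi" if "0 < l" "l \<le> M0" for l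
    using kepler_eq_less_iff[OF e, of 0 "\<E> l"] kepler_eq_less_iff[OF e, of "\<E> l" "2 * pi"] that M0 by (auto simp: \<E>)
  have \<E>_le: "\<E> l \<le> E0 \<longleftrightarrow> l \<le> M0" for l
    using kepler_eq_less_iff[OF e, of E0 "\<E> l"] by (auto simp: \<E> M0_def not_less[symmetric])
  define f where "f v = (vector [sqrt (v $ 1) * (a * (cos (\<E> (v $ 2)) - e)), sqrt (v $ 1) * (b * sin (\<E> (v $ 2)))] :: real^2)" for v :: "real^2"
  have qf: "q (f v) = sqrt (v $ 1) *\<^sub>R kpos a e (\<E> (v $ 2)) P Q" for v
    by (simp add: q_def f_def kpos_def b_def scaleR_add_right)
  have argf: "Arg2pi (Complex (f v $ 1) (f v $ 2)) = \<theta> (\<E> (v $ 2))" if "v \<in> D" for v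
    using that Arg2pi_Complex_scale[of "sqrt (v $ 1)"] by (simp add: f_def \<theta>_def D_def)
  have nf: "norm (q (f v)) + e * (f v $ 1) = sqrt (v $ 1) * (a * (1 - e\<^sup>2))" if "v \<in> D" for v
  proof -
    have "norm (q (f v)) = sqrt (v $ 1) * (a * (1 - e * cos (\<E> (v $ 2))))"
      using that unfolding qf norm_scaleR norm_kpos[OF on a e] by (simp add: D_def)
    then show ?thesis by (simp add: f_def algebra_simps power2_eq_square)
  qed
  have inj: "inj_on f D"
  proof (rule inj_onI)
    fix v v' assume v: "v \<in> D" "v' \<in> D" "f v = f v'"
    then have "\<theta> (\<E> (v $ 2)) = \<theta> (\<E> (v' $ 2))" using argf by metis
    moreover have "0 < \<E> (v $ 2)" "\<E> (v $ 2) < 2 * pi" "0 < \<E> (v' $ 2)" "\<E> (v' $ 2) < 2 * pi"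
      using \<E>_range v by (auto simp: D_def)
    ultimately have "\<E> (v $ 2) = \<E> (v' $ 2)"
      using \<theta>_le[of "\<E> (v $ 2)" "\<E> (v' $ 2)"] \<theta>_le[of "\<E> (v' $ 2)" "\<E> (v $ 2)"] by simp
    then have 2: "v $ 2 = v' $ 2" using \<E> by metis
    have "sqrt (v $ 1) * (a * (1 - e\<^sup>2)) = sqrt (v' $ 1) * (a * (1 - e\<^sup>2))"
      using nf[OF v(1)] nf[OF v(2)] unfolding v(3) by linarith
    then have "sqrt (v $ 1) = sqrt (v' $ 1)" using a one_minus_e2_pos[OF e] by simp
    then have "v $ 1 = v' $ 1" by simp
    with 2 show "v = v'" by (simp add: vec_eq_iff forall_2)
  qed
  have fD_sub: "f ` D \<subseteq> T"
  proof (intro image_subsetI)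
    fix v assume v: "v \<in> D"
    have "sqrt (v $ 1) * (a * (1 - e\<^sup>2)) \<le> 1 * (a * (1 - e\<^sup>2))"
      using v a one_minus_e2_pos[OF e] by (intro mult_right_mono) (auto simp: D_def)
    moreover have "\<theta> (\<E> (v $ 2)) \<le> \<theta> E0"
      using v \<E>_range[of "v $ 2"] E0 \<E>_le by (subst \<theta>_le) (auto simp: D_def)
    ultimately show "f v \<in> T" using nf[OF v] argf[OF v] by (simp add: T_def)
  qed
  have T_sub: "T - f ` D \<subseteq> {c. c $ 2 = 0}"
  proof
    fix c assume c: "c \<in> T - f ` D"
    have "c $ 2 = 0"
    proof (rule ccontr)
      assume c2: "c $ 2 \<noteq> 0"
      \<comment> \<open>The focal expression is homogeneous of degree one, so \<open>s\<close> is
        the scale at which the ellipse passes through \<open>c\<close>; the first parameter is then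
        \<open>s\<^sup>2\<close>.\<close>
      define s where "s = (norm (q c) + e * (c $ 1)) / (a * (1 - e\<^sup>2))"
      have p: "0 < a * (1 - e\<^sup>2)" using a one_minus_e2_pos[OF e] by simp
      have "norm (q c) > 0" using c2 P_q(2)[of c] by auto
      moreover have "\<bar>c $ 1\<bar> \<le> norm (q c)" using Cauchy_Schwarz_ineq2[of P "q c"] P by (simp add: P_q)
      then have "\<bar>e * (c $ 1)\<bar> \<le> e * norm (q c)" using e by (simp add: abs_mult mult_left_mono)
      moreover have "e * norm (q c) < norm (q c)" using \<open>norm (q c) > 0\<close> e by simp
      ultimately have "0 < norm (q c) + e * (c $ 1)" by linarith
      then have s: "0 < s" "s \<le> 1" using p c by (auto simp: s_def T_def)
      have "norm ((1 / s) *\<^sub>R q c) + e * (P \<bullet> ((1 / s) *\<^sub>R q c)) = (norm (q c) + e * (c $ 1)) / s"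
        using s by (simp add: P_q add_divide_distrib)
      also have "\<dots> = a * (1 - e\<^sup>2)" using p \<open>0 < norm (q c) + e * (c $ 1)\<close> by (simp add: s_def)
      finally obtain E where E: "0 \<le> E" "E < 2 * pi" "(1 / s) *\<^sub>R q c = kpos a e E P Q"
        using ellipse_param[OF on a e, of "(1 / s) *\<^sub>R q c" "c $ 1 / s" "c $ 2 / s"] by (auto simp: q_def scaleR_add_right)
      then have qc: "q c = s *\<^sub>R kpos a e E P Q" using s by (metis divide_self_if less_irrefl mult.commute scaleR_one scaleR_scaleR times_divide_eq_right mult.right_neutral)
      have c12: "c $ 1 = s * (a * (cos E - e))" "c $ 2 = s * (b * sin E)"
        using P_q[of c] inner_kpos[OF on, of a e E] unfolding qc by (simp_all add: b_def)
      have "E \<noteq> 0" using c12 c2 by auto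
      have "\<theta> E \<le> \<theta> E0" using c Arg2pi_Complex_scale[OF s(1)] by (simp add: T_def c12 \<theta>_def)
      then have "E \<le> E0" using \<theta>_le E E0 by simp
      define v where "v = (vector [s\<^sup>2, E - e * sin E] :: real^2)"
      have EE: "\<E> (E - e * sin E) = E" by (simp add: \<E>_def ecc_anom_kepler[OF e])
      have "E - e * sin E \<le> M0" using \<E>_le[of "E - e * sin E"] \<open>E \<le> E0\<close> by (simp add: EE)
      moreover have "0 < E - e * sin E" using kepler_eq_less_iff[OF e, of 0 E] E \<open>E \<noteq> 0\<close> by simp
      ultimately have "v \<in> D" using s by (simp add: D_def v_def power_le_one)
      moreover have "f v = c" using s by (simp add: f_def v_def EE vec_eq_iff forall_2 c12)
      ultimately show False using c by blast
    qed
    then show "c \<in> {c. c $ 2 = 0}" by simp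
  qed
  define g where "g v h = (vector [
      sqrt (v $ 1) * (a * (- sin (\<E> (v $ 2)) * (h $ 2 / (1 - e * cos (\<E> (v $ 2)))))) + h $ 1 / (2 * sqrt (v $ 1)) * (a * (cos (\<E> (v $ 2)) - e)),
      sqrt (v $ 1) * (b * (cos (\<E> (v $ 2)) * (h $ 2 / (1 - e * cos (\<E> (v $ 2)))))) + h $ 1 / (2 * sqrt (v $ 1)) * (b * sin (\<E> (v $ 2)))] :: real^2)" for v h :: "real^2"
  have deriv: "(f has_derivative g v) (at v within D)" if "v \<in> D" for v
  proof -
    have v: "0 < v $ 1" using that by (simp add: D_def)
    have nth: "((\<lambda>v. v $ i) has_derivative (\<lambda>h. h $ i)) (at v within D)" for i
      by (rule bounded_linear_imp_has_derivative[OF bounded_linear_vec_nth])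
    have r: "((\<lambda>v. sqrt (v $ 1)) has_derivative (\<lambda>h. h $ 1 / (2 * sqrt (v $ 1)))) (at v within D)"
      using has_derivative_compose[OF nth DERIV_real_sqrt[OF v, unfolded has_field_derivative_def]]
      by (simp add: inverse_eq_divide mult.commute)
    have E: "((\<lambda>v. \<E> (v $ 2)) has_derivative (\<lambda>h. h $ 2 / (1 - e * cos (\<E> (v $ 2))))) (at v within D)"
      using has_derivative_compose[OF nth ecc_anom_deriv[OF e, unfolded has_field_derivative_def]]
      by (simp add: \<E>_def)
    show ?thesis
      unfolding f_def[abs_def] g_def[abs_def]
      by (intro has_derivative_vec2 has_derivative_mult r has_derivative_mult_right)
        (auto intro!: derivative_eq_intros E)
  qed
  \<comment> \<open>The factor \<open>1 / (1 - e * cos E)\<close> coming from dE/dM cancels the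
    dependence of the areal density on \<open>E\<close>.\<close>
  have det: "det (matrix (g v)) = a * b / 2" if "v \<in> D" for v
  proof -
    have v: "0 < v $ 1" using that by (simp add: D_def)
    define r c s d where "r = sqrt (v $ 1)" and "c = cos (\<E> (v $ 2))" and "s = sin (\<E> (v $ 2))" and "d = 1 - e * c"
    have p: "0 < r" "0 < d" using v one_minus_e_cos_pos[OF e] by (auto simp: r_def d_def c_def)
    have cs: "c * c + s * s = 1" by (simp add: c_def s_def flip: power2_eq_square)
    have "det (matrix (g v)) = (1 / (2 * r) * (a * (c - e))) * (r * (b * (c * (1 / d)))) -
        (r * (a * (- s * (1 / d)))) * (1 / (2 * r) * (b * s))"
      by (simp add: det_2 matrix_def g_def r_def c_def s_def d_def axis_def)
    also have "\<dots> = a * b / 2 * (((c - e) * c + s * s) / d)"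
      using p by (simp add: field_simps)
    also have "(c - e) * c + s * s = d" using cs by (simp add: d_def algebra_simps)
    finally show ?thesis using p by simp
  qed
  define B where "B = cbox 0 (vector [1, M0] :: real^2)"
  have B_eq: "B = {v. 0 \<le> v $ 1 \<and> v $ 1 \<le> 1 \<and> 0 \<le> v $ 2 \<and> v $ 2 \<le> M0}"
    by (auto simp: B_def mem_box_cart forall_2)
  have neg: "negligible {c :: real^2. c $ i = 0}" for i
    by (rule negligible_standard_hyperplane_cart)
  have symd: "negligible (B - D \<union> (D - B))"
    by (rule negligible_subset[OF negligible_Un[OF neg[of 1] neg[of 2]]]) (auto simp: B_eq D_def)
  have B: "B \<in> lmeasurable" by (simp add: B_def)
  have D: "D \<in> lmeasurable" by (rule lmeasurable_negligible_symdiff[OF B symd])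
  have "measure lebesgue D = measure lebesgue B" by (rule measure_negligible_symdiff[OF B symd])
  also have "\<dots> = M0"
  proof -
    have "0 \<in> B" using M0 by (simp add: B_eq)
    then show ?thesis
      using content_cbox_cart[of 0 "vector [1, M0] :: real^2"] by (auto simp: B_def UNIV_2)
  qed
  finally have mD: "measure lebesgue D = M0" .
  have int: "(\<lambda>v. \<bar>det (matrix (g v))\<bar>) integrable_on D"
    by (rule integrable_eq[OF integrable_on_const[OF D, of "\<bar>a * b / 2\<bar>"]]) (simp only: det)
  have fm: "f ` D \<in> lmeasurable"
    using measurable_differentiable_image_eq[OF fmeasurableD[OF D] deriv inj] int by simp
  have "measure lebesgue T = measure lebesgue (f ` D)"
    by (rule measure_negligible_symdiff[OF fm]) (rule negligible_subset[OF neg[of 2]], use fD_sub T_sub in auto)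
  also have "\<dots> = integral D (\<lambda>v. \<bar>det (matrix (g v))\<bar>)"
    by (rule measure_differentiable_image_eq[OF fmeasurableD[OF D] deriv inj int])
  also have "\<dots> = integral D (\<lambda>v. \<bar>a * b / 2\<bar> * 1)"
    by (rule integral_cong) (simp only: det mult_1_right)
  also have "\<dots> = \<bar>a * b / 2\<bar> * M0"
    unfolding integral_mult_right using lmeasure_integral[OF D] mD by simp
  also have "\<dots> = a\<^sup>2 * sqrt (1 - e\<^sup>2) / 2 * (E0 - e * sin E0)"
    using a b by (simp add: M0_def) (simp add: b_def power2_eq_square)
  finally show ?thesis unfolding area .
qed

text \<open>\<open>(x \<bullet> y) / \<Lambda> = e sin E\<close> and \<open>1 - |x| / a = e cos E\<close>, where \<open>\<Lambda> = \<surd>(k a)\<close> is the Delaunay action.\<close>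

definition kep_ecc :: "real \<Rightarrow> (real^3) \<times> (real^3) \<Rightarrow> complex" where
  "kep_ecc k p = Complex (1 - norm (snd p) / kep_a k p) (snd p \<bullet> fst p / sqrt (k * kep_a k p))"

text \<open>\<open>kep_ecc\<close> equals \<open>of_real e * cis E\<close>: its argument is the
  eccentric anomaly and its imaginary part is \<open>e * sin E\<close>. No case distinction in
  \<open>E\<close> remains, and both quantities are explicit in position and momentum.\<close>

lemma mean_anomaly_eq:
  assumes mM: "0 < m" "0 < M" and k_def: "k = m\<^sup>2 * M" and bnd: "bound k (y, x)"
    and nz: "laplace k (y, x) \<noteq> 0"
  shows "mean_anomaly m M (y, x) = Arg2pi (kep_ecc k (y, x)) - Im (kep_ecc k (y, x))"
    and "kep_ecc k (y, x) \<noteq> 0"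
    and "x = kpos (kep_a k (y, x)) (norm (laplace k (y, x))) (Arg2pi (kep_ecc k (y, x)))
       (sgn (laplace k (y, x))) (sgn (x \<times> y) \<times> sgn (laplace k (y, x)))"
    and "y = kmom k (kep_a k (y, x)) (norm (laplace k (y, x))) (Arg2pi (kep_ecc k (y, x)))
       (sgn (laplace k (y, x))) (sgn (x \<times> y) \<times> sgn (laplace k (y, x)))"
    and "cmod (kep_ecc k (y, x)) = norm (laplace k (y, x))"
proof -
  note k = k_pos[OF mM k_def]
  define a e P N Q where "a = kep_a k (y, x)" and "e = norm (laplace k (y, x))"
    and "P = sgn (laplace k (y, x))" and "N = sgn (x \<times> y)" and "Q = N \<times> P"
  have cnz: "x \<times> y \<noteq> 0" using bnd by (simp add: bound_def)
  have e: "0 < e" using nz by (simp add: e_def)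
  have P: "norm P = 1" "P \<bullet> (x \<times> y) = 0" "laplace k (y, x) = e *\<^sub>R P"
    using nz laplace_inner_angular_momentum[of k "(y, x)"]
    by (auto simp: P_def norm_sgn sgn_div_norm e_def)
  obtain E where E: "0 \<le> E" "E < 2 * pi" "x = kpos a e E P Q" "y = kmom k a e E P Q" "e < 1"
    by (rule kepler_param[OF k bnd P less_imp_le[OF e] Q_def[unfolded N_def] a_def])
  have apos: "0 < a" using kep_a_pos[OF k bnd] by (simp add: a_def)
  have N: "norm N = 1" "N \<bullet> P = 0" using cnz P by (auto simp: N_def norm_sgn sgn_div_norm inner_commute)
  have on: "norm P = 1" "norm Q = 1" "P \<bullet> Q = 0"
    using P N norm_cross_orthonormal[of N P] by (auto simp: Q_def dot_cross_self)
  have ecc: "kep_ecc k (y, x) = of_real e * cis E"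
    using kepler_elements[OF on k apos less_imp_le[OF e] E(5) E(3,4)]
    by (simp add: kep_ecc_def complex_eq_iff a_def)
  then have EA: "Arg2pi (kep_ecc k (y, x)) = E" using e E by (simp add: Arg2pi_cis)
  show "kep_ecc k (y, x) \<noteq> 0" "cmod (kep_ecc k (y, x)) = norm (laplace k (y, x))"
    unfolding ecc using e by (simp, simp add: norm_mult e_def)
  show "x = kpos (kep_a k (y, x)) (norm (laplace k (y, x))) (Arg2pi (kep_ecc k (y, x)))
       (sgn (laplace k (y, x))) (sgn (x \<times> y) \<times> sgn (laplace k (y, x)))"
    "y = kmom k (kep_a k (y, x)) (norm (laplace k (y, x))) (Arg2pi (kep_ecc k (y, x)))
       (sgn (laplace k (y, x))) (sgn (x \<times> y) \<times> sgn (laplace k (y, x)))"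
    unfolding EA a_def[symmetric] e_def[symmetric] P_def[symmetric] N_def[symmetric] Q_def[symmetric] by (rule E)+
  have sq: "0 < sqrt (1 - e\<^sup>2)" using one_minus_e2_pos[OF less_imp_le[OF e] E(5)] by simp
  have "(x \<times> y) \<bullet> P = 0" using P(2) by (simp add: inner_commute)
  from sector_area_eq[OF cnz P(1) this apos less_imp_le[OF e] E(5) E(1,2)]
  have "sector_area (x \<times> y) a e P x = a\<^sup>2 * sqrt (1 - e\<^sup>2) / 2 * (E - e * sin E)"
    unfolding N_def[symmetric] Q_def[symmetric] E(3)[symmetric] .
  then have "mean_anomaly m M (y, x) = 2 * pi * (a\<^sup>2 * sqrt (1 - e\<^sup>2) / 2 * (E - e * sin E)) / (pi * a\<^sup>2 * sqrt (1 - e\<^sup>2))"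
    unfolding mean_anomaly_def Let_def semi_major_axis_eq[OF mM k_def bnd] eccentricity_eq[OF mM k_def bnd]
      perihelion_eq[OF mM k_def bnd nz] 
    unfolding a_def[symmetric] e_def[symmetric] P_def[symmetric] fst_conv snd_conv by (simp only:)
  also have "\<dots> = E - e * sin E" using apos sq by simp
  finally show "mean_anomaly m M (y, x) = Arg2pi (kep_ecc k (y, x)) - Im (kep_ecc k (y, x))"
    unfolding EA by (simp add: ecc)
qed

section \<open>The symplectic form of one body\<close>

text \<open>The three Lagrange brackets of the planar Kepler problem with respect to \<open>a\<close>, \<open>e\<close>, \<open>E\<close>.\<close>

lemma kepler_brackets:
  fixes a e w c sn s D :: real
  assumes nz: "a \<noteq> 0" "s \<noteq> 0" "D \<noteq> 0" and D: "D = 1 - e * c" and s: "s\<^sup>2 = 1 - e\<^sup>2" and sn: "sn\<^sup>2 = 1 - c\<^sup>2"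
  defines "g\<^sub>a \<equiv> w * sn / (2 * a * D)" and "g\<^sub>e \<equiv> - w * sn * c / D\<^sup>2" and "g\<^sub>E \<equiv> - w * (c - e) / D\<^sup>2"
    and "d\<^sub>a \<equiv> - w * s * c / (2 * a * D)" and "d\<^sub>e \<equiv> w * (s * c\<^sup>2 / D\<^sup>2 - e * c / (s * D))" and "d\<^sub>E \<equiv> - w * s * sn / D\<^sup>2"
  shows "g\<^sub>a * - a - g\<^sub>e * (c - e) + (d\<^sub>a * (- a * e * sn / s) - d\<^sub>e * (s * sn)) = - w * sn / 2"
    and "g\<^sub>a * (- a * sn) - g\<^sub>E * (c - e) + (d\<^sub>a * (a * s * c) - d\<^sub>E * (s * sn)) = w * D / 2"
    and "g\<^sub>e * (- a * sn) - g\<^sub>E * - a + (d\<^sub>e * (a * s * c) - d\<^sub>E * (- a * e * sn / s)) = 0"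
proof -
  have "g\<^sub>a * - a - g\<^sub>e * (c - e) + (d\<^sub>a * (- a * e * sn / s) - d\<^sub>e * (s * sn))
      = w * sn * (- D + 2 * c * (c - e) + e * c * D - 2 * s\<^sup>2 * c\<^sup>2 + 2 * e * c * D) / (2 * D\<^sup>2)"
    using nz by (simp add: g\<^sub>a_def g\<^sub>e_def d\<^sub>a_def d\<^sub>e_def field_simps) algebra
  also have "- D + 2 * c * (c - e) + e * c * D - 2 * s\<^sup>2 * c\<^sup>2 + 2 * e * c * D = - D\<^sup>2"
    unfolding D s by algebra
  finally show "g\<^sub>a * - a - g\<^sub>e * (c - e) + (d\<^sub>a * (- a * e * sn / s) - d\<^sub>e * (s * sn)) = - w * sn / 2"
    using nz by simp
  have "g\<^sub>a * (- a * sn) - g\<^sub>E * (c - e) + (d\<^sub>a * (a * s * c) - d\<^sub>E * (s * sn))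
      = w * (2 * (c - e)\<^sup>2 + 2 * s\<^sup>2 * sn\<^sup>2 - D * (sn\<^sup>2 + s\<^sup>2 * c\<^sup>2)) / (2 * D\<^sup>2)"
    using nz by (simp add: g\<^sub>a_def g\<^sub>E_def d\<^sub>a_def d\<^sub>E_def field_simps) algebra
  also have "2 * (c - e)\<^sup>2 + 2 * s\<^sup>2 * sn\<^sup>2 - D * (sn\<^sup>2 + s\<^sup>2 * c\<^sup>2) = D\<^sup>2 * D"
    unfolding D s sn by algebra
  finally show "g\<^sub>a * (- a * sn) - g\<^sub>E * (c - e) + (d\<^sub>a * (a * s * c) - d\<^sub>E * (s * sn)) = w * D / 2"
    using nz by simp
  have "g\<^sub>e * (- a * sn) - g\<^sub>E * - a + (d\<^sub>e * (a * s * c) - d\<^sub>E * (- a * e * sn / s))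
      = w * a * (sn\<^sup>2 * c - (c - e) + s\<^sup>2 * c ^ 3 - e * c\<^sup>2 * D - e * sn\<^sup>2) / D\<^sup>2"
    using nz by (simp add: g\<^sub>e_def g\<^sub>E_def d\<^sub>e_def d\<^sub>E_def field_simps) algebra
  also have "sn\<^sup>2 * c - (c - e) + s\<^sup>2 * c ^ 3 - e * c\<^sup>2 * D - e * sn\<^sup>2 = 0"
    unfolding D s sn by algebra
  finally show "g\<^sub>e * (- a * sn) - g\<^sub>E * - a + (d\<^sub>e * (a * s * c) - d\<^sub>E * (- a * e * sn / s)) = 0"
    by simp
qed

text \<open>Relative to the frame of \<open>P\<close> and \<open>N \<times> P\<close> the motion
  depends on \<open>a\<close>, \<open>e\<close>, \<open>E\<close> only, so
  \<open>wedge_rotating\<close> isolates a planar form. The first summand is dLambda ^ dl for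
  \<open>\<Lambda> = sqrt (k * a)\<close> and \<open>l = E - e * sin E\<close>.\<close>

lemma kepler_wedge:
  fixes a e E :: "'a::real_normed_vector \<Rightarrow> real" and P N x y :: "'a \<Rightarrow> real^3"
  assumes U: "open U" "z \<in> U"
    and a': "(a has_derivative a') (at z)" and e': "(e has_derivative e') (at z)" and E': "(E has_derivative E') (at z)"
    and P': "(P has_derivative P') (at z)" and N': "(N has_derivative N') (at z)"
    and x': "(x has_derivative x') (at z)" and y': "(y has_derivative y') (at z)"
    and on: "\<And>w. w \<in> U \<Longrightarrow> norm (P w) = 1 \<and> norm (N w) = 1 \<and> P w \<bullet> N w = 0"
    and xy: "\<And>w. w \<in> U \<Longrightarrow> x w = kpos (a w) (e w) (E w) (P w) (N w \<times> P w) \<and>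
        y w = kmom k (a w) (e w) (E w) (P w) (N w \<times> P w)"
    and pos: "0 < k" "0 < a z" "0 < e z" "e z < 1"
  shows "y' u \<bullet> x' v - y' v \<bullet> x' u =
    (sqrt (k / a z) / 2 * a' u * ((1 - e z * cos (E z)) * E' v - sin (E z) * e' v)
     - sqrt (k / a z) / 2 * a' v * ((1 - e z * cos (E z)) * E' u - sin (E z) * e' u))
    + frame_form (x z \<times> y z) (\<lambda>h. x z \<times> y' h + x' h \<times> y z) (\<lambda>h. spin (P z) (P' h) (N z) (N' h)) u v"
proof -
  define w c sn s D where "w = sqrt (k / a z)" and "c = cos (E z)" and "sn = sin (E z)"
    and "s = sqrt (1 - (e z)\<^sup>2)" and "D = 1 - e z * c"
  have s: "0 < s" "s\<^sup>2 = 1 - (e z)\<^sup>2" using one_minus_e2_pos[of "e z"] pos by (auto simp: s_def)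
  have sn: "sn\<^sup>2 = 1 - c\<^sup>2" by (simp add: sn_def c_def sin_squared_eq)
  have D: "0 < D" using one_minus_e_cos_pos[of "e z"] pos by (simp add: D_def c_def)
  have w: "0 < w" using pos by (simp add: w_def)
  define Q where "Q w = N w \<times> P w" for w
  define \<omega> where "\<omega> h = spin (P z) (P' h) (N z) (N' h)" for h
  have onz: "norm (P z) = 1" "norm (N z) = 1" "P z \<bullet> N z = 0" using on[OF U(2)] by auto
  have PP: "P z \<bullet> P' h = 0" for h using inner_derivative_zero_if_norm_1[OF U P'] on by auto
  have NN: "N z \<bullet> N' h = 0" for h using inner_derivative_zero_if_norm_1[OF U N'] on by auto
  have PN: "P' h \<bullet> N z + P z \<bullet> N' h = 0" for h using inner_derivative_if_orthogonal[OF U P' N'] on by auto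
  have \<omega>P: "\<omega> h \<times> P z = P' h" for h unfolding \<omega>_def using onz(1) PP by (rule spin_cross_first)
  have \<omega>N: "\<omega> h \<times> N z = N' h" for h unfolding \<omega>_def using onz NN PN by (rule spin_cross_second)
  \<comment> \<open>The third leg turns with the same angular velocity; this is the Jacobi identity
    for the cross product.\<close>
  have Q': "(Q has_derivative (\<lambda>h. \<omega> h \<times> Q z)) (at z)"
  proof -
    have "\<omega> h \<times> Q z = N z \<times> P' h + N' h \<times> P z" for h
      unfolding Q_def \<omega>P[symmetric] \<omega>N[symmetric] by (simp add: Lagrange cross_cross_left inner_commute)
    then show ?thesis using has_derivative_cross3[OF N' P'] by (simp add: Q_def[abs_def])
  qed
  define \<alpha> \<beta> \<gamma> \<delta> where "\<alpha> w = a w * (cos (E w) - e w)" and "\<beta> w = a w * sqrt (1 - (e w)\<^sup>2) * sin (E w)"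
    and "\<gamma> w = - sqrt (k / a w) * sin (E w) / (1 - e w * cos (E w))"
    and "\<delta> w = sqrt (k / a w) * sqrt (1 - (e w)\<^sup>2) * cos (E w) / (1 - e w * cos (E w))" for w
  define \<alpha>' where "\<alpha>' h = (c - e z) * a' h - a z * e' h - a z * sn * E' h" for h
  define \<beta>' where "\<beta>' h = s * sn * a' h + (- a z * e z * sn / s) * e' h + a z * s * c * E' h" for h
  define \<gamma>' where "\<gamma>' h = w * sn / (2 * a z * D) * a' h + (- w * sn * c / D\<^sup>2) * e' h + (- w * (c - e z) / D\<^sup>2) * E' h" for h
  define \<delta>' where "\<delta>' h = (- w * s * c / (2 * a z * D)) * a' h + w * (s * c\<^sup>2 / D\<^sup>2 - e z * c / (s * D)) * e' h + (- w * s * sn / D\<^sup>2) * E' h" for h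
  note intr = a' e' E'
  have s': "((\<lambda>w. sqrt (1 - (e w)\<^sup>2)) has_derivative (\<lambda>h. - (e z / s) * e' h)) (at z)"
    using s pos one_minus_e2_pos[of "e z"] by (auto intro!: derivative_eq_intros intr simp: s_def[symmetric] fun_eq_iff field_simps)
  have w': "((\<lambda>w. sqrt (k / a w)) has_derivative (\<lambda>h. - (w / (2 * a z)) * a' h)) (at z)"
  proof -
    have "k = w\<^sup>2 * a z" using pos by (simp add: w_def)
    then have "inverse w / 2 * (- k * a' h / (a z)\<^sup>2) = - (w / (2 * a z)) * a' h" for h
      using pos w by (simp add: field_simps power2_eq_square)
    moreover have h: "((\<lambda>w. k / a w) has_derivative (\<lambda>h. - k * a' h / (a z)\<^sup>2)) (at z)"
      using pos by (auto intro!: derivative_eq_intros intr simp: fun_eq_iff field_simps power2_eq_square)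
    have "(sqrt has_derivative (*) (inverse w / 2)) (at (k / a z))"
      using DERIV_real_sqrt[of "k / a z"] pos by (simp add: has_field_derivative_def w_def)
    from has_derivative_compose[OF h this]
    have "((\<lambda>w. sqrt (k / a w)) has_derivative (\<lambda>h. inverse w / 2 * (- k * a' h / (a z)\<^sup>2))) (at z)" .
    with calculation(1) show ?thesis by simp
  qed
  have c': "((\<lambda>w. cos (E w)) has_derivative (\<lambda>h. - sn * E' h)) (at z)"
    and sn': "((\<lambda>w. sin (E w)) has_derivative (\<lambda>h. c * E' h)) (at z)"
    unfolding sn_def c_def by (auto intro!: derivative_eq_intros intr)
  have iD': "((\<lambda>w. 1 / (1 - e w * cos (E w))) has_derivative (\<lambda>h. (c * e' h - e z * sn * E' h) / D\<^sup>2)) (at z)"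
  proof -
    have d: "((\<lambda>w. 1 - e w * cos (E w)) has_derivative (\<lambda>h. - (c * e' h - e z * sn * E' h))) (at z)"
      by (rule derivative_eq_intros c' intr refl)+ (simp add: c_def fun_eq_iff algebra_simps)
    have "1 - e z * cos (E z) \<noteq> 0" using D by (simp add: D_def c_def)
    from Deriv.has_derivative_inverse[OF this d]
    show ?thesis by (simp add: D_def c_def inverse_eq_divide power2_eq_square diff_divide_distrib)
  qed
  have "(\<alpha> has_derivative \<alpha>') (at z)"
    unfolding \<alpha>_def[abs_def] \<alpha>'_def by (rule derivative_eq_intros c' intr refl)+ (simp add: c_def fun_eq_iff algebra_simps)
  moreover have "(\<beta> has_derivative \<beta>') (at z)"
    unfolding \<beta>_def[abs_def] \<beta>'_def by (rule derivative_eq_intros s' sn' intr refl)+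
      (simp add: c_def sn_def s_def fun_eq_iff algebra_simps)
  moreover have "(\<gamma> has_derivative \<gamma>') (at z)"
  proof -
    have "(\<gamma> has_derivative (\<lambda>h. - w * sn * ((c * e' h - e z * sn * E' h) / D\<^sup>2) + (- w * (c * E' h) + (w / (2 * a z)) * a' h * sn) * (1 / D))) (at z)"
      using has_derivative_mult[OF has_derivative_mult[OF has_derivative_minus[OF w'] sn'] iD']
      by (simp add: \<gamma>_def[abs_def] w_def sn_def c_def D_def)
    moreover have "- w * sn * ((c * e' h - e z * sn * E' h) / D\<^sup>2) + (- w * (c * E' h) + (w / (2 * a z)) * a' h * sn) * (1 / D) = \<gamma>' h" for h
    proof -
      have "- w * sn * ((c * e' h - e z * sn * E' h) / D\<^sup>2) + (- w * (c * E' h) + (w / (2 * a z)) * a' h * sn) * (1 / D)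
        = w * sn / (2 * a z * D) * a' h + (- w * sn * c / D\<^sup>2) * e' h + (- w * (c * D - e z * sn\<^sup>2) / D\<^sup>2) * E' h"
        using D pos by (simp add: field_simps power2_eq_square)
      also have "c * D - e z * sn\<^sup>2 = c - e z" unfolding D_def sn by algebra
      finally show ?thesis by (simp add: \<gamma>'_def)
    qed
    ultimately show ?thesis by simp
  qed
  moreover have "(\<delta> has_derivative \<delta>') (at z)"
  proof -
    have "(\<delta> has_derivative (\<lambda>h. w * s * c * ((c * e' h - e z * sn * E' h) / D\<^sup>2) +
        (w * s * (- sn * E' h) + (w * (- (e z / s) * e' h) + - (w / (2 * a z)) * a' h * s) * c) * (1 / D))) (at z)"
      using has_derivative_mult[OF has_derivative_mult[OF has_derivative_mult[OF w' s'] c'] iD']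
      by (simp add: \<delta>_def[abs_def] w_def sn_def c_def D_def s_def)
    moreover have "w * s * c * ((c * e' h - e z * sn * E' h) / D\<^sup>2) +
        (w * s * (- sn * E' h) + (w * (- (e z / s) * e' h) + - (w / (2 * a z)) * a' h * s) * c) * (1 / D) = \<delta>' h" for h
    proof -
      have "w * s * c * ((c * e' h - e z * sn * E' h) / D\<^sup>2) +
        (w * s * (- sn * E' h) + (w * (- (e z / s) * e' h) + - (w / (2 * a z)) * a' h * s) * c) * (1 / D)
        = (- w * s * c / (2 * a z * D)) * a' h + w * (s * c\<^sup>2 / D\<^sup>2 - e z * c / (s * D)) * e' h + (- w * s * sn * (e z * c + D) / D\<^sup>2) * E' h"
        using D pos s(1) by (simp add: field_simps power2_eq_square)
      also have "e z * c + D = 1" by (simp add: D_def)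
      finally show ?thesis by (simp add: \<delta>'_def)
    qed
    ultimately show ?thesis by simp
  qed
  ultimately have "((\<lambda>w. \<alpha> w *\<^sub>R P w + \<beta> w *\<^sub>R Q w) has_derivative
      (\<lambda>h. (\<alpha> z *\<^sub>R P' h + \<alpha>' h *\<^sub>R P z) + (\<beta> z *\<^sub>R (\<omega> h \<times> Q z) + \<beta>' h *\<^sub>R Q z))) (at z)"
    "((\<lambda>w. \<gamma> w *\<^sub>R P w + \<delta> w *\<^sub>R Q w) has_derivative
      (\<lambda>h. (\<gamma> z *\<^sub>R P' h + \<gamma>' h *\<^sub>R P z) + (\<delta> z *\<^sub>R (\<omega> h \<times> Q z) + \<delta>' h *\<^sub>R Q z))) (at z)"
    by (auto intro!: has_derivative_add has_derivative_scaleR P' Q')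
  moreover have x_eq: "x w = \<alpha> w *\<^sub>R P w + \<beta> w *\<^sub>R Q w" and y_eq: "y w = \<gamma> w *\<^sub>R P w + \<delta> w *\<^sub>R Q w" if "w \<in> U" for w
    using xy[OF that] by (simp_all add: kpos_def kmom_def \<alpha>_def \<beta>_def \<gamma>_def \<delta>_def Q_def)
  ultimately have
    "(x has_derivative (\<lambda>h. (\<alpha> z *\<^sub>R P' h + \<alpha>' h *\<^sub>R P z) + (\<beta> z *\<^sub>R (\<omega> h \<times> Q z) + \<beta>' h *\<^sub>R Q z))) (at z)"
    "(y has_derivative (\<lambda>h. (\<gamma> z *\<^sub>R P' h + \<gamma>' h *\<^sub>R P z) + (\<delta> z *\<^sub>R (\<omega> h \<times> Q z) + \<delta>' h *\<^sub>R Q z))) (at z)"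
    using U by (auto intro: has_derivative_transform_within_open)
  then have "x' = (\<lambda>h. (\<alpha> z *\<^sub>R P' h + \<alpha>' h *\<^sub>R P z) + (\<beta> z *\<^sub>R (\<omega> h \<times> Q z) + \<beta>' h *\<^sub>R Q z))"
    "y' = (\<lambda>h. (\<gamma> z *\<^sub>R P' h + \<gamma>' h *\<^sub>R P z) + (\<delta> z *\<^sub>R (\<omega> h \<times> Q z) + \<delta>' h *\<^sub>R Q z))"
    using x' y' has_derivative_unique by blast+
  then have x'_eq: "x' h = (\<alpha>' h *\<^sub>R P z + \<beta>' h *\<^sub>R Q z) + \<omega> h \<times> x z"
    and y'_eq: "y' h = (\<gamma>' h *\<^sub>R P z + \<delta>' h *\<^sub>R Q z) + \<omega> h \<times> y z" for h
    unfolding x_eq[OF U(2)] y_eq[OF U(2)] by (simp_all add: cross_add_right cross_mult_right \<omega>P)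
  have "norm (Q z) = 1" "P z \<bullet> Q z = 0" using norm_cross_orthonormal[of "N z" "P z"] onz
    by (auto simp: Q_def dot_cross_self inner_commute)
  then have PQ: "P z \<bullet> P z = 1" "Q z \<bullet> Q z = 1" "P z \<bullet> Q z = 0" "Q z \<bullet> P z = 0"
    using onz by (auto simp: dot_square_norm inner_commute)
  have "y' u \<bullet> x' v - y' v \<bullet> x' u =
    ((\<gamma>' u *\<^sub>R P z + \<delta>' u *\<^sub>R Q z) \<bullet> (\<alpha>' v *\<^sub>R P z + \<beta>' v *\<^sub>R Q z) - (\<gamma>' v *\<^sub>R P z + \<delta>' v *\<^sub>R Q z) \<bullet> (\<alpha>' u *\<^sub>R P z + \<beta>' u *\<^sub>R Q z))
    + frame_form (x z \<times> y z) (\<lambda>h. x z \<times> y' h + x' h \<times> y z) \<omega> u v"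
    using wedge_rotating[of x' "\<lambda>h. \<alpha>' h *\<^sub>R P z + \<beta>' h *\<^sub>R Q z" \<omega> "x z" y' "\<lambda>h. \<gamma>' h *\<^sub>R P z + \<delta>' h *\<^sub>R Q z" "y z"
      "\<lambda>h. x z \<times> y' h + x' h \<times> y z" u v, OF x'_eq y'_eq] by (simp add: add.commute)
  moreover have "(\<gamma>' u *\<^sub>R P z + \<delta>' u *\<^sub>R Q z) \<bullet> (\<alpha>' v *\<^sub>R P z + \<beta>' v *\<^sub>R Q z) - (\<gamma>' v *\<^sub>R P z + \<delta>' v *\<^sub>R Q z) \<bullet> (\<alpha>' u *\<^sub>R P z + \<beta>' u *\<^sub>R Q z)
     = (\<gamma>' u * \<alpha>' v + \<delta>' u * \<beta>' v) - (\<gamma>' v * \<alpha>' u + \<delta>' v * \<beta>' u)"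
    by (simp add: inner_simps PQ)
  moreover have "\<dots> = w / 2 * a' u * (D * E' v - sn * e' v) - w / 2 * a' v * (D * E' u - sn * e' u)"
  proof -
    \<comment> \<open>The planar form in the basis da ^ de, da ^ dE, de ^ dE; its coefficients are
      the three brackets, of which the last vanishes.\<close>
    have gen: "((g1 * a1 + g2 * e1 + g3 * E1) * (p1 * a2 + p2 * e2 + p3 * E2) + (d1 * a1 + d2 * e1 + d3 * E1) * (q1 * a2 + q2 * e2 + q3 * E2))
      - ((g1 * a2 + g2 * e2 + g3 * E2) * (p1 * a1 + p2 * e1 + p3 * E1) + (d1 * a2 + d2 * e2 + d3 * E2) * (q1 * a1 + q2 * e1 + q3 * E1))
      = (g1 * p2 - g2 * p1 + (d1 * q2 - d2 * q1)) * (a1 * e2 - a2 * e1) + (g1 * p3 - g3 * p1 + (d1 * q3 - d3 * q1)) * (a1 * E2 - a2 * E1)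
        + (g2 * p3 - g3 * p2 + (d2 * q3 - d3 * q2)) * (e1 * E2 - e2 * E1)"
      for g1 g2 g3 p1 p2 p3 d1 d2 d3 q1 q2 q3 a1 a2 e1 e2 E1 E2 :: real by algebra
    have \<alpha>'_eq: "\<alpha>' h = (c - e z) * a' h + - a z * e' h + (- a z * sn) * E' h" for h by (simp add: \<alpha>'_def)
    have "a z \<noteq> 0" "s \<noteq> 0" "D \<noteq> 0" using pos s D by auto
    note br = kepler_brackets[OF this D_def s(2) sn, of w]
    show ?thesis
      unfolding \<alpha>'_eq \<beta>'_def \<gamma>'_def \<delta>'_def gen br by (simp add: algebra_simps)
  qed
  ultimately show ?thesis unfolding \<omega>_def w_def D_def c_def sn_def by simp
qed

section \<open>The nodes of the planetary system\<close>

subsection \<open>The order of the bodies\<close>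

lemma first_le: "first \<le> (j :: 'n::{finite,linorder})"
  by (simp add: first_def)

lemma le_final: "(j :: 'n::{finite,linorder}) \<le> final"
  by (simp add: final_def)

lemma prv_less:
  fixes j :: "'n::{finite,linorder}"
  assumes "j \<noteq> first" shows "prv j < j"
proof -
  have "first \<in> {k. k < j}" using first_le[of j] assms by auto
  then have "Max {k. k < j} \<in> {k. k < j}" by (intro Max_in) auto
  then show ?thesis by (simp add: prv_def)
qed

lemma prv_less_iff:
  fixes j :: "'n::{finite,linorder}"
  assumes "j \<noteq> first" shows "prv j < k \<longleftrightarrow> j \<le> k"
proof
  assume "prv j < k"
  moreover have "k \<le> prv j" if "k < j"
    unfolding prv_def using that by (intro Max_ge) auto
  ultimately show "j \<le> k" by (meson not_le)
qed (use prv_less[OF assms] in auto)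

lemma prv_neq_final: "j \<noteq> first \<Longrightarrow> prv j \<noteq> (final :: 'n::{finite,linorder})"
  using prv_less[of j] le_final[of j] by auto

lemma bij_betw_prv: "bij_betw prv (UNIV - {first}) (UNIV - {final :: 'n::{finite,linorder}})"
proof (rule bij_betwI')
  show "prv x = prv y \<longleftrightarrow> x = y" if "x \<in> UNIV - {first}" "y \<in> UNIV - {first :: 'n}" for x y
    using that prv_less_iff[of x] prv_less_iff[of y] by (metis DiffD2 order_refl antisym singletonI)
  show "prv x \<in> UNIV - {final}" if "x \<in> UNIV - {first :: 'n}" for x
    using that prv_neq_final by auto
next
  fix y :: 'n assume y: "y \<in> UNIV - {final}"
  \<comment> \<open>The successor of \<open>y\<close>, which exists because \<open>y\<close> is not
    the last body.\<close>
  define x where "x = Min {k. y < k}"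
  have "final \<in> {k. y < k}" using y le_final[of y] by auto
  then have "x \<in> {k. y < k}" unfolding x_def by (intro Min_in) auto
  then have x: "y < x" by simp
  then have "x \<noteq> first" using first_le[of y] by auto
  have "x \<le> k" if "y < k" for k unfolding x_def using that by (intro Min_le) auto
  then have "{k. k < x} = {k. k \<le> y}" using x by (auto simp: not_less[symmetric])
  then have "prv x = y" unfolding prv_def by (intro Max_eqI) auto
  then have "y = prv x" by simp
  with \<open>x \<noteq> first\<close> show "\<exists>x\<in>UNIV - {first}. y = prv x" by auto
qed

lemma prv_induct [case_names first step]:
  fixes j :: "'n::{finite,linorder}"
  assumes "Q first" "\<And>j. j \<noteq> first \<Longrightarrow> Q (prv j) \<Longrightarrow> Q j"
  shows "Q j"
proof (induction "card {k. k < j}" arbitrary: j rule: less_induct)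
  case less
  show ?case
  proof (cases "j = first")
    case False
    then have "{k. k < prv j} \<subset> {k. k < j}" using prv_less[OF False] by auto
    then show ?thesis using less assms(2)[OF False] by (simp add: psubset_card_mono)
  qed (use assms in simp)
qed

text \<open>\<open>B j\<close> is what enters link \<open>j\<close> of the chain and
  \<open>R j\<close> what leaves it; consecutive links are glued, and nothing enters the first or
  leaves the last.\<close>

lemma sum_telescope_prv:
  fixes B R :: "'n::{finite,linorder} \<Rightarrow> 'b::ab_group_add"
  assumes "B first = 0" "R final = 0" "\<And>j. j \<noteq> first \<Longrightarrow> B j = R (prv j)"
  shows "sum B UNIV = sum R UNIV"
proof -
  have "sum B UNIV = sum B (UNIV - {first})" using assms(1) by (simp add: sum.remove[of _ first])
  also have "\<dots> = sum (\<lambda>j. R (prv j)) (UNIV - {first})" using assms(3) by (intro sum.cong) auto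
  also have "\<dots> = sum R (UNIV - {final})" by (rule sum.reindex_bij_betw[OF bij_betw_prv])
  also have "\<dots> = sum R UNIV" using assms(2) by (simp add: sum.remove[of _ final])
  finally show ?thesis .
qed

lemma S_prv: "j \<noteq> first \<Longrightarrow> S z (prv j) = angmom z (prv j) + S z j"
proof -
  assume j: "j \<noteq> first"
  have "{prv j..} = insert (prv j) {j..}" using prv_less_iff[OF j] prv_less[OF j] by (auto simp: less_le)
  moreover have "prv j \<notin> {j..}" using prv_less[OF j] by auto
  ultimately show ?thesis by (simp add: S_def)
qed

lemma S_final: "S z final = angmom z final"
proof -
  have "{final..} = {final :: 'a}" using le_final by (auto intro: antisym)
  then show ?thesis by (simp add: S_def)
qed

subsection \<open>Differentiability\<close>

lemma differentiable_cross3: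
  "f differentiable at z within A \<Longrightarrow> g differentiable at z within A \<Longrightarrow> (\<lambda>x. f x \<times> g x) differentiable at z within A"
  unfolding differentiable_def using has_derivative_cross3 by blast

lemma differentiable_sgn:
  fixes f :: "'a::real_normed_vector \<Rightarrow> 'b::real_inner"
  assumes "f differentiable at x" "f x \<noteq> 0"
  shows "(\<lambda>x. sgn (f x)) differentiable at x"
proof -
  have "norm differentiable at (f x)" using assms by simp
  then have "(\<lambda>x. norm (f x)) differentiable at x"
    using differentiable_chain_at[OF assms(1), of norm] by (simp add: o_def)
  then show ?thesis unfolding sgn_div_norm using assms
    by (intro differentiable_scaleR differentiable_inverse) auto
qed

lemma differentiable_norm_comp:
  fixes f :: "'a::real_normed_vector \<Rightarrow> 'b::real_inner"
  assumes "f differentiable at x" "f x \<noteq> 0"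
  shows "(\<lambda>x. norm (f x)) differentiable at x"
  using differentiable_chain_at[OF assms(1), of norm] assms by (simp add: o_def)

lemma differentiable_sqrt_comp:
  fixes f :: "'a::real_normed_vector \<Rightarrow> real"
  assumes "f differentiable at x" "f x > 0"
  shows "(\<lambda>x. sqrt (f x)) differentiable at x"
proof -
  have "sqrt differentiable at (f x)"
    using DERIV_real_sqrt[OF assms(2)] by (auto simp: real_differentiable_def)
  then show ?thesis using differentiable_chain_at[OF assms(1), of sqrt] by (simp add: o_def)
qed

lemma sgn_sgn_vector [simp]: "sgn (sgn v) = sgn (v :: 'a::real_normed_vector)"
  by (cases "v = 0") (simp_all add: sgn_div_norm[of "sgn v"] norm_sgn)

lemma has_derivative_vecI:
  fixes f :: "'a::real_normed_vector \<Rightarrow> real^'n"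
  assumes "\<And>i. ((\<lambda>x. f x $ i) has_derivative (\<lambda>h. f' h $ i)) (at z)"
  shows "(f has_derivative f') (at z)"
proof -
  have "((\<lambda>x. f x \<bullet> i) has_derivative (\<lambda>h. f' h \<bullet> i)) (at z)" if "i \<in> Basis" for i
  proof -
    from that obtain j where "i = axis j 1" by (auto simp: Basis_vec_def)
    then show ?thesis using assms[of j] by (simp add: inner_axis)
  qed
  then show ?thesis by (subst has_derivative_componentwise_within) auto
qed

section \<open>Elements, nodes and frames of a configuration as explicit unit fields\<close>

locale planetary =
  fixes m0 \<mu> :: real and m :: "'n::{finite,linorder} coord"
  assumes m0_pos: "0 < m0" and \<mu>_pos: "0 < \<mu>" and m_pos: "0 < m $ i"
begin

definition kk :: "'n \<Rightarrow> real" where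
  "kk i = (red_mass m0 \<mu> m i)\<^sup>2 * tot_mass m0 \<mu> m i"

lemma mass_pos: "0 < red_mass m0 \<mu> m i" "0 < tot_mass m0 \<mu> m i" "0 < kk i"
proof -
  show "0 < red_mass m0 \<mu> m i" "0 < tot_mass m0 \<mu> m i"
    unfolding red_mass_def tot_mass_def
    by (intro divide_pos_pos mult_pos_pos add_pos_pos m0_pos \<mu>_pos m_pos)+
  then show "0 < kk i" by (simp add: kk_def)
qed

abbreviation reg :: "'n phase set" where "reg \<equiv> region m0 \<mu> m"

abbreviation cLam :: "'n phase \<Rightarrow> 'n coord" where "cLam \<equiv> c_Lambda m0 \<mu> m"
abbreviation cEll :: "'n phase \<Rightarrow> 'n coord" where "cEll \<equiv> c_ell m0 \<mu> m"
abbreviation cKap :: "'n phase \<Rightarrow> 'n coord" where "cKap \<equiv> c_kappa m0 \<mu> m"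
abbreviation cTheta :: "'n phase \<Rightarrow> 'n coord" where "cTheta \<equiv> c_Theta m0 \<mu> m"
abbreviation ctheta :: "'n phase \<Rightarrow> 'n coord" where "ctheta \<equiv> c_theta m0 \<mu> m"

definition lap :: "'n \<Rightarrow> 'n phase \<Rightarrow> real^3" where "lap i z = laplace (kk i) (body z i)"

definition peri :: "'n \<Rightarrow> 'n phase \<Rightarrow> real^3" where "peri i z = sgn (lap i z)"

text \<open>The axis and the reference direction of \<open>\<vartheta>\<^sub>j\<close>; the frame \<open>k\<^sup>(\<^sup>3\<^sup>), k\<^sup>(\<^sup>1\<^sup>)\<close> plays the role of \<open>P\<^sub>0, n\<^sub>0\<close>.\<close>

definition pre :: "'n \<Rightarrow> 'n phase \<Rightarrow> real^3" where
  "pre j z = (if j = first then axis 3 1 else peri (prv j) z)"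

definition nu :: "'n \<Rightarrow> 'n phase \<Rightarrow> real^3" where
  "nu j z = sgn (pre j z \<times> S z j)"

definition nn :: "'n \<Rightarrow> 'n phase \<Rightarrow> real^3" where
  "nn j z = (if j = final then peri j z else sgn (S z j \<times> peri j z))"

definition ref :: "'n \<Rightarrow> 'n phase \<Rightarrow> real^3" where
  "ref j z = (if j = first then axis 1 1 else nn (prv j) z)"

definition sS :: "'n \<Rightarrow> 'n phase \<Rightarrow> real^3" where "sS j z = sgn (S z j)"

definition sC :: "'n \<Rightarrow> 'n phase \<Rightarrow> real^3" where "sC j z = sgn (angmom z j)"

definition sma :: "'n \<Rightarrow> 'n phase \<Rightarrow> real" where "sma i z = kep_a (kk i) (body z i)"

definition ecc :: "'n \<Rightarrow> 'n phase \<Rightarrow> real" where "ecc i z = norm (lap i z)"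

definition eccv :: "'n \<Rightarrow> 'n phase \<Rightarrow> complex" where "eccv i z = kep_ecc (kk i) (body z i)"

lemma body_angmom: "angmom z i = snd (body z i) \<times> fst (body z i)"
  by (simp add: angmom_def body_def)

lemma bound_iff: "bound (kk i) (body z i) \<longleftrightarrow>
    two_body (red_mass m0 \<mu> m i) (tot_mass m0 \<mu> m i) (body z i) < 0 \<and> angmom z i \<noteq> 0"
  unfolding bound_def two_body_neg_iff[OF mass_pos(1,2)] kk_def body_angmom ..

lemma
  assumes "bound (kk i) (body z i)"
  shows semi_major_axis_body: "semi_major_axis (red_mass m0 \<mu> m i) (tot_mass m0 \<mu> m i) (body z i) = sma i z"
    and eccentricity_body: "eccentricity (red_mass m0 \<mu> m i) (tot_mass m0 \<mu> m i) (body z i) = ecc i z"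
    and ecc_less_1: "ecc i z < 1" and sma_pos: "0 < sma i z"
    and Peri_eq: "lap i z \<noteq> 0 \<Longrightarrow> Peri m0 \<mu> m z i = peri i z"
  using semi_major_axis_eq[OF mass_pos(1,2)[of i] kk_def[of i], where y = "fst (body z i)" and x = "snd (body z i)"]
    eccentricity_eq[OF mass_pos(1,2)[of i] kk_def[of i], where y = "fst (body z i)" and x = "snd (body z i)"]
    norm_laplace_less_1[OF mass_pos(3)[of i], where y = "fst (body z i)" and x = "snd (body z i)"]
    kep_a_pos[OF mass_pos(3)[of i], where y = "fst (body z i)" and x = "snd (body z i)"]
    perihelion_eq[OF mass_pos(1,2)[of i] kk_def[of i], where y = "fst (body z i)" and x = "snd (body z i)"] assms
  by (simp_all add: sma_def ecc_def lap_def Peri_def peri_def)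

text \<open>Once orbits are bound, an eccentricity in (0,1) means a nonzero Laplace vector, and the
  perihelion is its direction. The region is thus cut out by conditions on explicit fields, without
  definite descriptions.\<close>

lemma region_eq: "reg = {z. no_collision z \<and> (\<forall>i. bound (kk i) (body z i) \<and> lap i z \<noteq> 0 \<and> S z i \<noteq> 0 \<and> nu i z \<noteq> 0 \<and> nn i z \<noteq> 0)}"
proof -
  have "z \<in> reg \<longleftrightarrow> no_collision z \<and> (\<forall>i. bound (kk i) (body z i) \<and> lap i z \<noteq> 0 \<and> S z i \<noteq> 0 \<and>
      node_nu m0 \<mu> m z i \<noteq> 0 \<and> node_n m0 \<mu> m z i \<noteq> 0)" for z
  proof -
    have "eccentricity (red_mass m0 \<mu> m i) (tot_mass m0 \<mu> m i) (body z i) \<in> {0<..<1} \<longleftrightarrow> lap i z \<noteq> 0"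
      if "bound (kk i) (body z i)" for i
      using eccentricity_body[OF that] ecc_less_1[OF that] by (simp add: ecc_def)
    then show ?thesis unfolding region_def mem_Collect_eq using bound_iff by metis
  qed
  moreover have "node_nu m0 \<mu> m z i \<noteq> 0 \<longleftrightarrow> nu i z \<noteq> 0" "node_n m0 \<mu> m z i \<noteq> 0 \<longleftrightarrow> nn i z \<noteq> 0"
    if "\<forall>i. bound (kk i) (body z i) \<and> lap i z \<noteq> 0" for z i
    using that by (auto simp: node_nu_def node_n_def nu_def nn_def pre_def Peri_eq sgn_zero_iff)
  ultimately show ?thesis by blast
qed

context
  fixes z assumes z: "z \<in> reg"
begin

lemma regD: "no_collision z" "bound (kk i) (body z i)" "lap i z \<noteq> 0" "S z i \<noteq> 0" "nu i z \<noteq> 0" "nn i z \<noteq> 0"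
  "angmom z i \<noteq> 0" "Peri m0 \<mu> m z i = peri i z"
  using z Peri_eq[of i z] by (auto simp: region_eq bound_def body_angmom)

lemma node_eqs: "node_nu m0 \<mu> m z j = pre j z \<times> S z j"
  "node_n m0 \<mu> m z j = (if j = final then peri j z else S z j \<times> peri j z)"
  "pre j z \<times> S z j \<noteq> 0" "node_n m0 \<mu> m z j \<noteq> 0"
  "nu j z = sgn (node_nu m0 \<mu> m z j)" "nn j z = sgn (node_n m0 \<mu> m z j)"
  using regD(5,6)[of j] by (auto simp: node_nu_def node_n_def pre_def regD nu_def nn_def peri_def sgn_zero_iff)

lemma unit_fields [simp]: "norm (peri i z) = 1" "norm (pre j z) = 1" "norm (nu j z) = 1" "norm (nn j z) = 1" "norm (ref j z) = 1"
  "norm (sS j z) = 1" "norm (sC j z) = 1"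
proof -
  show 1: "norm (peri i z) = 1" for i using regD(3) by (simp add: peri_def norm_sgn)
  then show "norm (pre j z) = 1" by (simp add: pre_def)
  show "norm (nu j z) = 1" using node_eqs(3) by (simp add: nu_def norm_sgn)
  show 2: "norm (nn j z) = 1" for j
    using regD(6)[of j] 1 by (cases "j = final") (auto simp: nn_def norm_sgn sgn_zero_iff)
  then show "norm (ref j z) = 1" by (simp add: ref_def)
  show "norm (sS j z) = 1" "norm (sC j z) = 1" using regD(4,7) by (simp_all add: sS_def sC_def norm_sgn)
qed

lemma angmom_peri [simp]: "angmom z i \<bullet> peri i z = 0" "peri i z \<bullet> angmom z i = 0" "peri i z \<bullet> sC i z = 0"
  using laplace_inner_angular_momentum[of "kk i" "body z i"]
  by (auto simp: peri_def sC_def sgn_div_norm lap_def body_angmom inner_commute)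

lemma pre_nu [simp]: "pre j z \<bullet> nu j z = 0" "nu j z \<bullet> pre j z = 0" 
  and sS_nu [simp]: "sS j z \<bullet> nu j z = 0" "S z j \<bullet> nu j z = 0" "nu j z \<bullet> sS j z = 0"
  by (simp_all add: nu_def sS_def sgn_div_norm dot_cross_self inner_commute)

lemma sS_nn [simp]: "sS j z \<bullet> nn j z = 0" "nn j z \<bullet> sS j z = 0" "S z j \<bullet> nn j z = 0"
proof -
  show "S z j \<bullet> nn j z = 0"
  proof (cases "j = final")
    case True
    then show ?thesis by (simp add: nn_def S_final)
  qed (simp add: nn_def sgn_div_norm dot_cross_self)
  then show "sS j z \<bullet> nn j z = 0" "nn j z \<bullet> sS j z = 0" by (simp_all add: sS_def sgn_div_norm inner_commute)
qed

lemma peri_nn [simp]: "j \<noteq> final \<Longrightarrow> peri j z \<bullet> nn j z = 0" "j \<noteq> final \<Longrightarrow> nn j z \<bullet> peri j z = 0"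
  by (simp_all add: nn_def sgn_div_norm dot_cross_self inner_commute)

lemma ref_pre [simp]: "ref j z \<bullet> pre j z = 0" "pre j z \<bullet> ref j z = 0"
  using prv_neq_final[of j] by (auto simp: ref_def pre_def axis_eq_axis inner_axis_axis)

text \<open>Areas, definite descriptions and unnormalised nodes disappear here: all coordinates
  become expressions in fields that are differentiable on the region.\<close>

lemma coords:
  "cLam z $ i = sqrt (kk i * sma i z)"
  "cEll z $ i = Arg2pi (eccv i z) - Im (eccv i z)"
  "c_chi z $ j = norm (S z j)"
  "cKap z $ j = oangle (sS j z) (nu j z) (nn j z)"
  "cTheta z $ j = S z j \<bullet> pre j z"
  "ctheta z $ j = oangle (pre j z) (ref j z) (nu j z)"
proof -
  show "cLam z $ i = sqrt (kk i * sma i z)"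
    using mass_pos[of i]
    by (simp add: c_Lambda_def semi_major_axis_body[OF regD(2)] kk_def real_sqrt_mult mult.assoc)
  show "cEll z $ i = Arg2pi (eccv i z) - Im (eccv i z)"
    using mean_anomaly_eq(1)[OF mass_pos(1,2)[of i] kk_def[of i], where y = "fst (body z i)" and x = "snd (body z i)"] regD(2,3)[of i]
    by (simp add: c_ell_def eccv_def lap_def)
  show "c_chi z $ j = norm (S z j)" by (simp add: c_chi_def)
  show "cKap z $ j = oangle (sS j z) (nu j z) (nn j z)"
    unfolding node_eqs(5,6) sS_def using node_eqs(1,3,4) regD(4) by (simp add: oangle_sgn c_kappa_def)
  show "cTheta z $ j = S z j \<bullet> pre j z" by (simp add: c_Theta_def pre_def regD)
  have "oangle (sgn (pre j z)) (sgn (ref j z)) (sgn (nu j z)) = oangle (pre j z) (ref j z) (nu j z)"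
    using unit_fields by (metis oangle_sgn norm_zero zero_neq_one)
  show "ctheta z $ j = oangle (pre j z) (ref j z) (nu j z)"
  proof (cases "j = first")
    case True
    have "oangle (axis 3 1) (axis 1 1) (node_nu m0 \<mu> m z j) = oangle (sgn (axis 3 1)) (sgn (axis 1 1)) (sgn (node_nu m0 \<mu> m z j))"
      using node_eqs(1,3)[of j] by (subst oangle_sgn) (auto simp: axis_eq_0_iff)
    then show ?thesis using True by (simp add: c_theta_def pre_def ref_def node_eqs(5) sgn_div_norm)
  next
    case False
    have "oangle (peri (prv j) z) (node_n m0 \<mu> m z (prv j)) (node_nu m0 \<mu> m z j)
       = oangle (sgn (peri (prv j) z)) (sgn (node_n m0 \<mu> m z (prv j))) (sgn (node_nu m0 \<mu> m z j))"
      using node_eqs(1,3)[of j] node_eqs(4)[of "prv j"] regD(3)[of "prv j"]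
      by (subst oangle_sgn) (auto simp: peri_def sgn_zero_iff)
    then show ?thesis using False by (simp add: c_theta_def pre_def ref_def node_eqs(5,6) regD(8) sgn_div_norm)
  qed
qed

end

section \<open>Smoothness of the fields and openness of the region\<close>

lemma differentiable_position: "(\<lambda>z. snd z $ i) differentiable at (z :: 'n phase) within A"
  and differentiable_momentum: "(\<lambda>z. fst z $ i) differentiable at (z :: 'n phase) within A"
  by (intro bounded_linear_imp_differentiable bounded_linear_compose[OF bounded_linear_vec_nth bounded_linear_snd]
      bounded_linear_compose[OF bounded_linear_vec_nth bounded_linear_fst])+

lemma differentiable_angmom: "(\<lambda>z. angmom z i) differentiable at (z :: 'n phase)"
  unfolding angmom_def by (intro differentiable_cross3 differentiable_position differentiable_momentum)

lemma differentiable_S: "(\<lambda>z. S z j) differentiable at (z :: 'n phase)"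
  unfolding S_def by (intro differentiable_sum) (auto intro: differentiable_angmom)

context
  fixes z assumes z: "z \<in> reg"
begin

lemma position_nz: "snd z $ i \<noteq> 0"
  using regD(1)[OF z] by (simp add: no_collision_def)

lemma differentiable_norm_position: "(\<lambda>z. norm (snd z $ i)) differentiable at z"
  by (intro differentiable_norm_comp differentiable_position position_nz)

lemma differentiable_lap: "lap i differentiable at z"
  unfolding lap_def[abs_def] laplace_def body_def fst_conv snd_conv
  by (intro differentiable_diff differentiable_scaleR differentiable_cross3 differentiable_position
      differentiable_momentum differentiable_divide differentiable_const differentiable_norm_position)
    (simp add: position_nz)

lemma differentiable_peri: "peri i differentiable at z"
  unfolding peri_def[abs_def] by (intro differentiable_sgn differentiable_lap regD(3)[OF z])

lemma differentiable_pre: "pre j differentiable at z"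
  by (cases "j = first") (simp_all add: pre_def[abs_def] differentiable_peri)

lemma differentiable_nu: "nu j differentiable at z"
  unfolding nu_def[abs_def]
  by (intro differentiable_sgn differentiable_cross3 differentiable_pre differentiable_S node_eqs(3)[OF z])

lemma differentiable_nn: "nn j differentiable at z"
proof (cases "j = final")
  case False
  then have "S z j \<times> peri j z \<noteq> 0" using regD(6)[OF z, of j] by (auto simp: nn_def)
  then have "(\<lambda>z. sgn (S z j \<times> peri j z)) differentiable at z"
    by (intro differentiable_sgn differentiable_cross3 differentiable_peri differentiable_S)
  then show ?thesis using False by (simp add: nn_def[abs_def])
qed (simp add: nn_def[abs_def] differentiable_peri)

lemma differentiable_ref: "ref j differentiable at z"
  by (cases "j = first") (simp_all add: ref_def[abs_def] differentiable_nn)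

lemma differentiable_sS: "sS j differentiable at z"
  unfolding sS_def[abs_def] by (intro differentiable_sgn differentiable_S regD(4)[OF z])

lemma differentiable_sC: "sC j differentiable at z"
  unfolding sC_def[abs_def] by (intro differentiable_sgn differentiable_angmom regD(7)[OF z])

lemma differentiable_ecc: "ecc i differentiable at z"
  unfolding ecc_def[abs_def] by (intro differentiable_norm_comp differentiable_lap regD(3)[OF z])

lemma differentiable_inverse_sma:
  "(\<lambda>z. 2 / norm (snd z $ i) - (fst z $ i \<bullet> fst z $ i) / kk i) differentiable at z"
  by (intro differentiable_diff differentiable_divide differentiable_inner differentiable_momentum
      differentiable_const differentiable_norm_position) (use position_nz mass_pos(3)[of i] in auto)

lemma inverse_sma_pos: "0 < 2 / norm (snd z $ i) - (fst z $ i \<bullet> fst z $ i) / kk i"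
  using regD(2)[OF z, of i] by (simp add: bound_def body_def dot_square_norm)

lemma differentiable_sma: "sma i differentiable at z"
  unfolding sma_def[abs_def] kep_a_def body_def fst_conv snd_conv power2_norm_eq_inner
  by (intro differentiable_divide differentiable_const differentiable_inverse_sma) (use inverse_sma_pos[of i] in simp)

lemma sma_pos_reg: "0 < sma i z" and ecc_less_1_reg: "ecc i z < 1" and ecc_pos: "0 < ecc i z"
  using sma_pos regD(2,3)[OF z] ecc_less_1 by (auto simp: ecc_def)

lemma differentiable_Lambda: "(\<lambda>z. sqrt (kk i * sma i z)) differentiable at z"
  by (intro differentiable_sqrt_comp differentiable_mult differentiable_const differentiable_sma)
     (simp add: sma_pos_reg mass_pos)

lemma differentiable_eccv: "eccv i differentiable at z"
proof -
  have "(\<lambda>z. 1 - norm (snd z $ i) / sma i z) differentiable at z"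
    by (intro differentiable_diff differentiable_divide differentiable_const differentiable_norm_position differentiable_sma)
      (use sma_pos_reg[of i] in simp)
  moreover have "(\<lambda>z. snd z $ i \<bullet> fst z $ i / sqrt (kk i * sma i z)) differentiable at z"
    by (intro differentiable_divide differentiable_inner differentiable_position differentiable_momentum differentiable_Lambda)
      (use sma_pos_reg[of i] mass_pos(3)[of i] in simp)
  ultimately obtain f g where "((\<lambda>z. 1 - norm (snd z $ i) / sma i z) has_derivative f) (at z)"
    "((\<lambda>z. snd z $ i \<bullet> fst z $ i / sqrt (kk i * sma i z)) has_derivative g) (at z)"
    unfolding differentiable_def by blast
  then have "((\<lambda>z. complex_of_real (1 - norm (snd z $ i) / sma i z) + \<i> * complex_of_real (snd z $ i \<bullet> fst z $ i / sqrt (kk i * sma i z)))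
     has_derivative (\<lambda>h. complex_of_real (f h) + \<i> * complex_of_real (g h))) (at z)"
    by (intro has_derivative_add has_derivative_mult_right has_derivative_of_real)
  moreover have "eccv i = (\<lambda>z. complex_of_real (1 - norm (snd z $ i) / sma i z) + \<i> * complex_of_real (snd z $ i \<bullet> fst z $ i / sqrt (kk i * sma i z)))"
    by (rule ext) (simp add: eccv_def kep_ecc_def Complex_eq body_def sma_def)
  ultimately show ?thesis unfolding differentiable_def by auto
qed

lemma
  shows eccv_nz: "eccv i z \<noteq> 0" and norm_eccv: "cmod (eccv i z) = ecc i z"
    and position_eq: "snd z $ i = kpos (sma i z) (ecc i z) (Arg2pi (eccv i z)) (peri i z) (sC i z \<times> peri i z)"
    and momentum_eq: "fst z $ i = kmom (kk i) (sma i z) (ecc i z) (Arg2pi (eccv i z)) (peri i z) (sC i z \<times> peri i z)"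
  using mean_anomaly_eq(2-)[OF mass_pos(1,2)[of i] kk_def[of i], where y = "fst z $ i" and x = "snd z $ i"] regD(2,3)[OF z, of i]
  by (simp_all add: eccv_def ecc_def lap_def sma_def peri_def sC_def body_def angmom_def)

end

text \<open>There are finitely many conditions, each the positivity or the nonvanishing of a
  function continuous at the given point.\<close>

lemma open_reg: "open reg"
proof (subst open_subopen; intro ballI)
  fix z assume z: "z \<in> reg"
  have lim: "(f \<longlongrightarrow> f z) (nhds z)" if "f differentiable at z" for f :: "'n phase \<Rightarrow> 'b::real_normed_vector"
    using differentiable_imp_continuous_within[OF that] tendsto_at_iff_tendsto_nhds
    by (auto simp: continuous_within)
  have ne: "\<forall>\<^sub>F w in nhds z. f w \<noteq> 0" if "f differentiable at z" "f z \<noteq> 0" for f :: "'n phase \<Rightarrow> real^3"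
    by (rule tendsto_imp_eventually_ne[OF lim[OF that(1)] that(2)])
  have "\<forall>\<^sub>F w in nhds z. \<forall>i. snd w $ i \<noteq> 0"
    by (intro eventually_all_finite ne differentiable_position position_nz[OF z])
  moreover have "\<forall>\<^sub>F w in nhds z. \<forall>i j. i \<noteq> j \<longrightarrow> snd w $ i \<noteq> snd w $ j"
  proof (intro eventually_all_finite)
    fix i j
    have "\<forall>\<^sub>F w in nhds z. snd w $ i - snd w $ j \<noteq> 0" if "i \<noteq> j"
      using regD(1)[OF z] that
      by (intro ne differentiable_diff differentiable_position) (auto simp: no_collision_def)
    then show "\<forall>\<^sub>F w in nhds z. i \<noteq> j \<longrightarrow> snd w $ i \<noteq> snd w $ j"
      by (cases "i = j") auto
  qed
  moreover have "\<forall>\<^sub>F w in nhds z. \<forall>i. 0 < 2 / norm (snd w $ i) - (fst w $ i \<bullet> fst w $ i) / kk i"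
    by (intro eventually_all_finite order_tendstoD(1)[OF lim[OF differentiable_inverse_sma[OF z]]] inverse_sma_pos[OF z])
  moreover have "\<forall>\<^sub>F w in nhds z. \<forall>i. angmom w i \<noteq> 0" "\<forall>\<^sub>F w in nhds z. \<forall>i. lap i w \<noteq> 0"
    "\<forall>\<^sub>F w in nhds z. \<forall>i. S w i \<noteq> 0" "\<forall>\<^sub>F w in nhds z. \<forall>i. nu i w \<noteq> 0" "\<forall>\<^sub>F w in nhds z. \<forall>i. nn i w \<noteq> 0"
    by (intro eventually_all_finite ne differentiable_angmom differentiable_S differentiable_lap[OF z]
      differentiable_nu[OF z] differentiable_nn[OF z] regD[OF z])+
  ultimately have "\<forall>\<^sub>F w in nhds z. w \<in> reg"
    by eventually_elim
      (auto simp: region_eq no_collision_def bound_def body_def angmom_def dot_square_norm)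
  then show "\<exists>T. open T \<and> z \<in> T \<and> T \<subseteq> reg" unfolding eventually_nhds by blast
qed

section \<open>Local lifts of the angles and the symplectic form of the whole system\<close>

lemma continuous_on_reg:
  fixes f :: "'n phase \<Rightarrow> 'b::real_normed_vector"
  assumes "\<And>z. z \<in> reg \<Longrightarrow> f differentiable at z"
  shows "continuous_on reg f"
  using assms differentiable_imp_continuous_within continuous_at_imp_continuous_on by blast

text \<open>A lift of the eccentric anomaly is produced as well as one of the mean anomaly, because
  \<open>kepler_wedge\<close> is phrased with the former. They are linked by
  \<open>ecc * sin \<phi> = Im eccv\<close>.\<close>

lemma mean_anomaly_lift:
  assumes z: "z \<in> reg"
  obtains V \<phi> E where "open V" "z \<in> V" "V \<subseteq> reg" "continuous_on V (\<lambda>w. \<phi> w - ecc i w * sin (\<phi> w))"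
    "\<And>w. w \<in> V \<Longrightarrow> [\<phi> w = Arg2pi (eccv i w)] (rmod (2 * pi))"
    "\<And>w. w \<in> V \<Longrightarrow> [\<phi> w - ecc i w * sin (\<phi> w) = cEll w $ i] (rmod (2 * pi))"
    "(\<phi> has_derivative E) (at z)"
    "((\<lambda>w. \<phi> w - ecc i w * sin (\<phi> w)) has_derivative
      (\<lambda>h. (1 - ecc i z * cos (\<phi> z)) * E h - sin (\<phi> z) * frechet_derivative (ecc i) (at z) h)) (at z)"
proof -
  have cont: "continuous_on reg (eccv i)" by (intro continuous_on_reg differentiable_eccv)
  have d: "(eccv i has_derivative frechet_derivative (eccv i) (at z)) (at z)"
    using differentiable_eccv[OF z] frechet_derivative_works by blast
  obtain V \<phi> where V: "open V" "z \<in> V" "V \<subseteq> reg" "continuous_on V \<phi>"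
    "\<And>w. w \<in> V \<Longrightarrow> cis (\<phi> w) = sgn (eccv i w)"
    "(\<phi> has_derivative (\<lambda>h. Im (frechet_derivative (eccv i) (at z) h / eccv i z))) (at z)"
    using arg_lift[OF open_reg z cont eccv_nz d] by metis
  have e: "(ecc i has_derivative frechet_derivative (ecc i) (at z)) (at z)"
    using differentiable_ecc[OF z] frechet_derivative_works by blast
  have c: "continuous_on V (\<lambda>w. \<phi> w - ecc i w * sin (\<phi> w))"
    using continuous_on_subset[OF continuous_on_reg[OF differentiable_ecc] V(3)] V(4)
    by (intro continuous_intros)
  have arg: "[\<phi> w = Arg2pi (eccv i w)] (rmod (2 * pi))" if "w \<in> V" for w
    using V(3) V(5)[OF that] that cis_Arg2pi[OF eccv_nz[of w i]] by (auto simp: rcong_2pi_iff_cis)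
  have "[\<phi> w - ecc i w * sin (\<phi> w) = cEll w $ i] (rmod (2 * pi))" if "w \<in> V" for w
  proof -
    have w: "w \<in> reg" using V(3) that by auto
    have "sin (\<phi> w) = Im (eccv i w) / ecc i w"
      using arg_cong[OF V(5)[OF that], of Im] by (simp add: sgn_eq norm_eccv[OF w])
    then have "ecc i w * sin (\<phi> w) = Im (eccv i w)" using ecc_pos[OF w, of i] by simp
    then show ?thesis using arg[OF that] by (simp add: coords[OF w] rcong_diff)
  qed
  moreover have "((\<lambda>w. \<phi> w - ecc i w * sin (\<phi> w)) has_derivative
      (\<lambda>h. (1 - ecc i z * cos (\<phi> z)) * Im (frechet_derivative (eccv i) (at z) h / eccv i z) - sin (\<phi> z) * frechet_derivative (ecc i) (at z) h)) (at z)"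
    by (rule derivative_eq_intros V(6) e refl)+ (simp add: fun_eq_iff algebra_simps)
  ultimately show thesis using that[OF V(1-3) c arg _ V(6)] by blast
qed

text \<open>
  Every passage between consecutive frames is a rotation about a common axis, which only matters for the
  axes \<open>S\<^sup>(\<^sup>j\<^sup>)\<close> and \<open>P\<^sup>(\<^sup>j\<^sup>)\<close>.
\<close>

lemma frame_chain:
  assumes z: "z \<in> reg"
  defines "D f \<equiv> frechet_derivative f (at z)"
  defines "sp f g h \<equiv> spin (f z) (D f h) (g z) (D g h)"
  defines "d\<chi> j h \<equiv> D (\<lambda>z. S z j) h \<bullet> sS j z + S z j \<bullet> D (sS j) h"
    and "d\<Theta> j h \<equiv> D (\<lambda>z. S z j) h \<bullet> pre j z + S z j \<bullet> D (pre j) h"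
    and "d\<kappa> j h \<equiv> D (nn j) h \<bullet> (sS j z \<times> nn j z) - D (nu j) h \<bullet> (sS j z \<times> nu j z)"
    and "d\<theta> j h \<equiv> D (nu j) h \<bullet> (pre j z \<times> nu j z) - D (ref j) h \<bullet> (pre j z \<times> ref j z)"
  shows "(\<Sum>j\<in>UNIV. frame_form (angmom z j) (D (\<lambda>z. angmom z j)) (sp (peri j) (sC j)) u v) =
    (\<Sum>j\<in>UNIV. d\<chi> j u * d\<kappa> j v - d\<chi> j v * d\<kappa> j u) + (\<Sum>j\<in>UNIV. d\<Theta> j u * d\<theta> j v - d\<Theta> j v * d\<theta> j u)"
proof -
  note U = open_reg z
  have Dd: "(f has_derivative D f) (at z)" if "f differentiable at z" for f :: "'n phase \<Rightarrow> real^3"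
    using that frechet_derivative_works unfolding D_def by blast
  note d = differentiable_peri[OF z] differentiable_pre[OF z] differentiable_nu[OF z] differentiable_nn[OF z]
    differentiable_ref[OF z] differentiable_sS[OF z] differentiable_sC[OF z] differentiable_S[of _ z] differentiable_angmom[of _ z]
  have orth: "D f h \<bullet> g z + f z \<bullet> D g h = 0"
    if "f differentiable at z" "g differentiable at z" "\<And>w. w \<in> reg \<Longrightarrow> f w \<bullet> g w = 0" for f g h
    using inner_derivative_if_orthogonal[OF U Dd Dd, OF that] .
  have unit: "f z \<bullet> D f h = 0" if "f differentiable at z" "\<And>w. w \<in> reg \<Longrightarrow> norm (f w) = 1" for f h
    using inner_derivative_zero_if_norm_1[OF U Dd, OF that] .
  have comm: "frame_form s s' (sp f g) u v = frame_form s s' (sp g f) u v"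
    if "f differentiable at z" "g differentiable at z"
      "\<And>w. w \<in> reg \<Longrightarrow> norm (f w) = 1 \<and> norm (g w) = 1 \<and> f w \<bullet> g w = 0" for f g s s'
  proof -
    have "sp f g = sp g f"
      unfolding sp_def
      by (rule ext, rule spin_commute) (use that z unit orth in auto)
    then show ?thesis by simp
  qed
  have step: "frame_form s s' (sp f g2) u v = frame_form s s' (sp f g1) u v + (t' u * \<theta>' v - t' v * \<theta>' u)"
    if "f differentiable at z" "\<And>w. w \<in> reg \<Longrightarrow> norm (f w) = 1"
      "\<And>h. t' h = s' h \<bullet> f z + s \<bullet> D f h" "\<And>h. \<theta>' h = D g2 h \<bullet> (f z \<times> g2 z) - D g1 h \<bullet> (f z \<times> g1 z)"
    for f g1 g2 s s' t' \<theta>'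
  proof (rule frame_form_rotate)
    show "sp f g2 h = sp f g1 h + \<theta>' h *\<^sub>R f z" for h
      by (simp add: sp_def spin_def that(4) scaleR_diff_left)
    show "sp f g1 h \<times> f z = D f h" for h
      unfolding sp_def using that z unit by (intro spin_cross_first) auto
    show "t' h = s' h \<bullet> f z + s \<bullet> D f h" for h by (rule that(3))
  qed
  \<comment> \<open>A rotation about an axis orthogonal to \<open>s\<close> contributes d(s . f) =
    0, so the second leg of the frame may be exchanged freely.\<close>
  have step0: "frame_form (s z) (D s) (sp f g2) u v = frame_form (s z) (D s) (sp f g1) u v"
    if "f differentiable at z" "s differentiable at z" "\<And>w. w \<in> reg \<Longrightarrow> norm (f w) = 1 \<and> s w \<bullet> f w = 0" for f g1 g2 s
    using step[of f "\<lambda>h. 0" "D s" "s z" "\<lambda>h. D g2 h \<bullet> (f z \<times> g2 z) - D g1 h \<bullet> (f z \<times> g1 z)" g2 g1] that orth by simp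
  define T where "T j = frame_form (S z j) (D (\<lambda>z. S z j)) (sp (pre j) (nu j)) u v" for j
  define K where "K j = frame_form (angmom z j) (D (\<lambda>z. angmom z j)) (sp (peri j) (sC j)) u v" for j
  \<comment> \<open>the contribution of \<open>S\<^sup>(\<^sup>j\<^sup>+\<^sup>1\<^sup>) = S\<^sup>(\<^sup>j\<^sup>) - C\<^sup>(\<^sup>j\<^sup>)\<close> in the frame \<open>(P\<^sup>(\<^sup>j\<^sup>), n\<^sub>j)\<close>\<close>
  define R where "R j = frame_form (S z j - angmom z j) (\<lambda>h. D (\<lambda>z. S z j) h - D (\<lambda>z. angmom z j) h) (sp (peri j) (nn j)) u v" for j
  define X where "X j = d\<chi> j u * d\<kappa> j v - d\<chi> j v * d\<kappa> j u" for j
  define Y where "Y j = d\<Theta> j u * d\<theta> j v - d\<Theta> j v * d\<theta> j u" for j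
  \<comment> \<open>One link, in the axes nu, S, n, P: turns about nu and n are free since S is
    orthogonal to both, and the turn about S yields \<open>X\<close>. In the frame (P, n) the
    momentum is split, and the part C, orthogonal to P, may be moved to the Kepler frame.\<close>
  have TK: "T j + X j = K j + R j" for j
  proof -
    have "T j = frame_form (S z j) (D (\<lambda>z. S z j)) (sp (nu j) (pre j)) u v"
      unfolding T_def by (rule comm) (use d in auto)
    also have "\<dots> = frame_form (S z j) (D (\<lambda>z. S z j)) (sp (nu j) (sS j)) u v"
      by (rule step0) (use d in auto)
    also have "\<dots> = frame_form (S z j) (D (\<lambda>z. S z j)) (sp (sS j) (nu j)) u v"
      by (rule comm) (use d in auto)
    finally have 1: "T j + X j = frame_form (S z j) (D (\<lambda>z. S z j)) (sp (sS j) (nn j)) u v"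
      using step[of "sS j" "d\<chi> j" "D (\<lambda>z. S z j)" "S z j" "d\<kappa> j" "nn j" "nu j"] d
      by (simp add: X_def d\<chi>_def d\<kappa>_def)
    show ?thesis
    proof (cases "j = final")
      \<comment> \<open>For the last body S = C and n = P, so the frame reached is already its
        Kepler frame and nothing is passed on.\<close>
      case True
      have eqs: "(\<lambda>z. S z j) = (\<lambda>z. angmom z j)" "nn j = peri j" "sS j = sC j"
        unfolding True by (auto simp: S_final nn_def sS_def sC_def)
      have Sj: "S z j = angmom z j" by (simp add: True S_final)
      have "R j = 0" unfolding R_def eqs by (simp add: True S_final)
      moreover have "T j + X j = frame_form (angmom z j) (D (\<lambda>z. angmom z j)) (sp (peri j) (sC j)) u v"
        unfolding 1 unfolding eqs Sj by (rule comm) (use d in \<open>auto simp: inner_commute[of "sC _ _"]\<close>)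
      ultimately show ?thesis by (simp add: K_def)
    next
      case False
      have "T j + X j = frame_form (S z j) (D (\<lambda>z. S z j)) (sp (nn j) (sS j)) u v"
        unfolding 1 by (rule comm) (use d in auto)
      also have "\<dots> = frame_form (S z j) (D (\<lambda>z. S z j)) (sp (nn j) (peri j)) u v"
        by (rule step0) (use d in auto)
      also have "\<dots> = frame_form (S z j) (D (\<lambda>z. S z j)) (sp (peri j) (nn j)) u v"
        by (rule comm) (use d False in auto)
      also have "\<dots> = frame_form (angmom z j) (D (\<lambda>z. angmom z j)) (sp (peri j) (nn j)) u v + R j"
        unfolding R_def using frame_form_add[of "angmom z j" "S z j - angmom z j" "D (\<lambda>z. angmom z j)"
          "\<lambda>h. D (\<lambda>z. S z j) h - D (\<lambda>z. angmom z j) h" "sp (peri j) (nn j)" u v] by simp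
      also have "frame_form (angmom z j) (D (\<lambda>z. angmom z j)) (sp (peri j) (nn j)) u v = K j"
        unfolding K_def by (rule step0) (use d in auto)
      finally show ?thesis .
    qed
  qed
  \<comment> \<open>The chain starts at the fixed axes, whose angular velocity is zero.\<close>
  have T_first: "T first - Y first = 0"
  proof -
    have "sp (pre first) (ref first) = (\<lambda>h. 0)"
      by (simp add: sp_def spin_def D_def pre_def[abs_def] ref_def[abs_def] fun_eq_iff)
    then show ?thesis
      using step[of "pre first" "d\<Theta> first" "D (\<lambda>z. S z first)" "S z first" "d\<theta> first" "nu first" "ref first"] d
      by (simp add: T_def Y_def d\<Theta>_def d\<theta>_def)
  qed
  \<comment> \<open>What the previous link leaves is S(j) in the frame of its perihelion and node;
    the turn about that perihelion towards nu yields \<open>Y\<close>.\<close>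
  have T_prv: "T j - Y j = R (prv j)" if "j \<noteq> first" for j
  proof -
    have eqs: "pre j = peri (prv j)" "ref j = nn (prv j)" using that by (auto simp: pre_def ref_def)
    have "((\<lambda>z. S z (prv j)) has_derivative (\<lambda>h. D (\<lambda>z. angmom z (prv j)) h + D (\<lambda>z. S z j) h)) (at z)"
      using has_derivative_add[OF Dd[OF d(9)] Dd[OF d(8)]] unfolding S_prv[OF that] .
    from has_derivative_unique[OF Dd[OF d(8)] this]
    have "D (\<lambda>z. S z (prv j)) = (\<lambda>h. D (\<lambda>z. angmom z (prv j)) h + D (\<lambda>z. S z j) h)" .
    then have "R (prv j) = frame_form (S z j) (D (\<lambda>z. S z j)) (sp (pre j) (ref j)) u v"
      unfolding R_def eqs by (simp add: S_prv[OF that])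
    then show ?thesis
      using step[of "pre j" "d\<Theta> j" "D (\<lambda>z. S z j)" "S z j" "d\<theta> j" "nu j" "ref j"] d
      by (simp add: T_def Y_def d\<Theta>_def d\<theta>_def)
  qed
  have R_final: "R final = 0"
  proof -
    have "(\<lambda>z. S z final) = (\<lambda>z :: 'n phase. angmom z final)" by (simp add: S_final fun_eq_iff)
    then show ?thesis unfolding R_def by (simp add: S_final)
  qed
  have "(\<Sum>j\<in>UNIV. T j - Y j) = (\<Sum>j\<in>UNIV. R j)"
    by (rule sum_telescope_prv[OF T_first R_final T_prv])
  moreover have "K j = (T j - Y j) + X j + Y j - R j" for j using TK[of j] by simp
  ultimately show ?thesis
    unfolding K_def[symmetric] X_def[symmetric] Y_def[symmetric]
    by (simp add: sum.distrib sum_subtractf)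
qed

lemma c_Lambda_has_derivative:
  assumes z: "z \<in> reg"
  shows "(cLam has_derivative
    (\<lambda>h. \<chi> i. sqrt (kk i / sma i z) / 2 * frechet_derivative (sma i) (at z) h)) (at z)"
proof (rule has_derivative_vecI)
  fix i
  have pos: "0 < sma i z" "0 < kk i" using sma_pos_reg[OF z] mass_pos by auto
  have d: "(sma i has_derivative frechet_derivative (sma i) (at z)) (at z)"
    using differentiable_sma[OF z] frechet_derivative_works by blast
  have "(sqrt has_derivative (*) (inverse (sqrt (kk i * sma i z)) / 2)) (at (kk i * sma i z))"
    using DERIV_real_sqrt[of "kk i * sma i z"] pos by (simp add: has_field_derivative_def)
  from has_derivative_compose[OF has_derivative_mult_right[OF d] this]
  have "((\<lambda>w. sqrt (kk i * sma i w)) has_derivative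
      (\<lambda>h. inverse (sqrt (kk i * sma i z)) / 2 * (kk i * frechet_derivative (sma i) (at z) h))) (at z)" .
  moreover have "inverse (sqrt (kk i * sma i z)) / 2 * (kk i * t) = sqrt (kk i / sma i z) / 2 * t" for t
  proof -
    have "inverse (sqrt (kk i * sma i z)) * kk i = sqrt (kk i / sma i z)"
      using sqrt_div_mult(2)[OF pos] pos by (simp add: field_simps)
    moreover have "inverse (sqrt (kk i * sma i z)) / 2 * (kk i * t) = inverse (sqrt (kk i * sma i z)) * kk i / 2 * t"
      by simp
    ultimately show ?thesis by (simp only:)
  qed
  ultimately have "((\<lambda>w. sqrt (kk i * sma i w)) has_derivative
      (\<lambda>h. sqrt (kk i / sma i z) / 2 * frechet_derivative (sma i) (at z) h)) (at z)" by (simp only:)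
  then show "((\<lambda>w. cLam w $ i) has_derivative
      (\<lambda>h. (\<chi> i. sqrt (kk i / sma i z) / 2 * frechet_derivative (sma i) (at z) h) $ i)) (at z)"
    using coords(1) by (auto intro: has_derivative_transform_within_open[OF _ open_reg z])
qed

text \<open>The norm of S is written as the inner product with its own direction, which gives the
  derivative in the shape that \<open>frame_chain\<close> uses for the axis S.\<close>

lemma c_chi_has_derivative:
  assumes z: "z \<in> reg"
  shows "(c_chi has_derivative
    (\<lambda>h. \<chi> j. frechet_derivative (\<lambda>z. S z j) (at z) h \<bullet> sS j z + S z j \<bullet> frechet_derivative (sS j) (at z) h)) (at z)"
proof (rule has_derivative_vecI)
  fix j
  have "((\<lambda>w. S w j \<bullet> sS j w) has_derivative
     (\<lambda>h. S z j \<bullet> frechet_derivative (sS j) (at z) h + frechet_derivative (\<lambda>z. S z j) (at z) h \<bullet> sS j z)) (at z)"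
    using differentiable_S[of j z] differentiable_sS[OF z, of j]
    by (intro has_derivative_inner) (simp_all add: frechet_derivative_works[symmetric])
  moreover have "S w j \<bullet> sS j w = c_chi w $ j" for w :: "'n phase"
    by (cases "S w j = 0") (simp_all add: c_chi_def sS_def sgn_div_norm dot_square_norm power2_eq_square)
  ultimately show "((\<lambda>w. c_chi w $ j) has_derivative (\<lambda>h. (\<chi> j. frechet_derivative (\<lambda>z. S z j) (at z) h \<bullet> sS j z +
      S z j \<bullet> frechet_derivative (sS j) (at z) h) $ j)) (at z)"
    by (simp add: add.commute)
qed

lemma c_Theta_has_derivative:
  assumes z: "z \<in> reg"
  shows "(cTheta has_derivative
    (\<lambda>h. \<chi> j. frechet_derivative (\<lambda>z. S z j) (at z) h \<bullet> pre j z + S z j \<bullet> frechet_derivative (pre j) (at z) h)) (at z)"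
proof (rule has_derivative_vecI)
  fix j
  have "((\<lambda>w. S w j \<bullet> pre j w) has_derivative
     (\<lambda>h. S z j \<bullet> frechet_derivative (pre j) (at z) h + frechet_derivative (\<lambda>z. S z j) (at z) h \<bullet> pre j z)) (at z)"
    using differentiable_S[of j z] differentiable_pre[OF z, of j]
    by (intro has_derivative_inner) (simp_all add: frechet_derivative_works[symmetric])
  then show "((\<lambda>w. cTheta w $ j) has_derivative (\<lambda>h. (\<chi> j. frechet_derivative (\<lambda>z. S z j) (at z) h \<bullet> pre j z +
      S z j \<bullet> frechet_derivative (pre j) (at z) h) $ j)) (at z)"
    using coords(5) by (auto intro: has_derivative_transform_within_open[OF _ open_reg z] simp: add.commute)
qed

lemma body_wedge:
  assumes z: "z \<in> reg" and V: "open V" "z \<in> V" "V \<subseteq> reg"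
    and \<phi>: "\<And>w. w \<in> V \<Longrightarrow> [\<phi> w = Arg2pi (eccv i w)] (rmod (2 * pi))" "(\<phi> has_derivative E) (at z)"
  shows "fst u $ i \<bullet> snd v $ i - fst v $ i \<bullet> snd u $ i =
    (sqrt (kk i / sma i z) / 2 * frechet_derivative (sma i) (at z) u *
       ((1 - ecc i z * cos (\<phi> z)) * E v - sin (\<phi> z) * frechet_derivative (ecc i) (at z) v) -
     sqrt (kk i / sma i z) / 2 * frechet_derivative (sma i) (at z) v *
       ((1 - ecc i z * cos (\<phi> z)) * E u - sin (\<phi> z) * frechet_derivative (ecc i) (at z) u))
    + frame_form (angmom z i) (frechet_derivative (\<lambda>z. angmom z i) (at z))
        (\<lambda>h. spin (peri i z) (frechet_derivative (peri i) (at z) h) (sC i z) (frechet_derivative (sC i) (at z) h)) u v"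
proof -
  have x: "((\<lambda>z :: 'n phase. snd z $ i) has_derivative (\<lambda>h. snd h $ i)) (at z)"
    and y: "((\<lambda>z :: 'n phase. fst z $ i) has_derivative (\<lambda>h. fst h $ i)) (at z)"
    by (intro bounded_linear_imp_has_derivative bounded_linear_compose[OF bounded_linear_vec_nth bounded_linear_snd]
      bounded_linear_compose[OF bounded_linear_vec_nth bounded_linear_fst])+
  have w: "((f :: 'n phase \<Rightarrow> 'b::real_normed_vector) has_derivative frechet_derivative f (at z)) (at z)"
    if "f differentiable at z" for f using that frechet_derivative_works by blast
  have "frechet_derivative (\<lambda>z. angmom z i) (at z) = (\<lambda>h. snd z $ i \<times> fst h $ i + snd h $ i \<times> fst z $ i)"
    using has_derivative_unique[OF w[OF differentiable_angmom]] has_derivative_cross3[OF x y]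
    by (simp add: angmom_def)
  \<comment> \<open>Only the sine and cosine of the anomaly enter \<open>kpos\<close> and
    \<open>kmom\<close>, so the lift may replace \<open>Arg2pi\<close>.\<close>
  moreover have "cos (\<phi> w) = cos (Arg2pi (eccv i w))" "sin (\<phi> w) = sin (Arg2pi (eccv i w))" if "w \<in> V" for w
    using \<phi>(1)[OF that] by (auto simp: rcong_2pi_iff_cis complex_eq_iff)
  then have "snd w $ i = kpos (sma i w) (ecc i w) (\<phi> w) (peri i w) (sC i w \<times> peri i w)"
    "fst w $ i = kmom (kk i) (sma i w) (ecc i w) (\<phi> w) (peri i w) (sC i w \<times> peri i w)" if "w \<in> V" for w
    using position_eq[of w i] momentum_eq[of w i] V(3) that by (auto simp: kpos_def kmom_def)
  ultimately show ?thesis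
    unfolding angmom_def
    using V(3) by (subst kepler_wedge[OF V(1,2) w[OF differentiable_sma[OF z, of i]] w[OF differentiable_ecc[OF z, of i]] \<phi>(2)
      w[OF differentiable_peri[OF z, of i]] w[OF differentiable_sC[OF z, of i]] x y])
      (auto simp: sma_pos_reg z ecc_pos ecc_less_1_reg mass_pos subset_iff)
qed

lemma oangle_lift_reg:
  assumes z: "z \<in> reg"
    and d: "\<And>w. w \<in> reg \<Longrightarrow> p differentiable at w \<and> q differentiable at w \<and> r differentiable at w"
    and on: "\<And>w. w \<in> reg \<Longrightarrow> norm (p w) = 1 \<and> norm (q w) = 1 \<and> norm (r w) = 1 \<and> q w \<bullet> p w = 0 \<and> r w \<bullet> p w = 0"
  shows "\<exists>V \<phi>. open V \<and> z \<in> V \<and> V \<subseteq> reg \<and> continuous_on V \<phi> \<and>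
    (\<forall>w\<in>V. [\<phi> w = oangle (p w) (q w) (r w)] (rmod (2 * pi))) \<and>
    (\<phi> has_derivative (\<lambda>h. frechet_derivative r (at z) h \<bullet> (p z \<times> r z) - frechet_derivative q (at z) h \<bullet> (p z \<times> q z))) (at z)"
proof -
  have w: "(f has_derivative frechet_derivative f (at z)) (at z)"
    if "f differentiable at z" for f :: "'n phase \<Rightarrow> real^3" using that frechet_derivative_works by blast
  have c: "continuous_on reg p" "continuous_on reg q" "continuous_on reg r"
    using d by (auto intro: continuous_on_reg)
  show ?thesis
    by (rule oangle_lift[OF open_reg z c w w w]) (use d[OF z] on in blast)+
qed

text \<open>The lifts are restricted to a common neighbourhood. \<open>body_wedge\<close> summed
  over the bodies gives dLambda ^ dl and the Kepler frame terms, which \<open>frame_chain\<close>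
  converts. Continuity on all of \<open>V\<close> is recorded for the later use of invariance of
  domain.\<close>

lemma local_chart:
  assumes z: "z \<in> reg"
  obtains V \<phi>l \<phi>\<kappa> \<phi>\<theta> d\<Lambda> d\<chi> d\<Theta> dl d\<kappa> d\<theta> where
    "open V" "z \<in> V" "V \<subseteq> reg" "continuous_on V \<phi>l" "continuous_on V \<phi>\<kappa>" "continuous_on V \<phi>\<theta>"
    "\<And>w. w \<in> V \<Longrightarrow> angle_cong (\<phi>l w) (cEll w)"
    "\<And>w. w \<in> V \<Longrightarrow> angle_cong (\<phi>\<kappa> w) (cKap w)"
    "\<And>w. w \<in> V \<Longrightarrow> angle_cong (\<phi>\<theta> w) (ctheta w)"
    "(cLam has_derivative d\<Lambda>) (at z)" "(c_chi has_derivative d\<chi>) (at z)"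
    "(cTheta has_derivative d\<Theta>) (at z)"
    "(\<phi>l has_derivative dl) (at z)" "(\<phi>\<kappa> has_derivative d\<kappa>) (at z)" "(\<phi>\<theta> has_derivative d\<theta>) (at z)"
    "\<And>u v. wedge d\<Lambda> dl u v + wedge d\<chi> d\<kappa> u v + wedge d\<Theta> d\<theta> u v = wedge fst snd u v"
proof -
  define Q where "Q p q r V \<phi> \<longleftrightarrow> open V \<and> z \<in> V \<and> V \<subseteq> reg \<and> continuous_on V \<phi> \<and>
      (\<forall>w\<in>V. [\<phi> w = oangle (p w) (q w) (r w)] (rmod (2 * pi))) \<and>
      (\<phi> has_derivative (\<lambda>h. frechet_derivative r (at z) h \<bullet> (p z \<times> r z) - frechet_derivative q (at z) h \<bullet> (p z \<times> q z))) (at z)"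
    for p q r :: "'n phase \<Rightarrow> real^3" and V \<phi>
  have "\<exists>V \<phi>. Q (sS j) (nu j) (nn j) V \<phi>" for j
    unfolding Q_def by (intro oangle_lift_reg z) (auto simp: differentiable_sS differentiable_nu differentiable_nn)
  then obtain V1 \<kappa> where "\<And>j. Q (sS j) (nu j) (nn j) (V1 j) (\<kappa> j)" by metis
  note \<kappa> = this[unfolded Q_def]
  have "\<exists>V \<phi>. Q (pre j) (ref j) (nu j) V \<phi>" for j
    unfolding Q_def by (intro oangle_lift_reg z) (auto simp: differentiable_pre differentiable_nu differentiable_ref)
  then obtain V2 \<theta> where "\<And>j. Q (pre j) (ref j) (nu j) (V2 j) (\<theta> j)" by metis
  note \<theta> = this[unfolded Q_def]
  define Q' where "Q' i V \<phi> E \<longleftrightarrow> open V \<and> z \<in> V \<and> V \<subseteq> reg \<and> continuous_on V (\<lambda>w. \<phi> w - ecc i w * sin (\<phi> w)) \<and>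
    (\<forall>w\<in>V. [\<phi> w = Arg2pi (eccv i w)] (rmod (2 * pi))) \<and>
    (\<forall>w\<in>V. [\<phi> w - ecc i w * sin (\<phi> w) = cEll w $ i] (rmod (2 * pi))) \<and>
    (\<phi> has_derivative E) (at z) \<and>
    ((\<lambda>w. \<phi> w - ecc i w * sin (\<phi> w)) has_derivative
      (\<lambda>h. (1 - ecc i z * cos (\<phi> z)) * E h - sin (\<phi> z) * frechet_derivative (ecc i) (at z) h)) (at z)"
    for i and V :: "'n phase set" and \<phi> E
  have "\<exists>V \<phi> E. Q' i V \<phi> E" for i
    unfolding Q'_def by (rule mean_anomaly_lift[OF z, of i]) blast
  then obtain V3 \<phi> E where "\<And>i. Q' i (V3 i) (\<phi> i) (E i)" by metis
  note \<phi> = this[unfolded Q'_def]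
  define V where "V = (\<Inter>j. V1 j \<inter> V2 j \<inter> V3 j)"
  have "open (V1 j \<inter> V2 j \<inter> V3 j)" for j
    using \<kappa>[of j] \<theta>[of j] \<phi>[of j] by (intro open_Int) blast+
  then have V: "open V" "z \<in> V" "V \<subseteq> V1 j" "V \<subseteq> V2 j" "V \<subseteq> V3 j" for j
    using \<kappa> \<theta> \<phi> by (auto simp: V_def intro: open_INT)
  have Vreg: "V \<subseteq> reg" using V(3) \<kappa> by blast
  have cl: "continuous_on V (\<lambda>w. \<chi> i. \<phi> i w - ecc i w * sin (\<phi> i w))"
    and c\<kappa>: "continuous_on V (\<lambda>w. \<chi> j. \<kappa> j w)" and c\<theta>: "continuous_on V (\<lambda>w. \<chi> j. \<theta> j w)"
  proof -
    have "continuous_on V (\<lambda>w. \<phi> i w - ecc i w * sin (\<phi> i w))" "continuous_on V (\<kappa> i)" "continuous_on V (\<theta> i)" for i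
      using \<kappa>[of i] \<theta>[of i] \<phi>[of i] V(3-5)[of i] continuous_on_subset by blast+
    then show "continuous_on V (\<lambda>w. \<chi> i. \<phi> i w - ecc i w * sin (\<phi> i w))"
      "continuous_on V (\<lambda>w. \<chi> j. \<kappa> j w)" "continuous_on V (\<lambda>w. \<chi> j. \<theta> j w)"
      by (auto intro!: continuous_on_vec_lambda)
  qed
  have al: "angle_cong (\<chi> i. \<phi> i w - ecc i w * sin (\<phi> i w)) (cEll w)"
    and a\<kappa>: "angle_cong (\<chi> j. \<kappa> j w) (cKap w)" and a\<theta>: "angle_cong (\<chi> j. \<theta> j w) (ctheta w)"
    if "w \<in> V" for w
  proof -
    have w: "w \<in> V1 i" "w \<in> V2 i" "w \<in> V3 i" "w \<in> reg" for i using that V(3-5)[of i] Vreg by blast+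
    have "[\<phi> i w - ecc i w * sin (\<phi> i w) = cEll w $ i] (rmod (2 * pi))" 
      "[\<kappa> i w = oangle (sS i w) (nu i w) (nn i w)] (rmod (2 * pi))"
      "[\<theta> i w = oangle (pre i w) (ref i w) (nu i w)] (rmod (2 * pi))" for i
      using \<kappa>[of i] \<theta>[of i] \<phi>[of i] w(1-3)[of i] by blast+
    then show "angle_cong (\<chi> i. \<phi> i w - ecc i w * sin (\<phi> i w)) (cEll w)"
      "angle_cong (\<chi> j. \<kappa> j w) (cKap w)" "angle_cong (\<chi> j. \<theta> j w) (ctheta w)"
      unfolding angle_cong_def vec_lambda_beta coords(4,6)[OF w(4)] by blast+
  qed
  let ?d\<Lambda> = "\<lambda>h. \<chi> i. sqrt (kk i / sma i z) / 2 * frechet_derivative (sma i) (at z) h"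
  let ?d\<chi> = "\<lambda>h. \<chi> j. frechet_derivative (\<lambda>z. S z j) (at z) h \<bullet> sS j z + S z j \<bullet> frechet_derivative (sS j) (at z) h"
  let ?d\<Theta> = "\<lambda>h. \<chi> j. frechet_derivative (\<lambda>z. S z j) (at z) h \<bullet> pre j z + S z j \<bullet> frechet_derivative (pre j) (at z) h"
  let ?dl = "\<lambda>h. \<chi> i. (1 - ecc i z * cos (\<phi> i z)) * E i h - sin (\<phi> i z) * frechet_derivative (ecc i) (at z) h"
  let ?d\<kappa> = "\<lambda>h. \<chi> j. frechet_derivative (nn j) (at z) h \<bullet> (sS j z \<times> nn j z) - frechet_derivative (nu j) (at z) h \<bullet> (sS j z \<times> nu j z)"
  let ?d\<theta> = "\<lambda>h. \<chi> j. frechet_derivative (nu j) (at z) h \<bullet> (pre j z \<times> nu j z) - frechet_derivative (ref j) (at z) h \<bullet> (pre j z \<times> ref j z)"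
  have dl: "((\<lambda>w. \<chi> i. \<phi> i w - ecc i w * sin (\<phi> i w)) has_derivative ?dl) (at z)"
    and d\<kappa>: "((\<lambda>w. \<chi> j. \<kappa> j w) has_derivative ?d\<kappa>) (at z)" and d\<theta>: "((\<lambda>w. \<chi> j. \<theta> j w) has_derivative ?d\<theta>) (at z)"
    using \<kappa> \<theta> \<phi> by (auto intro!: has_derivative_vecI)
  have sympl: "wedge ?d\<Lambda> ?dl u v + wedge ?d\<chi> ?d\<kappa> u v + wedge ?d\<Theta> ?d\<theta> u v = wedge fst snd u v" for u v :: "'n phase"
  proof -
    have prem: "open (V3 i)" "z \<in> V3 i" "V3 i \<subseteq> reg" "\<And>w. w \<in> V3 i \<Longrightarrow> [\<phi> i w = Arg2pi (eccv i w)] (rmod (2 * pi))"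
      "(\<phi> i has_derivative E i) (at z)" for i
      using \<phi>[of i] by blast+
    have "wedge fst snd u v = (\<Sum>i\<in>UNIV. fst u $ i \<bullet> snd v $ i - fst v $ i \<bullet> snd u $ i)"
      by (simp add: wedge_def inner_vec_def sum_subtractf)
    also have "\<dots> = (\<Sum>i\<in>UNIV. (sqrt (kk i / sma i z) / 2 * frechet_derivative (sma i) (at z) u *
       ((1 - ecc i z * cos (\<phi> i z)) * E i v - sin (\<phi> i z) * frechet_derivative (ecc i) (at z) v) -
     sqrt (kk i / sma i z) / 2 * frechet_derivative (sma i) (at z) v *
       ((1 - ecc i z * cos (\<phi> i z)) * E i u - sin (\<phi> i z) * frechet_derivative (ecc i) (at z) u))
    + frame_form (angmom z i) (frechet_derivative (\<lambda>z. angmom z i) (at z))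
        (\<lambda>h. spin (peri i z) (frechet_derivative (peri i) (at z) h) (sC i z) (frechet_derivative (sC i) (at z) h)) u v)"
      by (intro sum.cong refl body_wedge[OF z prem])
    also have "\<dots> = wedge ?d\<Lambda> ?dl u v + (\<Sum>i\<in>UNIV. frame_form (angmom z i) (frechet_derivative (\<lambda>z. angmom z i) (at z))
        (\<lambda>h. spin (peri i z) (frechet_derivative (peri i) (at z) h) (sC i z) (frechet_derivative (sC i) (at z) h)) u v)"
      by (simp add: wedge_def inner_vec_def sum_subtractf sum.distrib)
    also have "\<dots> = wedge ?d\<Lambda> ?dl u v + wedge ?d\<chi> ?d\<kappa> u v + wedge ?d\<Theta> ?d\<theta> u v"
      unfolding frame_chain[OF z] by (simp add: wedge_def inner_vec_def sum_subtractf)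
    finally show ?thesis by simp
  qed
  show thesis
    by (rule that[OF V(1,2) Vreg cl c\<kappa> c\<theta> al a\<kappa> a\<theta> c_Lambda_has_derivative[OF z] c_chi_has_derivative[OF z]
      c_Theta_has_derivative[OF z] dl d\<kappa> d\<theta> sympl])
qed

end

section \<open>Reconstruction of a configuration from its coordinates\<close>

text \<open>The part of \<open>v\<close> orthogonal to \<open>p\<close> is
  \<open>(p \<times> v) \<times> p\<close>. So length, height over the axis and direction of the
  node determine a vector; this serves for S over P and for P over S.\<close>

lemma eq_from_axis:
  assumes p: "norm p = 1" and nz: "p \<times> v \<noteq> 0"
  shows "v = (v \<bullet> p) *\<^sub>R p + sqrt ((norm v)\<^sup>2 - (v \<bullet> p)\<^sup>2) *\<^sub>R (sgn (p \<times> v) \<times> p)"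
proof -
  have "(p \<times> v) \<times> p = v - (v \<bullet> p) *\<^sub>R p"
    using p by (simp add: cross_cross_left dot_square_norm inner_commute)
  moreover have "norm (p \<times> v) = sqrt ((norm v)\<^sup>2 - (v \<bullet> p)\<^sup>2)"
    using norm_cross[of p v] p by (simp add: inner_commute real_sqrt_unique)
  then have "sqrt ((norm v)\<^sup>2 - (v \<bullet> p)\<^sup>2) *\<^sub>R (sgn (p \<times> v) \<times> p) = (p \<times> v) \<times> p"
    using nz by (simp add: sgn_div_norm cross_mult_left flip: \<open>norm (p \<times> v) = _\<close>)
  ultimately show ?thesis by simp
qed

text \<open>Compatibility with the cross product excludes the isometries that reverse
  orientation.\<close>

definition rotation :: "(real^3 \<Rightarrow> real^3) \<Rightarrow> bool" where
  "rotation R \<longleftrightarrow> linear R \<and> (\<forall>a b. R a \<bullet> R b = a \<bullet> b) \<and> (\<forall>a b. R (a \<times> b) = R a \<times> R b)"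

lemma rotation_id: "rotation (\<lambda>v. v)"
  by (simp add: rotation_def linear_id[unfolded id_def])

lemma rotation_exists:
  assumes 1: "norm p = 1" "norm q = 1" "p \<bullet> q = 0" and 2: "norm p' = 1" "norm q' = 1" "p' \<bullet> q' = 0"
  obtains R where "rotation R" "R p = p'" "R q = q'"
proof
  define n n' where "n = p \<times> q" and "n' = p' \<times> q'"
  define R where "R v = (v \<bullet> p) *\<^sub>R p' + (v \<bullet> q) *\<^sub>R q' + (v \<bullet> n) *\<^sub>R n'" for v
  have frame: "a \<bullet> a = 1" "b \<bullet> b = 1" "(a \<times> b) \<bullet> (a \<times> b) = 1" "a \<bullet> b = 0" "b \<bullet> a = 0"
    "a \<bullet> (a \<times> b) = 0" "b \<bullet> (a \<times> b) = 0" "(a \<times> b) \<bullet> a = 0" "(a \<times> b) \<bullet> b = 0"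
    "b \<times> (a \<times> b) = a" "(a \<times> b) \<times> a = b" "b \<times> a = - (a \<times> b)" "(a \<times> b) \<times> b = - a" "a \<times> (a \<times> b) = - b"
    if "norm a = 1" "norm b = 1" "a \<bullet> b = 0" for a b
  proof -
    show "a \<bullet> a = 1" "b \<bullet> b = 1" "a \<bullet> b = 0" "b \<bullet> a = 0" using that by (auto simp: dot_square_norm inner_commute)
    then show "b \<times> (a \<times> b) = a" "(a \<times> b) \<times> a = b" "(a \<times> b) \<times> b = - a" "a \<times> (a \<times> b) = - b" 
      by (simp_all add: Lagrange cross_cross_left)
    show "(a \<times> b) \<bullet> (a \<times> b) = 1" using norm_cross_orthonormal[of a b] that by (simp add: dot_square_norm)
    show "b \<times> a = - (a \<times> b)" by (rule cross_skew)
  qed (simp_all add: dot_cross_self)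
  note f = frame[OF 1, folded n_def] and f' = frame[OF 2, folded n'_def]
  have ex: "v = (v \<bullet> p) *\<^sub>R p + (v \<bullet> q) *\<^sub>R q + (v \<bullet> n) *\<^sub>R n" for v
    using orthonormal_expansion[OF 1, of v] by (simp add: n_def)
  have inner_ex: "a \<bullet> b = (a \<bullet> p) * (b \<bullet> p) + (a \<bullet> q) * (b \<bullet> q) + (a \<bullet> n) * (b \<bullet> n)" for a b
    by (subst ex[of a]) (simp add: inner_simps inner_commute)
  have cross_ex: "a \<times> b = ((a \<bullet> q) * (b \<bullet> n) - (a \<bullet> n) * (b \<bullet> q)) *\<^sub>R p
      + ((a \<bullet> n) * (b \<bullet> p) - (a \<bullet> p) * (b \<bullet> n)) *\<^sub>R q + ((a \<bullet> p) * (b \<bullet> q) - (a \<bullet> q) * (b \<bullet> p)) *\<^sub>R n" for a b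
    by (subst ex[of a], subst ex[of b])
      (simp add: cross_add_left cross_add_right cross_mult_left cross_mult_right f n_def[symmetric] algebra_simps)
  have "R a \<times> R b = ((a \<bullet> q) * (b \<bullet> n) - (a \<bullet> n) * (b \<bullet> q)) *\<^sub>R p'
      + ((a \<bullet> n) * (b \<bullet> p) - (a \<bullet> p) * (b \<bullet> n)) *\<^sub>R q' + ((a \<bullet> p) * (b \<bullet> q) - (a \<bullet> q) * (b \<bullet> p)) *\<^sub>R n'" for a b
    by (simp add: R_def cross_add_left cross_add_right cross_mult_left cross_mult_right f' n'_def[symmetric] algebra_simps)
  moreover have "R (a \<times> b) = ((a \<bullet> q) * (b \<bullet> n) - (a \<bullet> n) * (b \<bullet> q)) *\<^sub>R p'
      + ((a \<bullet> n) * (b \<bullet> p) - (a \<bullet> p) * (b \<bullet> n)) *\<^sub>R q' + ((a \<bullet> p) * (b \<bullet> q) - (a \<bullet> q) * (b \<bullet> p)) *\<^sub>R n'" for a b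
    unfolding cross_ex[of a b] R_def by (simp add: inner_simps f)
  moreover have "R a \<bullet> R b = a \<bullet> b" for a b
    unfolding inner_ex[of a b] R_def by (simp add: inner_simps f')
  moreover have "linear R"
    by (rule linearI) (simp_all add: R_def inner_simps algebra_simps)
  ultimately show "rotation R" by (simp add: rotation_def)
  show "R p = p'" "R q = q'" by (simp_all add: R_def f)
qed

context
  fixes R assumes R: "rotation R"
begin

lemma rot_simps: "R (a + b) = R a + R b" "R (a - b) = R a - R b" "R (c *\<^sub>R a) = c *\<^sub>R R a" "R (a \<times> b) = R a \<times> R b"
  "R a \<bullet> R b = a \<bullet> b" "norm (R a) = norm a" "R (sgn a) = sgn (R a)"
proof -
  have l: "linear R" and i: "\<And>a b. R a \<bullet> R b = a \<bullet> b" using R by (auto simp: rotation_def)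
  show "R (a + b) = R a + R b" "R (a - b) = R a - R b" "R (c *\<^sub>R a) = c *\<^sub>R R a"
    using l by (auto simp: linear_add linear_diff linear_cmul)
  show "R (a \<times> b) = R a \<times> R b" "R a \<bullet> R b = a \<bullet> b" using R by (auto simp: rotation_def)
  show n: "norm (R a) = norm a" by (simp add: norm_eq_sqrt_inner i)
  show "R (sgn a) = sgn (R a)" using l by (simp add: sgn_div_norm n linear_cmul)
qed

lemma rot_kpos: "R (kpos a e E P Q) = kpos a e E (R P) (R Q)" and rot_kmom: "R (kmom k a e E P Q) = kmom k a e E (R P) (R Q)"
  by (simp_all add: kpos_def kmom_def rot_simps)

end

section \<open>The coordinates determine a configuration up to a rotation\<close>

context planetary
begin

context
  fixes z assumes z: "z \<in> reg"
begin

text \<open>The first of four formulas for one link of the chain: ref gives nu, nu gives S, S gives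
  n, and n gives the next perihelion, each with the help of coordinates only.\<close>

lemma nu_from: "nu j z = cos (ctheta z $ j) *\<^sub>R ref j z + sin (ctheta z $ j) *\<^sub>R (pre j z \<times> ref j z)"
  unfolding coords[OF z] using z by (intro oangle_unit(2)) auto

lemma nn_from: "nn j z = cos (cKap z $ j) *\<^sub>R nu j z + sin (cKap z $ j) *\<^sub>R (sS j z \<times> nu j z)"
  unfolding coords[OF z] using z by (intro oangle_unit(2)) auto

lemma S_from: "S z j = (cTheta z $ j) *\<^sub>R pre j z
    + sqrt ((c_chi z $ j)\<^sup>2 - (cTheta z $ j)\<^sup>2) *\<^sub>R (nu j z \<times> pre j z)"
  unfolding coords[OF z] nu_def using z node_eqs(3)[OF z] by (intro eq_from_axis) auto

text \<open>As C is orthogonal to its perihelion P, the momenta of this link and of the next have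
  the same height \<Theta> over P; divided by |S| it is the cosine \<open>t\<close> of the angle
  between P and S.\<close>

lemma peri_from:
  assumes j: "j \<noteq> first"
  defines "t \<equiv> (cTheta z $ j) / (c_chi z $ prv j)"
  shows "peri (prv j) z = t *\<^sub>R sS (prv j) z + sqrt (1 - t\<^sup>2) *\<^sub>R (nn (prv j) z \<times> sS (prv j) z)"
proof -
  define i where "i = prv j"
  have i: "i \<noteq> final" using prv_neq_final[OF j] by (simp add: i_def)
  have Snz: "S z i \<noteq> 0" by (rule regD[OF z])
  have "S z i \<times> peri i z \<noteq> 0" using regD(6)[OF z, of i] i by (auto simp: nn_def)
  then have nz: "sS i z \<times> peri i z \<noteq> 0" using Snz by (simp add: sS_def sgn_div_norm cross_mult_left)
  have "sgn (sS i z \<times> peri i z) = nn i z"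
    using i Snz by (simp add: nn_def sS_def sgn_div_norm cross_mult_left)
  moreover have "peri i z \<bullet> S z i = cTheta z $ j"
    unfolding coords[OF z] using j S_prv[OF j, of z] z by (simp add: i_def pre_def inner_simps inner_commute)
  then have "peri i z \<bullet> sS i z = t"
    unfolding t_def by (simp add: sS_def sgn_div_norm i_def[symmetric] c_chi_def divide_inverse)
  ultimately show ?thesis
    using eq_from_axis[of "sS i z" "peri i z"] z nz by (simp add: i_def)
qed

text \<open>The eccentricity is not a coordinate; it is recovered from \<Lambda>, through
  \<open>sma\<close>, and the length of C.\<close>

lemma ecc_sq: "(ecc i z)\<^sup>2 = 1 - (norm (angmom z i))\<^sup>2 / (kk i * sma i z)"
  using norm_laplace(1)[OF mass_pos(3)[of i], where y = "fst z $ i" and x = "snd z $ i"] regD(2)[OF z, of i]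
  by (simp add: ecc_def lap_def sma_def body_def angmom_def)

lemma c_ell_kepler: "cEll z $ i = Arg2pi (eccv i z) - ecc i z * sin (Arg2pi (eccv i z))"
  using sin_Arg2pi[of "eccv i z"] by (simp add: coords[OF z] norm_eccv[OF z])

lemma cEll_bounds: "0 \<le> cEll z $ i" "cEll z $ i < 2 * pi"
proof -
  note e = less_imp_le[OF ecc_pos[OF z, of i]] ecc_less_1_reg[OF z, of i]
  show "0 \<le> cEll z $ i" "cEll z $ i < 2 * pi"
    using kepler_eq_less_iff[OF e, of "Arg2pi (eccv i z)" 0] kepler_eq_less_iff[OF e, of "Arg2pi (eccv i z)" "2 * pi"]
      Arg2pi_ge_0[of "eccv i z"] Arg2pi_lt_2pi[of "eccv i z"] by (auto simp: c_ell_kepler)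
qed

lemma angle_bounds: "0 \<le> cKap z $ i" "cKap z $ i < 2 * pi"
  "0 \<le> ctheta z $ i" "ctheta z $ i < 2 * pi"
  by (simp_all add: coords[OF z] oangle_bounds)

end

text \<open>All reconstruction formulas are built from inner and cross products and hence commute
  with \<open>R\<close>, so it suffices to match the first frame. The coordinates \<Theta>0,
  \<theta>0, \<kappa>0 only locate that frame in space.\<close>

lemma rotated_configuration:
  assumes z: "z \<in> reg" "z' \<in> reg" and R: "rotation R"
    and first: "S z' first = R (S z first)" "nn first z' = R (nn first z)"
    and eqs: "cLam z' = cLam z" "c_chi z' = c_chi z" "cEll z' = cEll z"
      "\<And>j. j \<noteq> first \<Longrightarrow> cTheta z' $ j = cTheta z $ j"
      "\<And>j. j \<noteq> first \<Longrightarrow> cKap z' $ j = cKap z $ j"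
      "\<And>j. j \<noteq> first \<Longrightarrow> ctheta z' $ j = ctheta z $ j"
  shows "z' = ((\<chi> i. R (fst z $ i)), (\<chi> i. R (snd z $ i)))"
proof -
  note rs = rot_simps[OF R]
  have sS: "sS j z' = R (sS j z)" if "S z' j = R (S z j)" for j using that by (simp add: sS_def rs)
  have peri_prv: "peri (prv j) z' = R (peri (prv j) z)"
    if "j \<noteq> first" "S z' (prv j) = R (S z (prv j))" "nn (prv j) z' = R (nn (prv j) z)" for j
    using peri_from[OF z(1) that(1)] peri_from[OF z(2) that(1)] sS[OF that(2)] that(1,3) by (simp add: eqs rs)
  have SN: "S z' j = R (S z j) \<and> nn j z' = R (nn j z)" for j
  proof (induction j rule: prv_induct)
    case (step j)
    then have p: "pre j z' = R (pre j z)" "ref j z' = R (ref j z)"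
      using peri_prv[of j] by (auto simp: pre_def ref_def)
    have n: "nu j z' = R (nu j z)"
      using nu_from[OF z(1), of j] nu_from[OF z(2), of j] step(1) by (simp add: eqs p rs)
    have "S z' j = R (S z j)"
      using S_from[OF z(1), of j] S_from[OF z(2), of j] step(1) by (simp add: eqs p n rs)
    moreover from sS[OF this] have "nn j z' = R (nn j z)"
      using nn_from[OF z(1), of j] nn_from[OF z(2), of j] step(1) by (simp add: eqs n rs)
    ultimately show ?case by simp
  qed (use first in simp)
  have PC: "peri i z' = R (peri i z) \<and> angmom z' i = R (angmom z i)" for i
  proof (cases "i = final")
    case True
    then show ?thesis using SN[of i] by (simp add: nn_def S_final)
  next
    case False
    then obtain j where j: "j \<noteq> first" "i = prv j" using bij_betw_prv by (auto simp: bij_betw_def)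
    have "angmom w i = S w i - S w j" for w using S_prv[OF j(1), of w] j(2) by simp
    then show ?thesis using peri_prv[OF j(1)] SN j(2) by (auto simp: rs)
  qed
  have "fst z' $ i = R (fst z $ i) \<and> snd z' $ i = R (snd z $ i)" for i
  proof -
    have a: "sma i z' = sma i z"
      using arg_cong[OF eqs(1), of "\<lambda>v. v $ i"] mass_pos(3)[of i] sma_pos_reg[OF z(1), of i] sma_pos_reg[OF z(2), of i]
      by (simp add: coords z)
    have "(ecc i z')\<^sup>2 = (ecc i z)\<^sup>2" using PC[of i] by (simp add: ecc_sq z a rs)
    then have e: "ecc i z' = ecc i z"
      using ecc_pos[OF z(1), of i] ecc_pos[OF z(2), of i] by (simp add: power2_eq_iff_nonneg)
    \<comment> \<open>Equal mean anomalies and equal eccentricities give equal eccentric anomalies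
      by injectivity of Kepler's equation.\<close>
    have "Arg2pi (eccv i z') = Arg2pi (eccv i z)"
      using arg_cong[OF eqs(3), of "\<lambda>v. v $ i"] kepler_eq_inj[of "ecc i z"] ecc_pos[OF z(1), of i] ecc_less_1_reg[OF z(1), of i]
      by (simp add: c_ell_kepler z e)
    moreover have "sC i z' = R (sC i z)" using PC[of i] by (simp add: sC_def rs)
    ultimately show ?thesis
      using PC[of i] a e position_eq[OF z(1), of i] position_eq[OF z(2), of i] momentum_eq[OF z(1), of i] momentum_eq[OF z(2), of i]
      by (simp add: rot_kpos[OF R] rot_kmom[OF R] rs)
  qed
  then show ?thesis by (simp add: prod_eq_iff vec_eq_iff)
qed

text \<open>With \<Theta>0, \<theta>0, \<kappa>0 included, the formulas can start at the fixed axes,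
  and the first frames coincide; the rotation is the identity.\<close>

lemma inj_coords:
  "inj_on (\<lambda>z. (cLam z, c_chi z, cTheta z, cEll z, cKap z, ctheta z)) reg"
proof (rule inj_onI)
  fix z z' assume z: "z \<in> reg" "z' \<in> reg" and "(cLam z, c_chi z, cTheta z, cEll z, cKap z, ctheta z)
    = (cLam z', c_chi z', cTheta z', cEll z', cKap z', ctheta z')"
  then have eqs: "cLam z' = cLam z" "c_chi z' = c_chi z" "cEll z' = cEll z"
      "cTheta z' = cTheta z" "cKap z' = cKap z" "ctheta z' = ctheta z"
    by simp_all
  have p: "pre first z' = pre first z" "ref first z' = ref first z" by (simp_all add: pre_def ref_def)
  have n: "nu first z' = nu first z" using nu_from[OF z(1), of first] nu_from[OF z(2), of first] by (simp add: eqs p)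
  have S: "S z' first = S z first" using S_from[OF z(1), of first] S_from[OF z(2), of first] by (simp add: eqs p n)
  have "nn first z' = nn first z"
    using nn_from[OF z(1), of first] nn_from[OF z(2), of first] S by (simp add: eqs n sS_def)
  from rotated_configuration[OF z rotation_id S this eqs(1-3)] eqs(4-) show "z = z'" by (simp add: vec_lambda_eta)
qed

section \<open>Rotation invariance and existence of the perturbing function\<close>

lemma H_hel_rotate:
  assumes "rotation R"
  shows "H_hel m0 \<mu> m ((\<chi> i. R (fst z $ i)), (\<chi> i. R (snd z $ i))) = H_hel m0 \<mu> m z"
  using rot_simps[OF assms] by (simp add: H_hel_def case_prod_unfold flip: rot_simps(2)[OF assms])

lemma bar_eqD: "bar a = bar b \<Longrightarrow> j \<noteq> first \<Longrightarrow> a $ j = b $ j"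
  by (drule arg_cong[where f = "\<lambda>v. v $ j"]) (simp add: bar_def)

lemma angle_cong_bar: "angle_cong a b \<Longrightarrow> angle_cong (bar a) (bar b)"
  by (simp add: angle_cong_def bar_def)

text \<open>The first frames, of S and n, are two orthonormal pairs, so some rotation carries one to
  the other. It then carries the whole configuration, and H does not change.\<close>

lemma H_hel_eq:
  assumes z: "z \<in> reg" "z' \<in> reg"
    and eqs: "cLam z' = cLam z" "c_chi z' $ first = c_chi z $ first" "bar (c_chi z') = bar (c_chi z)"
      "bar (cTheta z') = bar (cTheta z)" "angle_cong (cEll z') (cEll z)"
      "angle_cong (bar (cKap z')) (bar (cKap z))"
      "angle_cong (bar (ctheta z')) (bar (ctheta z))"
  shows "H_hel m0 \<mu> m z' = H_hel m0 \<mu> m z"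
proof -
  have chi: "c_chi z' = c_chi z" using eqs(2) bar_eqD[OF eqs(3)] by (metis vec_eq_iff)
  have ell: "cEll z' = cEll z"
    using angle_congD[OF eqs(5)] cEll_bounds[OF z(1)] cEll_bounds[OF z(2)] rcong_2pi_imp_eq by (metis vec_eq_iff)
  have kap: "cKap z' $ j = cKap z $ j" if "j \<noteq> first" for j
    using angle_congD[OF eqs(6), of j] that angle_bounds[OF z(1), of j] angle_bounds[OF z(2), of j]
    by (intro rcong_2pi_imp_eq) (simp_all add: bar_def)
  have the: "ctheta z' $ j = ctheta z $ j" if "j \<noteq> first" for j
    using angle_congD[OF eqs(7), of j] that angle_bounds[OF z(1), of j] angle_bounds[OF z(2), of j]
    by (intro rcong_2pi_imp_eq) (simp_all add: bar_def)
  obtain R where R: "rotation R" "R (sS first z) = sS first z'" "R (nn first z) = nn first z'"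
    by (rule rotation_exists[of "sS first z" "nn first z" "sS first z'" "nn first z'"]) (use z in auto)
  have "S z first = c_chi z $ first *\<^sub>R sS first z" "S z' first = c_chi z $ first *\<^sub>R sS first z'"
    using regD(4)[OF z(1), of first] regD(4)[OF z(2), of first] chi[symmetric]
    by (auto simp: c_chi_def sS_def sgn_div_norm vec_eq_iff)
  then have "S z' first = R (S z first)" by (simp add: rot_simps[OF R(1)] R)
  from rotated_configuration[OF z R(1) this R(3)[symmetric] eqs(1) chi ell bar_eqD[OF eqs(4)] kap the]
  show ?thesis using H_hel_rotate[OF R(1)] by simp
qed

text \<open>The value is read off any configuration that realises the arguments, compared modulo 2
  pi in the angles; by \<open>H_hel_eq\<close> the choice is immaterial.\<close>

lemma perturbing_function_exists: "\<exists>f. perturbing_function m0 \<mu> m f"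
proof -
  define C where "C x0 L X T l K Q z \<longleftrightarrow> z \<in> reg \<and> c_chi z $ first = x0 \<and> cLam z = L \<and> bar (c_chi z) = X \<and>
     bar (cTheta z) = T \<and> angle_cong l (cEll z) \<and> angle_cong K (bar (cKap z)) \<and>
     angle_cong Q (bar (ctheta z))" for x0 L X T l K Q z
  define f where "f x0 L X T l K Q = (H_hel m0 \<mu> m (SOME z. C x0 L X T l K Q z) - h_K m0 \<mu> m L) / \<mu>" for x0 L X T l K Q
  have "perturbing_function m0 \<mu> m f"
    unfolding perturbing_function_def
  proof (intro ballI allI impI)
    fix z l k t assume z: "z \<in> reg" and "angle_cong l (cEll z) \<and> angle_cong k (cKap z) \<and> angle_cong t (ctheta z)"
    then have Cz: "C (c_chi z $ first) (cLam z) (bar (c_chi z)) (bar (cTheta z)) l (bar k) (bar t) z"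
      by (auto simp: C_def angle_cong_bar)
    define z' where "z' = (SOME w. C (c_chi z $ first) (cLam z) (bar (c_chi z)) (bar (cTheta z)) l (bar k) (bar t) w)"
    have "C (c_chi z $ first) (cLam z) (bar (c_chi z)) (bar (cTheta z)) l (bar k) (bar t) z'"
      unfolding z'_def using Cz by (rule someI)
    then have z': "z' \<in> reg" "cLam z' = cLam z" "c_chi z' $ first = c_chi z $ first"
        "bar (c_chi z') = bar (c_chi z)" "bar (cTheta z') = bar (cTheta z)"
      and a: "angle_cong l (cEll z')" "angle_cong (bar k) (bar (cKap z'))"
        "angle_cong (bar t) (bar (ctheta z'))"
      unfolding C_def by blast+
    from Cz have "angle_cong l (cEll z)" "angle_cong (bar k) (bar (cKap z))"
        "angle_cong (bar t) (bar (ctheta z))"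
      unfolding C_def by blast+
    then have "H_hel m0 \<mu> m z' = H_hel m0 \<mu> m z"
      using a[THEN angle_cong_sym] by (intro H_hel_eq[OF z z']) (erule angle_cong_trans, assumption)+
    then show "H_hel m0 \<mu> m z = h_K m0 \<mu> m (cLam z) +
        \<mu> * f (c_chi z $ first) (cLam z) (bar (c_chi z)) (bar (cTheta z)) l (bar k) (bar t)"
      using \<mu>_pos by (simp add: f_def z'_def)
  qed
  then show ?thesis by (intro exI)
qed

end

section \<open>Reflection, conservation laws and equilibria\<close>

lemma reflect3_nth [simp]: "reflect3 v $ 1 = v $ 1" "reflect3 v $ 2 = - v $ 2" "reflect3 v $ 3 = v $ 3"
  by (simp_all add: reflect3_def)

lemma reflect3_inner: "reflect3 a \<bullet> reflect3 b = a \<bullet> b"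
  by (simp add: inner_vec_def sum_3)

text \<open>The sign is the determinant of the reflection. Angular momenta are pseudovectors,
  whereas perihelia and nodes transform as true vectors; all sign changes of the coordinates come
  from this.\<close>

lemma reflect3_cross: "reflect3 a \<times> reflect3 b = - reflect3 (a \<times> b)"
  by (simp add: vec_eq_iff forall_3 cross_components)

lemma linear_reflect3: "linear reflect3"
  by (rule linearI) (simp_all add: vec_eq_iff forall_3)

lemma reflect3_reflect3 [simp]: "reflect3 (reflect3 v) = v"
  by (simp add: vec_eq_iff forall_3)

lemma reflect3_eq_iff [simp]: "reflect3 a = reflect3 b \<longleftrightarrow> a = b"
  by (metis reflect3_reflect3)

lemma norm_reflect3 [simp]: "norm (reflect3 v) = norm v"
  by (simp add: norm_eq_sqrt_inner reflect3_inner)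

lemma reflect3_simps: "reflect3 (a + b) = reflect3 a + reflect3 b" "reflect3 (a - b) = reflect3 a - reflect3 b"
  "reflect3 (- a) = - reflect3 a" "reflect3 (c *\<^sub>R a) = c *\<^sub>R reflect3 a" "reflect3 (sgn a) = sgn (reflect3 a)"
  "reflect3 (sum h A) = (\<Sum>i\<in>A. reflect3 (h i))" "reflect3 0 = 0"
  using linear_reflect3
  by (simp_all add: sgn_div_norm linear_add linear_diff linear_neg linear_cmul linear_sum linear_0)

lemma reflect3_eq_0_iff [simp]: "reflect3 a = 0 \<longleftrightarrow> a = 0"
  using reflect3_eq_iff[of a 0] by (simp add: reflect3_simps)

lemma reflect3_axis: "reflect3 (axis 1 1) = axis 1 1" "reflect3 (axis 3 1) = axis 3 1"
  by (simp_all add: vec_eq_iff forall_3 axis_def)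

lemma body_reflect: "body (reflect z) i = (reflect3 (fst (body z i)), reflect3 (snd (body z i)))"
  by (simp add: body_def reflect_def)

lemma angmom_reflect: "angmom (reflect z) i = - reflect3 (angmom z i)"
  by (simp add: angmom_def reflect_def reflect3_cross)

lemma S_reflect: "S (reflect z) j = - reflect3 (S z j)"
  by (simp add: S_def angmom_reflect reflect3_simps sum_negf)

text \<open>Uniqueness of the derivative makes the linear map \<open>D\<close> even. It is applied
  to rotations, for the conservation law, and to the reflection, for the equilibria.\<close>

lemma even_derivative_zero:
  fixes g :: "'a::real_normed_vector \<Rightarrow> 'b::real_normed_vector"
  assumes g: "(g has_derivative D) (at 0)" and even: "\<forall>\<^sub>F h in nhds 0. g (- h) = g h"
  shows "D = (\<lambda>h. 0)"
proof -
  have m: "((\<lambda>h :: 'a. - h) has_derivative (\<lambda>h. - h)) (at 0)"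
    by (intro has_derivative_minus has_derivative_ident)
  have "((\<lambda>h. g (- h)) has_derivative (\<lambda>h. D (- h))) (at 0)"
    using has_derivative_compose[OF m, of g D] g by simp
  moreover obtain T where T: "open T" "0 \<in> T" "\<And>h. h \<in> T \<Longrightarrow> g (- h) = g h"
    using even unfolding eventually_nhds by blast
  ultimately have "(g has_derivative (\<lambda>h. D (- h))) (at 0)"
    by (rule has_derivative_transform_within_open)
  then have "D = (\<lambda>h. D (- h))" using has_derivative_unique g by blast
  moreover have "D (- h) = - D h" for h
    using g by (simp add: has_derivative_bounded_linear bounded_linear.linear linear_neg)
  ultimately have "D h = - D h" for h by metis
  then have "2 *\<^sub>R D h = 0" for h by (metis add.right_inverse scaleR_2)
  then show ?thesis by auto
qed

section \<open>The reflection in the coordinates, conservation of C, planarity\<close>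

context planetary
begin

lemma lap_reflect: "lap i (reflect z) = reflect3 (lap i z)"
  unfolding lap_def laplace_def body_reflect fst_conv snd_conv reflect3_cross cross_minus_right norm_reflect3
  by (simp add: reflect3_simps)

lemma peri_reflect: "peri i (reflect z) = reflect3 (peri i z)"
  by (simp add: peri_def lap_reflect reflect3_simps)

lemma pre_reflect: "pre j (reflect z) = reflect3 (pre j z)"
  by (simp add: pre_def peri_reflect reflect3_axis)

lemma nu_reflect: "nu j (reflect z) = reflect3 (nu j z)"
  by (simp add: nu_def pre_reflect S_reflect reflect3_cross reflect3_simps)

lemma nn_reflect: "nn j (reflect z) = reflect3 (nn j z)"
  by (simp add: nn_def peri_reflect S_reflect reflect3_cross reflect3_simps)

lemma ref_reflect: "ref j (reflect z) = reflect3 (ref j z)"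
  by (simp add: ref_def nn_reflect reflect3_axis)

lemma reflect_region: "z \<in> reg \<Longrightarrow> reflect z \<in> reg"
  unfolding region_eq
  by (simp add: lap_reflect nu_reflect nn_reflect S_reflect bound_def body_reflect reflect3_cross no_collision_def)
    (simp add: reflect_def)

text \<open>\<Theta> pairs a pseudovector with a true vector and changes sign. An oriented angle
  changes sign when its axis is a true vector, as for \<theta>, and keeps it when the axis is a
  pseudovector, as for \<kappa>.\<close>

lemma reflect_coords:
  assumes z: "z \<in> reg"
  shows "cLam (reflect z) = cLam z" "c_chi (reflect z) = c_chi z"
    "cTheta (reflect z) = - cTheta z" "cEll (reflect z) = cEll z"
    "cKap (reflect z) = cKap z" "angle_cong (ctheta (reflect z)) (- ctheta z)"
proof -
  note z' = reflect_region[OF z]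
  have sma: "sma i (reflect z) = sma i z" for i by (simp add: sma_def kep_a_def body_reflect)
  show "cLam (reflect z) = cLam z" by (simp add: vec_eq_iff coords z z' sma)
  have "eccv i (reflect z) = eccv i z" for i
    by (simp add: eccv_def kep_ecc_def body_reflect reflect3_inner kep_a_def)
  then show "cEll (reflect z) = cEll z" by (simp add: vec_eq_iff coords z z')
  show "c_chi (reflect z) = c_chi z" by (simp add: c_chi_def S_reflect vec_eq_iff)
  show "cTheta (reflect z) = - cTheta z"
    by (simp add: vec_eq_iff coords z z' S_reflect pre_reflect reflect3_inner)
  have sSr: "sS j (reflect z) = - reflect3 (sS j z)" for j
    by (simp add: sS_def S_reflect reflect3_simps sgn_minus)
  show "cKap (reflect z) = cKap z"
    by (rule iffD2[OF vec_eq_iff])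
      (simp add: coords z z' oangle_def nu_reflect nn_reflect sSr reflect3_inner reflect3_cross)
  have "cis (oangle (pre j (reflect z)) (ref j (reflect z)) (nu j (reflect z))) = cis (- oangle (pre j z) (ref j z) (nu j z))" for j
  proof -
    have "cis (- oangle (pre j z) (ref j z) (nu j z)) = cnj (Complex (ref j z \<bullet> nu j z) (pre j z \<bullet> (ref j z \<times> nu j z)))"
      using z by (subst oangle_unit(1)[symmetric]) (auto simp: cis_cnj)
    moreover have "cis (oangle (pre j (reflect z)) (ref j (reflect z)) (nu j (reflect z))) =
        Complex (ref j (reflect z) \<bullet> nu j (reflect z)) (pre j (reflect z) \<bullet> (ref j (reflect z) \<times> nu j (reflect z)))"
      using z' by (intro oangle_unit(1)) auto
    ultimately show ?thesis
      by (simp add: pre_reflect ref_reflect nu_reflect reflect3_inner reflect3_cross complex_eq_iff)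
  qed
  then show "angle_cong (ctheta (reflect z)) (- ctheta z)"
    by (simp add: angle_cong_def coords z z' rcong_2pi_iff_cis)
qed

lemma H_hel_reflect: "H_hel m0 \<mu> m (reflect z) = H_hel m0 \<mu> m z"
  by (simp add: H_hel_def case_prod_unfold reflect_def reflect3_inner flip: reflect3_simps(2))

text \<open>
  Along the tangent \<open>w \<times> z\<close> of a rotation, \<open>H\<close> is an even function of the time
  up to which the tangent is followed, since only squares of norms and inner products enter.
\<close>

lemma H_hel_rotation_invariant:
  assumes D: "(H_hel m0 \<mu> m has_derivative D) (at z)"
  shows "D ((\<chi> i. w \<times> fst z $ i), (\<chi> i. w \<times> snd z $ i)) = 0"
proof -
  define v :: "'n phase" where "v = ((\<chi> i. w \<times> fst z $ i), (\<chi> i. w \<times> snd z $ i))"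
  define r where "r s a = a + s *\<^sub>R (w \<times> a)" for s and a :: "real^3"
  have r: "fst (z + s *\<^sub>R v) $ i = r s (fst z $ i)" "snd (z + s *\<^sub>R v) $ i = r s (snd z $ i)" for s i
    by (simp_all add: v_def r_def)
  have inner: "r (- s) a \<bullet> r (- s) b = r s a \<bullet> r s b" for s a b
  proof -
    have "a \<bullet> (w \<times> b) + (w \<times> a) \<bullet> b = 0"
      by (simp add: inner_cross_swap) (metis add.right_inverse cross_skew inner_minus_left)
    then have "(w \<times> a) \<bullet> b = - (a \<bullet> (w \<times> b))" by simp
    then show ?thesis by (simp add: r_def inner_simps algebra_simps)
  qed
  have norm: "norm (r (- s) a) = norm (r s a)" for s a by (simp add: norm_eq_sqrt_inner inner)
  have diff: "r s a - r s b = r s (a - b)" for s a b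
    by (simp add: r_def Cross3.right_diff_distrib algebra_simps)
  have "H_hel m0 \<mu> m (z + (- s) *\<^sub>R v) = H_hel m0 \<mu> m (z + s *\<^sub>R v)" for s
    unfolding H_hel_def case_prod_unfold r diff norm inner ..
  then have even: "\<forall>\<^sub>F s in nhds 0. H_hel m0 \<mu> m (z + (- s) *\<^sub>R v) = H_hel m0 \<mu> m (z + s *\<^sub>R v)" by simp
  have line: "((\<lambda>s. z + s *\<^sub>R v) has_derivative (\<lambda>s. s *\<^sub>R v)) (at 0)"
    by (auto intro!: derivative_eq_intros)
  have "((\<lambda>s. H_hel m0 \<mu> m (z + s *\<^sub>R v)) has_derivative (\<lambda>s. D (s *\<^sub>R v))) (at 0)"
    using has_derivative_compose[OF line, of "H_hel m0 \<mu> m" D] D by simp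
  from even_derivative_zero[OF this even] have "D (1 *\<^sub>R v) = 0" by meson
  then show ?thesis by (simp add: v_def)
qed

text \<open>Noether's argument: by Hamilton's equations the component along \<open>w\<close> of the
  velocity of C is minus the derivative of H along the infinitesimal rotation about
  \<open>w\<close>, which vanishes.\<close>

lemma total_angular_momentum_conserved:
  assumes J: "is_interval J" and motion: "hamiltonian_motion (H_hel m0 \<mu> m) J z" and st: "s \<in> J" "t \<in> J"
  shows "S (z s) first = S (z t) first"
proof -
  have S_first: "S w first = (\<Sum>i\<in>UNIV. snd w $ i \<times> fst w $ i)" for w :: "'n phase"
    using first_le by (auto simp: S_def angmom_def intro: sum.cong)
  have "((\<lambda>t. S (z t) first) has_vector_derivative 0) (at t within J)" if t: "t \<in> J" for t
  proof -
    obtain y' x' where z': "(z has_vector_derivative (y', x')) (at t within J)"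
      and H: "(H_hel m0 \<mu> m has_derivative (\<lambda>(\<eta>, \<xi>). x' \<bullet> \<eta> - y' \<bullet> \<xi>)) (at (z t))"
      using motion t unfolding hamiltonian_motion_def by blast
    have y: "((\<lambda>t. fst (z t) $ i) has_vector_derivative y' $ i) (at t within J)"
      and x: "((\<lambda>t. snd (z t) $ i) has_vector_derivative x' $ i) (at t within J)" for i
      using bounded_linear.has_vector_derivative[OF bounded_linear_compose[OF bounded_linear_vec_nth bounded_linear_fst] z']
        bounded_linear.has_vector_derivative[OF bounded_linear_compose[OF bounded_linear_vec_nth bounded_linear_snd] z'] by simp_all
    define c where "c = (\<Sum>i\<in>UNIV. snd (z t) $ i \<times> y' $ i + x' $ i \<times> fst (z t) $ i)"
    have "((\<lambda>t. S (z t) first) has_vector_derivative c) (at t within J)"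
      unfolding S_first c_def
      by (intro has_vector_derivative_sum bounded_bilinear.has_vector_derivative[OF bounded_bilinear_cross3] x y)
    moreover have "w \<bullet> c = 0" for w
    proof -
      have "x' \<bullet> (\<chi> i. w \<times> fst (z t) $ i) - y' \<bullet> (\<chi> i. w \<times> snd (z t) $ i) = 0"
        using H_hel_rotation_invariant[OF H, of w] by simp
      then have "(\<Sum>i\<in>UNIV. x' $ i \<bullet> (w \<times> fst (z t) $ i) - y' $ i \<bullet> (w \<times> snd (z t) $ i)) = 0"
        unfolding inner_vec_def[where 'a = "real^3"] by (simp add: sum_subtractf)
      moreover have "w \<bullet> (a \<times> b' + a' \<times> b) = - (a' \<bullet> (w \<times> b) - b' \<bullet> (w \<times> a))" for a b a' b' :: "real^3"
        by (simp add: cross3_simps)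
      then have "w \<bullet> c = - (\<Sum>i\<in>UNIV. x' $ i \<bullet> (w \<times> fst (z t) $ i) - y' $ i \<bullet> (w \<times> snd (z t) $ i))"
        unfolding c_def inner_sum_right by (simp only: sum_negf)
      ultimately show ?thesis by simp
    qed
    then have "c = 0" using inner_eq_zero_iff by blast
    ultimately show ?thesis by simp
  qed
  then obtain c where "\<And>t. t \<in> J \<Longrightarrow> S (z t) first = c"
    using has_vector_derivative_zero_constant[of J "\<lambda>t. S (z t) first"] is_interval_convex[OF J] by blast
  then show ?thesis using st by simp
qed

text \<open>If \<Theta> = 0, consecutive S are both orthogonal to the perihelion P between them; if
  sin \<theta> = 0, their products with P are parallel. Hence all S are parallel, and so are their
  differences C.\<close>

lemma planar_if_Theta_zero:
  assumes z: "z \<in> reg" and k: "\<And>j. k $ j \<in> {0, 1}" and \<Theta>: "cTheta z = 0"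
    and \<theta>: "angle_cong (ctheta z) (pi *\<^sub>R k)"
  shows "planar z"
proof -
  have par: "\<exists>c. S z j = c *\<^sub>R S z (prv j)" if j: "j \<noteq> first" for j
  proof -
    define p where "p = peri (prv j) z"
    have pre: "pre j z = p" "ref j z = nn (prv j) z" using j by (auto simp: pre_def ref_def p_def)
    have p1: "norm p = 1" using z by (simp add: p_def)
    have Sj: "S z j \<bullet> p = 0" using arg_cong[OF \<Theta>, of "\<lambda>v. v $ j"] by (simp add: coords[OF z] pre)
    then have Si: "S z (prv j) \<bullet> p = 0" using z by (simp add: S_prv[OF j] inner_simps p_def)
    have "sin (ctheta z $ j) = 0"
      using angle_congD[OF \<theta>, of j] k[of j] by (auto simp: rcong_2pi_iff_cis complex_eq_iff)
    then have nu: "nu j z = cos (ctheta z $ j) *\<^sub>R nn (prv j) z"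
      using nu_from[OF z, of j] by (simp add: pre)
    have e1: "p \<times> S z j = norm (p \<times> S z j) *\<^sub>R nu j z"
      using node_eqs(3)[OF z, of j] by (simp add: nu_def pre sgn_div_norm)
    have e2: "nn (prv j) z = (- inverse (norm (S z (prv j) \<times> p))) *\<^sub>R (p \<times> S z (prv j))"
      using prv_neq_final[OF j] by (simp add: nn_def p_def sgn_div_norm cross_skew[of "S z (prv j)"])
    obtain c where "p \<times> S z j = c *\<^sub>R (p \<times> S z (prv j))"
      using e1 unfolding nu e2 scaleR_scaleR by blast
    then have "p \<times> (S z j - c *\<^sub>R S z (prv j)) = 0" by (simp add: Cross3.right_diff_distrib cross_mult_right)
    from cross_eq_0_imp_parallel[OF p1 this] have "S z j - c *\<^sub>R S z (prv j) = 0"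
      by (simp add: inner_simps Sj Si)
    then show ?thesis by (intro exI[of _ c]) simp
  qed
  have S: "\<exists>c. S z j = c *\<^sub>R S z first" for j
  proof (induction j rule: prv_induct)
    case first
    show ?case by (intro exI[of _ 1]) simp
  next
    case (step j)
    then show ?case using par[OF step(1)] by (metis scaleR_scaleR)
  qed
  have "\<exists>c. angmom z i = c *\<^sub>R S z first" for i
  proof (cases "i = final")
    case False
    then obtain j where j: "j \<noteq> first" "i = prv j" using bij_betw_prv by (auto simp: bij_betw_def)
    then have "angmom z i = S z i - S z j" using S_prv[OF j(1), of z] by simp
    then show ?thesis using S[of i] S[of j] by (metis scaleR_diff_left)
  qed (use S[of final] S_final in metis)
  then show ?thesis unfolding planar_def by (metis cross_mult_left cross_mult_right cross_refl scaleR_zero_right)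
qed

section \<open>Differentiability of the perturbing function and its equilibria\<close>

lemma differentiable_H_hel:
  assumes "no_collision z"
  shows "H_hel m0 \<mu> m differentiable at z"
proof -
  have nz: "snd z $ i \<noteq> 0" "i \<noteq> j \<Longrightarrow> snd z $ i - snd z $ j \<noteq> 0" for i j
    using assms by (auto simp: no_collision_def)
  have m: "red_mass m0 \<mu> m i \<noteq> 0" "m0 \<noteq> 0" for i using mass_pos(1)[of i] m0_pos by auto
  have "(\<lambda>z. (\<Sum>i\<in>UNIV. (fst z $ i \<bullet> fst z $ i) / (2 * red_mass m0 \<mu> m i) - red_mass m0 \<mu> m i * tot_mass m0 \<mu> m i / norm (snd z $ i)) +
     \<mu> * (\<Sum>p\<in>{(i, j). i < j}. fst z $ fst p \<bullet> fst z $ snd p / m0 - m $ fst p * m $ snd p / norm (snd z $ fst p - snd z $ snd p))) differentiable at z"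
    using nz m
    by (intro differentiable_add differentiable_sum differentiable_mult differentiable_diff differentiable_divide
       differentiable_inner differentiable_const differentiable_momentum differentiable_position differentiable_norm_comp ballI)
      auto
  then show ?thesis by (simp add: H_hel_def[abs_def] case_prod_unfold dot_square_norm)
qed

text \<open>
  The inverse of a local chart is differentiable: the chart is injective and continuous,
  hence open by invariance of domain, and its derivative is injective because the symplectic form is nondegenerate.
\<close>

lemma local_inverse:
  assumes z: "z \<in> reg"
  obtains \<phi>l \<phi>\<kappa> \<phi>\<theta> :: "'n phase \<Rightarrow> 'n coord" and W g g' where
    "open W" "(cLam z, c_chi z, cTheta z, \<phi>l z, \<phi>\<kappa> z, \<phi>\<theta> z) \<in> W"
    "g (cLam z, c_chi z, cTheta z, \<phi>l z, \<phi>\<kappa> z, \<phi>\<theta> z) = z"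
    "(g has_derivative g') (at (cLam z, c_chi z, cTheta z, \<phi>l z, \<phi>\<kappa> z, \<phi>\<theta> z))"
    "\<And>\<Lambda> X T l K Q. (\<Lambda>, X, T, l, K, Q) \<in> W \<Longrightarrow> g (\<Lambda>, X, T, l, K, Q) \<in> reg \<and>
      cLam (g (\<Lambda>, X, T, l, K, Q)) = \<Lambda> \<and> c_chi (g (\<Lambda>, X, T, l, K, Q)) = X \<and>
      cTheta (g (\<Lambda>, X, T, l, K, Q)) = T \<and> angle_cong l (cEll (g (\<Lambda>, X, T, l, K, Q))) \<and>
      angle_cong K (cKap (g (\<Lambda>, X, T, l, K, Q))) \<and> angle_cong Q (ctheta (g (\<Lambda>, X, T, l, K, Q)))"
    "angle_cong (\<phi>l z) (cEll z)" "angle_cong (\<phi>\<kappa> z) (cKap z)" "angle_cong (\<phi>\<theta> z) (ctheta z)"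
proof -
  obtain V \<phi>l \<phi>\<kappa> \<phi>\<theta> d\<Lambda> d\<chi> d\<Theta> dl d\<kappa> d\<theta> where V: "open V" "z \<in> V" "V \<subseteq> reg"
    and cont: "continuous_on V \<phi>l" "continuous_on V \<phi>\<kappa>" "continuous_on V \<phi>\<theta>"
    and cong: "\<And>w. w \<in> V \<Longrightarrow> angle_cong (\<phi>l w) (cEll w)"
      "\<And>w. w \<in> V \<Longrightarrow> angle_cong (\<phi>\<kappa> w) (cKap w)"
      "\<And>w. w \<in> V \<Longrightarrow> angle_cong (\<phi>\<theta> w) (ctheta w)"
    and d: "(cLam has_derivative d\<Lambda>) (at z)" "(c_chi has_derivative d\<chi>) (at z)"
      "(cTheta has_derivative d\<Theta>) (at z)"
      "(\<phi>l has_derivative dl) (at z)" "(\<phi>\<kappa> has_derivative d\<kappa>) (at z)" "(\<phi>\<theta> has_derivative d\<theta>) (at z)"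
    and sympl: "\<And>u v. wedge d\<Lambda> dl u v + wedge d\<chi> d\<kappa> u v + wedge d\<Theta> d\<theta> u v = wedge fst snd u v"
    using local_chart[OF z] by metis
  define \<Phi> where "\<Phi> w = (cLam w, c_chi w, cTheta w, \<phi>l w, \<phi>\<kappa> w, \<phi>\<theta> w)" for w
  define D\<Phi> where "D\<Phi> h = (d\<Lambda> h, d\<chi> h, d\<Theta> h, dl h, d\<kappa> h, d\<theta> h)" for h
  have D\<Phi>: "(\<Phi> has_derivative D\<Phi>) (at z)"
    unfolding \<Phi>_def[abs_def] D\<Phi>_def[abs_def] by (intro has_derivative_Pair d)
  have c\<Phi>: "continuous_on V \<Phi>"
  proof -
    have "continuous_on reg (cLam)" "continuous_on reg (c_chi :: 'n phase \<Rightarrow> _)" "continuous_on reg (cTheta)"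
      by (blast intro: continuous_on_reg differentiableI c_Lambda_has_derivative c_chi_has_derivative c_Theta_has_derivative)+
    then show ?thesis
      unfolding \<Phi>_def[abs_def] using V(3) by (intro continuous_on_Pair cont) (auto intro: continuous_on_subset)
  qed
  have inj: "inj_on \<Phi> V"
  proof (rule inj_onI)
    fix w w' assume w: "w \<in> V" "w' \<in> V" and "\<Phi> w = \<Phi> w'"
    then have eqs: "cLam w = cLam w'" "c_chi w = c_chi w'" "cTheta w = cTheta w'"
      "\<phi>l w = \<phi>l w'" "\<phi>\<kappa> w = \<phi>\<kappa> w'" "\<phi>\<theta> w = \<phi>\<theta> w'" by (auto simp: \<Phi>_def)
    have wr: "w \<in> reg" "w' \<in> reg" using w V(3) by auto
    have "angle_cong (cEll w) (cEll w')" "angle_cong (cKap w) (cKap w')"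
      "angle_cong (ctheta w) (ctheta w')"
      using cong[OF w(1)] cong[OF w(2)] eqs angle_cong_sym angle_cong_trans by metis+
    then have "cEll w = cEll w'" "cKap w = cKap w'" "ctheta w = ctheta w'"
      by (blast intro: angle_cong_imp_eq cEll_bounds angle_bounds wr)+
    then show "w = w'" using inj_coords wr eqs by (auto simp: inj_on_def)
  qed
  \<comment> \<open>Six coordinate families of n members and the phase space both have dimension 6n.
    Composing with \<open>L\<close> turns the chart into a map of the phase space to itself, as the
    inverse function theorem and invariance of domain are applied.\<close>
  obtain L :: "'n coord \<times> 'n coord \<times> 'n coord \<times> 'n coord \<times> 'n coord \<times> 'n coord \<Rightarrow> 'n phase" and L'
    where L: "linear L" "linear L'" "\<And>p. L' (L p) = p" "\<And>q. L (L' q) = q"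
    by (rule isomorphisms_UNIV_UNIV[where 'M = "'n coord \<times> 'n coord \<times> 'n coord \<times> 'n coord \<times> 'n coord \<times> 'n coord" and 'N = "'n phase"]) auto
  have LD: "(L has_derivative L) F" for F
    using L(1) by (rule linear_imp_has_derivative)
  define f where "f w = L (\<Phi> w)" for w
  have f': "(f has_derivative (\<lambda>h. L (D\<Phi> h))) (at z)"
    unfolding f_def[abs_def] using has_derivative_compose[OF D\<Phi> LD] .
  have cf: "continuous_on V f"
    unfolding f_def[abs_def] using c\<Phi> L(1) by (intro continuous_on_compose2[OF linear_continuous_on[of L UNIV]])
     (auto simp: linear_linear)
  have inj_f: "inj_on f V" using inj L(3) unfolding f_def inj_on_def by metis
  have "inj (\<lambda>h. L (D\<Phi> h))"
  proof -
    have lin: "linear (\<lambda>h. L (D\<Phi> h))" using f' has_derivative_linear by blast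
    have "h = 0" if "L (D\<Phi> h) = 0" for h
    proof -
      have "D\<Phi> h = 0" using L(2,3) that linear_0 by metis
      then have "wedge fst snd h v = 0" for v :: "'n phase"
        using sympl[of h v] by (simp add: D\<Phi>_def wedge_def zero_prod_def)
      \<comment> \<open>On this vector the symplectic form gives the squared norm of
        \<open>h\<close>.\<close>
      then have "wedge fst snd h (- snd h, fst h) = 0" by blast
      then have "fst h \<bullet> fst h + snd h \<bullet> snd h = 0" by (simp add: wedge_def)
      then show "h = 0" by (simp add: add_nonneg_eq_0_iff prod_eq_iff)
    qed
    then show ?thesis using linear_injective_0[OF lin] by blast
  qed
  then obtain g' where g': "(\<lambda>h. L (D\<Phi> h)) \<circ> g' = id"
    using linear_injective_isomorphism[of "\<lambda>h. L (D\<Phi> h)"] f' has_derivative_linear by (metis (no_types, lifting) comp_apply eq_id_iff)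
  define g where "g p = inv_into V f (L p)" for p
  have gf: "inv_into V f (f w) = w" if "w \<in> V" for w using that inj_f by simp
  have "(inv_into V f has_derivative g') (at (L (\<Phi> z)))"
    unfolding f_def[symmetric] by (rule has_derivative_inverse_strong[OF V(1,2) cf gf f' g'])
  then have Dg: "(g has_derivative (\<lambda>h. g' (L h))) (at (\<Phi> z))"
    unfolding g_def[abs_def] by (rule has_derivative_compose[OF LD])
  define W where "W = L -` (f ` V)"
  have "open (f ` V)" by (rule invariance_of_domain[OF cf V(1) inj_f])
  then have "open W" unfolding W_def using L(1)
    by (intro continuous_open_vimage) (auto simp: linear_continuous_at linear_linear)
  moreover have "\<Phi> z \<in> W" using V(2) by (auto simp: W_def f_def)
  moreover have "g (\<Phi> z) = z" using gf[OF V(2)] by (simp add: g_def f_def)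
  moreover have gW: "g p \<in> V \<and> \<Phi> (g p) = p" if "p \<in> W" for p
  proof -
    from that obtain w where w: "w \<in> V" "L p = f w" by (auto simp: W_def)
    then have "g p = w" using gf by (simp add: g_def)
    moreover have "p = \<Phi> w" using w(2) L(3) unfolding f_def by metis
    ultimately show ?thesis using w(1) by simp
  qed
  have "g (\<Lambda>, X, T, l, K, Q) \<in> reg \<and>
      cLam (g (\<Lambda>, X, T, l, K, Q)) = \<Lambda> \<and> c_chi (g (\<Lambda>, X, T, l, K, Q)) = X \<and>
      cTheta (g (\<Lambda>, X, T, l, K, Q)) = T \<and> angle_cong l (cEll (g (\<Lambda>, X, T, l, K, Q))) \<and>
      angle_cong K (cKap (g (\<Lambda>, X, T, l, K, Q))) \<and> angle_cong Q (ctheta (g (\<Lambda>, X, T, l, K, Q)))"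
    if "(\<Lambda>, X, T, l, K, Q) \<in> W" for \<Lambda> X T l K Q
  proof -
    define w where "w = g (\<Lambda>, X, T, l, K, Q)"
    have w: "w \<in> V" "\<Phi> w = (\<Lambda>, X, T, l, K, Q)" using gW[OF that] by (simp_all add: w_def)
    then have "cLam w = \<Lambda>" "c_chi w = X" "cTheta w = T" "\<phi>l w = l" "\<phi>\<kappa> w = K" "\<phi>\<theta> w = Q"
      by (simp_all add: \<Phi>_def)
    then show ?thesis using cong[OF w(1)] w(1) V(3) by (auto simp flip: w_def)
  qed
  ultimately show thesis
    using that[of W \<phi>l \<phi>\<kappa> \<phi>\<theta> g, OF _ _ _ Dg[unfolded \<Phi>_def]] cong V(2) unfolding \<Phi>_def by blast
qed

text \<open>
  By the reflection, the perturbing function is even in \<open>(\<Theta>, \<vartheta> - \<pi> k)\<close>.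
\<close>

lemma perturbing_function_gradient:
  assumes f: "perturbing_function m0 \<mu> m f" and z: "z \<in> reg" and k: "\<And>j. k $ j \<in> {0, 1}"
    and \<Theta>: "bar (cTheta z) = 0" and \<theta>: "angle_cong (bar (ctheta z)) (bar (pi *\<^sub>R k))"
    and l: "angle_cong l (cEll z)" and \<kappa>: "angle_cong \<kappa> (cKap z)"
  shows "((\<lambda>(\<Theta>, \<theta>). f (c_chi z $ first) (cLam z) (bar (c_chi z)) (bar \<Theta>) l (bar \<kappa>) (bar \<theta>))
      has_derivative (\<lambda>_. 0)) (at (0, pi *\<^sub>R k))"
proof -
  define F where "F p = f (c_chi z $ first) (cLam z) (bar (c_chi z)) (bar (fst p)) l (bar \<kappa>) (bar (snd p))"
    for p :: "'n coord \<times> 'n coord"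
  obtain \<phi>l \<phi>\<kappa> \<phi>\<theta> :: "'n phase \<Rightarrow> 'n coord" and W g g' where W: "open W"
      "(cLam z, c_chi z, cTheta z, \<phi>l z, \<phi>\<kappa> z, \<phi>\<theta> z) \<in> W"
    and gz: "g (cLam z, c_chi z, cTheta z, \<phi>l z, \<phi>\<kappa> z, \<phi>\<theta> z) = z"
    and g': "(g has_derivative g') (at (cLam z, c_chi z, cTheta z, \<phi>l z, \<phi>\<kappa> z, \<phi>\<theta> z))"
    and g: "\<And>\<Lambda> X T l K Q. (\<Lambda>, X, T, l, K, Q) \<in> W \<Longrightarrow> g (\<Lambda>, X, T, l, K, Q) \<in> reg \<and>
      cLam (g (\<Lambda>, X, T, l, K, Q)) = \<Lambda> \<and> c_chi (g (\<Lambda>, X, T, l, K, Q)) = X \<and>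
      cTheta (g (\<Lambda>, X, T, l, K, Q)) = T \<and> angle_cong l (cEll (g (\<Lambda>, X, T, l, K, Q))) \<and>
      angle_cong K (cKap (g (\<Lambda>, X, T, l, K, Q))) \<and> angle_cong Q (ctheta (g (\<Lambda>, X, T, l, K, Q)))"
    and cong: "angle_cong (\<phi>l z) (cEll z)" "angle_cong (\<phi>\<kappa> z) (cKap z)" "angle_cong (\<phi>\<theta> z) (ctheta z)"
    using local_inverse[OF z] by metis
  \<comment> \<open>Only the barred components are moved. The components with number 0 keep the
    values they have at \<open>z\<close>, and the base point \<open>p0\<close> corresponds to
    \<open>z\<close> itself.\<close>
  define T where "T \<Theta> = cTheta z + bar \<Theta>" for \<Theta>
  define Q where "Q \<theta> = \<phi>\<theta> z + bar \<theta> - bar (pi *\<^sub>R k)" for \<theta>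
  define q where "q p = (cLam z, c_chi z, T (fst p), \<phi>l z, \<phi>\<kappa> z, Q (snd p))" for p :: "'n coord \<times> 'n coord"
  define p0 :: "'n coord \<times> 'n coord" where "p0 = (0, pi *\<^sub>R k)"
  have bar0: "bar 0 = (0 :: 'n coord)" by (simp add: bar_def vec_eq_iff)
  have q0: "q p0 = (cLam z, c_chi z, cTheta z, \<phi>l z, \<phi>\<kappa> z, \<phi>\<theta> z)"
    by (simp add: q_def p0_def T_def Q_def bar0)
  have lin: "bounded_linear (bar :: 'n coord \<Rightarrow> _)"
    unfolding linear_conv_bounded_linear[symmetric] by (rule linearI) (simp_all add: bar_def vec_eq_iff)
  have "(q has_derivative (\<lambda>h. (0, 0, bar (fst h), 0, 0, bar (snd h)))) (at p)" for p
  proof -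
    have "((\<lambda>p :: 'n coord \<times> 'n coord. bar (fst p)) has_derivative (\<lambda>h. bar (fst h))) (at p)"
      "((\<lambda>p :: 'n coord \<times> 'n coord. bar (snd p)) has_derivative (\<lambda>h. bar (snd h))) (at p)"
      by (intro bounded_linear.has_derivative[OF lin] bounded_linear_imp_has_derivative bounded_linear_fst bounded_linear_snd)+
    note bd = this
    have "((\<lambda>p. T (fst p)) has_derivative (\<lambda>h. bar (fst h))) (at p)" "((\<lambda>p. Q (snd p)) has_derivative (\<lambda>h. bar (snd h))) (at p)"
      unfolding T_def Q_def by (rule derivative_eq_intros bd refl | simp)+
    then show ?thesis unfolding q_def[abs_def] by (intro has_derivative_Pair has_derivative_const)
  qed
  note q' = this
  obtain H' where H': "(H_hel m0 \<mu> m has_derivative H') (at z)"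
    using differentiable_H_hel[OF regD(1)[OF z]] by (auto simp: differentiable_def)
  define w where "w p = g (q p)" for p
  have w0: "w p0 = z" by (simp add: w_def q0 gz)
  define U where "U = q -` W"
  have U: "open U" "p0 \<in> U"
  proof -
    show "open U" unfolding U_def using q' W(1) by (intro continuous_open_vimage) (auto intro: has_derivative_continuous)
    show "p0 \<in> U" unfolding U_def by (simp add: q0 W)
  qed
  have w: "w p \<in> reg" "cLam (w p) = cLam z" "c_chi (w p) = c_chi z"
    "cTheta (w p) = T (fst p)" "angle_cong (\<phi>l z) (cEll (w p))" "angle_cong (\<phi>\<kappa> z) (cKap (w p))"
    "angle_cong (Q (snd p)) (ctheta (w p))" if "p \<in> U" for p
    using g[of "cLam z" "c_chi z" "T (fst p)" "\<phi>l z" "\<phi>\<kappa> z" "Q (snd p)"] that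
    by (auto simp: U_def q_def w_def)
  have bT: "bar (T \<Theta>) = bar \<Theta>" for \<Theta>
    using \<Theta> by (simp add: T_def bar_def vec_eq_iff) metis
  have th: "[\<theta>' $ j = ctheta (w (\<Theta>', \<theta>')) $ j] (rmod (2 * pi))" if "(\<Theta>', \<theta>') \<in> U" "j \<noteq> first" for \<Theta>' \<theta>' j
  proof -
    have "[pi * k $ j = \<phi>\<theta> z $ j] (rmod (2 * pi))"
      using angle_congD[OF \<theta>, of j] angle_congD[OF cong(3), of j] that(2) by (simp add: bar_def rcong_def)
    then have "[pi * k $ j + (\<theta>' $ j - pi * k $ j) = \<phi>\<theta> z $ j + (\<theta>' $ j - pi * k $ j)] (rmod (2 * pi))"
      by (simp only: rcong_add_right_cancel)
    then have "[\<theta>' $ j = Q \<theta>' $ j] (rmod (2 * pi))" using that(2) by (simp add: Q_def bar_def algebra_simps)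
    also have "[Q \<theta>' $ j = ctheta (w (\<Theta>', \<theta>')) $ j] (rmod (2 * pi))"
      using angle_congD[OF w(7)[OF that(1)], of j] by simp
    finally show ?thesis .
  qed
  have H_F: "H_hel m0 \<mu> m w' = h_K m0 \<mu> m (cLam z) + \<mu> * F (\<Theta>', \<theta>')"
    if "w' \<in> reg" "cLam w' = cLam z" "c_chi w' = c_chi z" "bar (cTheta w') = bar \<Theta>'"
      "angle_cong (\<phi>l z) (cEll w')" "angle_cong (\<phi>\<kappa> z) (cKap w')"
      "\<And>j. j \<noteq> first \<Longrightarrow> [\<theta>' $ j = ctheta w' $ j] (rmod (2 * pi))" for w' \<Theta>' \<theta>'
  proof -
    \<comment> \<open>\<open>perturbing_function\<close> wants representatives of all angles; the
      entry at \<open>first\<close> is filled with the true coordinate, which \<open>bar\<close>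
      then erases.\<close>
    define t where "t = (\<chi> j. if j = first then ctheta w' $ j else \<theta>' $ j)"
    have "bar t = bar \<theta>'" by (simp add: bar_def t_def vec_eq_iff)
    moreover have "angle_cong t (ctheta w')" using that(7) by (simp add: angle_cong_def t_def)
    moreover have "angle_cong l (cEll w')" "angle_cong \<kappa> (cKap w')"
      using l \<kappa> cong(1,2) that(5,6) angle_cong_trans angle_cong_sym by metis+
    ultimately have "H_hel m0 \<mu> m w' = h_K m0 \<mu> m (cLam w') + \<mu> * f (c_chi w' $ first) (cLam w')
        (bar (c_chi w')) (bar (cTheta w')) l (bar \<kappa>) (bar \<theta>')"
      using f that(1) unfolding perturbing_function_def by metis
    then show ?thesis by (simp add: that F_def)
  qed
  have F_eq: "F p = (H_hel m0 \<mu> m (w p) - h_K m0 \<mu> m (cLam z)) / \<mu>" if p: "p \<in> U" for p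
  proof -
    have "(fst p, snd p) \<in> U" using p by simp
    then have "H_hel m0 \<mu> m (w p) = h_K m0 \<mu> m (cLam z) + \<mu> * F (fst p, snd p)"
      using p th[of "fst p" "snd p"] by (intro H_F) (simp_all add: w bT)
    then show ?thesis using \<mu>_pos by simp
  qed
  \<comment> \<open>Reflecting the configuration that realises \<open>p\<close> negates the barred
    \<Theta> and \<theta>, and \<open>2 * pi * k\<close> is congruent to 0. So the point symmetric
    to \<open>p\<close> about \<open>p0\<close> is realised with the same energy.\<close>
  have F_even: "F (- fst p, 2 *\<^sub>R (pi *\<^sub>R k) - snd p) = F p" if p: "p \<in> U" for p
  proof -
    note rc = reflect_coords[OF w(1)[OF p]]
    have "bar (- v) = - bar v" for v :: "'n coord" by (simp add: bar_def vec_eq_iff)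
    then have bT': "bar (cTheta (reflect (w p))) = bar (- fst p)" by (simp add: rc w[OF p] bT)
    have "[(2 *\<^sub>R (pi *\<^sub>R k) - snd p) $ j = ctheta (reflect (w p)) $ j] (rmod (2 * pi))" if "j \<noteq> first" for j
    proof -
      have "[(2 *\<^sub>R (pi *\<^sub>R k) - snd p) $ j = - snd p $ j] (rmod (2 * pi))"
        unfolding rcong_2pi_iff using k[of j] by (auto intro: exI[of _ 0] exI[of _ 1])
      also have "[- snd p $ j = - ctheta (w p) $ j] (rmod (2 * pi))"
        using th[of "fst p" "snd p" j] p that by simp
      also have "[- ctheta (w p) $ j = ctheta (reflect (w p)) $ j] (rmod (2 * pi))"
        using angle_congD[OF rc(6), of j] by (simp add: rcong_sym)
      finally show ?thesis .
    qed
    then have "H_hel m0 \<mu> m (reflect (w p)) = h_K m0 \<mu> m (cLam z) + \<mu> * F (- fst p, 2 *\<^sub>R (pi *\<^sub>R k) - snd p)"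
      using w[OF p] bT' by (intro H_F) (simp_all add: rc reflect_region)
    then show ?thesis using \<mu>_pos by (simp add: H_hel_reflect F_eq[OF p])
  qed
  \<comment> \<open>Regularity enters here: near \<open>p0\<close> the function \<open>F\<close> is,
    up to constants, H composed with the inverse chart and an affine map.\<close>
  have "(w has_derivative (\<lambda>h. g' (0, 0, bar (fst h), 0, 0, bar (snd h)))) (at p0)"
    unfolding w_def[abs_def] using has_derivative_compose[OF q', of g g'] g' by (simp add: q0)
  from has_derivative_compose[OF this, of "H_hel m0 \<mu> m" H'] H'
  have "((\<lambda>p. H_hel m0 \<mu> m (w p)) has_derivative (\<lambda>h. H' (g' (0, 0, bar (fst h), 0, 0, bar (snd h))))) (at p0)"
    by (simp add: w0)
  then have "((\<lambda>p. (H_hel m0 \<mu> m (w p) - h_K m0 \<mu> m (cLam z)) / \<mu>) has_derivative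
      (\<lambda>h. (H' (g' (0, 0, bar (fst h), 0, 0, bar (snd h))) - 0) / \<mu>)) (at p0)"
    by (intro bounded_linear.has_derivative[OF bounded_linear_divide] has_derivative_diff has_derivative_const)
  then obtain D where D: "(F has_derivative D) (at p0)"
    using has_derivative_transform_within_open[OF _ U] F_eq by (metis (no_types, lifting))
  have shift: "((\<lambda>h. p0 + h) has_derivative (\<lambda>h. h)) (at 0)" by (auto intro!: derivative_eq_intros)
  have "((\<lambda>h. F (p0 + h)) has_derivative D) (at 0)"
    using has_derivative_compose[OF shift, of F D] D by simp
  moreover have "\<forall>\<^sub>F h in nhds 0. F (p0 + - h) = F (p0 + h)"
  proof -
    have "open ((\<lambda>h. p0 + h) -` U)" by (intro continuous_open_vimage U continuous_intros)
    moreover have "F (p0 + - h) = F (p0 + h)" if "h \<in> (\<lambda>h. p0 + h) -` U" for h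
    proof -
      have "p0 + - h = (- fst (p0 + h), 2 *\<^sub>R (pi *\<^sub>R k) - snd (p0 + h))"
        by (simp add: p0_def prod_eq_iff vec_eq_iff)
      then show ?thesis using F_even[of "p0 + h"] that by simp
    qed
    ultimately show ?thesis using U(2) unfolding eventually_nhds by (intro exI[of _ "(\<lambda>h. p0 + h) -` U"]) auto
  qed
  ultimately have "D = (\<lambda>h. 0)" by (rule even_derivative_zero)
  with D show ?thesis by (simp add: F_def[abs_def] p0_def case_prod_unfold)
qed

end

text \<open>Injectivity in (1) makes these functions coordinates, and the canonical identity is
  evaluated on tangent vectors, with lifts for the angles. In the gradient statement only the barred
  \<Theta> and \<theta> sit at the equilibrium; \<Theta>0 and \<theta>0 are free.\<close>

theorem proposition3p1:
  fixes m0 \<mu> :: real and m :: "'n::{finite,linorder} coord"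
  assumes n: "CARD('n) \<ge> 2"
    and pos: "m0 > 0" "\<mu> > 0" "\<And>i. m $ i > 0"
  shows
    "\<comment> \<open>(1)\<close>
     inj_on (\<lambda>z. (c_Lambda m0 \<mu> m z, c_chi z, c_Theta m0 \<mu> m z,
                  c_ell m0 \<mu> m z, c_kappa m0 \<mu> m z, c_theta m0 \<mu> m z)) (region m0 \<mu> m) \<and>
     (\<forall>z\<in>region m0 \<mu> m. \<exists>d\<Lambda> d\<chi> d\<Theta> dl d\<kappa> d\<theta>.
        (c_Lambda m0 \<mu> m has_derivative d\<Lambda>) (at z) \<and>
        (c_chi has_derivative d\<chi>) (at z) \<and>
        (c_Theta m0 \<mu> m has_derivative d\<Theta>) (at z) \<and>
        angle_has_derivative (c_ell m0 \<mu> m) dl z \<and>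
        angle_has_derivative (c_kappa m0 \<mu> m) d\<kappa> z \<and>
        angle_has_derivative (c_theta m0 \<mu> m) d\<theta> z \<and>
        (\<forall>u v. wedge d\<Lambda> dl u v + wedge d\<chi> d\<kappa> u v + wedge d\<Theta> d\<theta> u v = wedge fst snd u v)) \<and>
     \<comment> \<open>(2)\<close>
     (\<forall>J z. is_interval J \<and> z ` J \<subseteq> region m0 \<mu> m \<and> hamiltonian_motion (H_hel m0 \<mu> m) J z \<longrightarrow>
        (\<forall>s\<in>J. \<forall>t\<in>J. c_Theta m0 \<mu> m (z s) $ first = c_Theta m0 \<mu> m (z t) $ first \<and>
                       c_theta m0 \<mu> m (z s) $ first = c_theta m0 \<mu> m (z t) $ first \<and>
                       c_chi (z s) $ first = c_chi (z t) $ first)) \<and>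
     (\<exists>f. perturbing_function m0 \<mu> m f) \<and>
     \<comment> \<open>(3)\<close>
     (\<forall>z\<in>region m0 \<mu> m. reflect z \<in> region m0 \<mu> m \<and>
        c_Lambda m0 \<mu> m (reflect z) = c_Lambda m0 \<mu> m z \<and>
        c_chi (reflect z) = c_chi z \<and>
        c_Theta m0 \<mu> m (reflect z) = - c_Theta m0 \<mu> m z \<and>
        c_ell m0 \<mu> m (reflect z) = c_ell m0 \<mu> m z \<and>
        c_kappa m0 \<mu> m (reflect z) = c_kappa m0 \<mu> m z \<and>
        angle_cong (c_theta m0 \<mu> m (reflect z)) (- c_theta m0 \<mu> m z)) \<and>
     \<comment> \<open>(4)\<close>
     (\<forall>z\<in>region m0 \<mu> m. \<forall>k. (\<forall>j. k $ j \<in> {0, 1}) \<and>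
        c_Theta m0 \<mu> m z = 0 \<and> angle_cong (c_theta m0 \<mu> m z) (pi *\<^sub>R k) \<longrightarrow> planar z) \<and>
     (\<forall>f. perturbing_function m0 \<mu> m f \<longrightarrow>
        (\<forall>z\<in>region m0 \<mu> m. \<forall>k l \<kappa>. (\<forall>j. k $ j \<in> {0, 1}) \<and>
           bar (c_Theta m0 \<mu> m z) = 0 \<and>
           angle_cong (bar (c_theta m0 \<mu> m z)) (bar (pi *\<^sub>R k)) \<and>
           angle_cong l (c_ell m0 \<mu> m z) \<and> angle_cong \<kappa> (c_kappa m0 \<mu> m z) \<longrightarrow>
           ((\<lambda>(\<Theta>, \<theta>). f (c_chi z $ first) (c_Lambda m0 \<mu> m z) (bar (c_chi z)) (bar \<Theta>)
                             l (bar \<kappa>) (bar \<theta>))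
              has_derivative (\<lambda>_. 0)) (at (0, pi *\<^sub>R k))))"
proof (intro conjI)
  interpret planetary m0 \<mu> m using pos by unfold_locales auto
  show "inj_on (\<lambda>z. (c_Lambda m0 \<mu> m z, c_chi z, c_Theta m0 \<mu> m z,
      c_ell m0 \<mu> m z, c_kappa m0 \<mu> m z, c_theta m0 \<mu> m z)) (region m0 \<mu> m)"
    by (rule inj_coords)
  show "\<forall>z\<in>region m0 \<mu> m. \<exists>d\<Lambda> d\<chi> d\<Theta> dl d\<kappa> d\<theta>.
      (c_Lambda m0 \<mu> m has_derivative d\<Lambda>) (at z) \<and> (c_chi has_derivative d\<chi>) (at z) \<and>
      (c_Theta m0 \<mu> m has_derivative d\<Theta>) (at z) \<and> angle_has_derivative (c_ell m0 \<mu> m) dl z \<and>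
      angle_has_derivative (c_kappa m0 \<mu> m) d\<kappa> z \<and> angle_has_derivative (c_theta m0 \<mu> m) d\<theta> z \<and>
      (\<forall>u v. wedge d\<Lambda> dl u v + wedge d\<chi> d\<kappa> u v + wedge d\<Theta> d\<theta> u v = wedge fst snd u v)"
  proof
    fix z assume z: "z \<in> region m0 \<mu> m"
    have lift: "angle_has_derivative \<alpha> D z"
      if "open V" "z \<in> V" "\<And>w. w \<in> V \<Longrightarrow> angle_cong (\<phi> w) (\<alpha> w)" "(\<phi> has_derivative D) (at z)"
      for \<alpha> \<phi> :: "'n phase \<Rightarrow> 'n coord" and D V
      using that unfolding angle_has_derivative_def eventually_nhds by blast
    show "\<exists>d\<Lambda> d\<chi> d\<Theta> dl d\<kappa> d\<theta>.
      (c_Lambda m0 \<mu> m has_derivative d\<Lambda>) (at z) \<and> (c_chi has_derivative d\<chi>) (at z) \<and>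
      (c_Theta m0 \<mu> m has_derivative d\<Theta>) (at z) \<and> angle_has_derivative (c_ell m0 \<mu> m) dl z \<and>
      angle_has_derivative (c_kappa m0 \<mu> m) d\<kappa> z \<and> angle_has_derivative (c_theta m0 \<mu> m) d\<theta> z \<and>
      (\<forall>u v. wedge d\<Lambda> dl u v + wedge d\<chi> d\<kappa> u v + wedge d\<Theta> d\<theta> u v = wedge fst snd u v)"
      by (rule local_chart[OF z], intro exI conjI allI) (assumption | rule lift)+
  qed
  show "\<forall>J z. is_interval J \<and> z ` J \<subseteq> region m0 \<mu> m \<and> hamiltonian_motion (H_hel m0 \<mu> m) J z \<longrightarrow>
      (\<forall>s\<in>J. \<forall>t\<in>J. c_Theta m0 \<mu> m (z s) $ first = c_Theta m0 \<mu> m (z t) $ first \<and>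
        c_theta m0 \<mu> m (z s) $ first = c_theta m0 \<mu> m (z t) $ first \<and> c_chi (z s) $ first = c_chi (z t) $ first)"
    \<comment> \<open>All three coordinates with number 0 are functions of C and the fixed
      axes.\<close>
    using total_angular_momentum_conserved
    by (simp add: c_Theta_def c_theta_def c_chi_def node_nu_def) metis
  show "\<exists>f. perturbing_function m0 \<mu> m f" by (rule perturbing_function_exists)
  show "\<forall>z\<in>region m0 \<mu> m. reflect z \<in> region m0 \<mu> m \<and>
      c_Lambda m0 \<mu> m (reflect z) = c_Lambda m0 \<mu> m z \<and> c_chi (reflect z) = c_chi z \<and>
      c_Theta m0 \<mu> m (reflect z) = - c_Theta m0 \<mu> m z \<and> c_ell m0 \<mu> m (reflect z) = c_ell m0 \<mu> m z \<and>
      c_kappa m0 \<mu> m (reflect z) = c_kappa m0 \<mu> m z \<and>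
      angle_cong (c_theta m0 \<mu> m (reflect z)) (- c_theta m0 \<mu> m z)"
    by (simp add: reflect_region reflect_coords)
  show "\<forall>z\<in>region m0 \<mu> m. \<forall>k. (\<forall>j. k $ j \<in> {0, 1}) \<and> c_Theta m0 \<mu> m z = 0 \<and>
      angle_cong (c_theta m0 \<mu> m z) (pi *\<^sub>R k) \<longrightarrow> planar z"
    using planar_if_Theta_zero by blast
  show "\<forall>f. perturbing_function m0 \<mu> m f \<longrightarrow>
      (\<forall>z\<in>region m0 \<mu> m. \<forall>k l \<kappa>. (\<forall>j. k $ j \<in> {0, 1}) \<and> bar (c_Theta m0 \<mu> m z) = 0 \<and>
         angle_cong (bar (c_theta m0 \<mu> m z)) (bar (pi *\<^sub>R k)) \<and>
         angle_cong l (c_ell m0 \<mu> m z) \<and> angle_cong \<kappa> (c_kappa m0 \<mu> m z) \<longrightarrow>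
         ((\<lambda>(\<Theta>, \<theta>). f (c_chi z $ first) (c_Lambda m0 \<mu> m z) (bar (c_chi z)) (bar \<Theta>) l (bar \<kappa>) (bar \<theta>))
            has_derivative (\<lambda>_. 0)) (at (0, pi *\<^sub>R k)))"
    using perturbing_function_gradient by blast
qed

end
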